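(* Let $L$ be a Tonelli Lagrangian on $\mathbb{R}^n\times\mathbb{R}^n$, with fundamental solution $A_t(x,y)$. For any $\lambda>0$ there exists $t_\lambda>0$ such that, setting for $x\in\mathbb{R}^n$ $$S_\lambda(x,t_\lambda):=\{(t,y)\in\mathbb{R}\times\mathbb{R}^n:\ 0<t<t_\lambda,\ |y-x|<\lambda t\},$$ the following hold. (a) For any $x\in\mathbb{R}^n$ the function $(t,y)\mapsto A_t(x,y)$ is semiconvex on $S_\lambda(x,t_\lambda)$, in the sense that there exists $C_\lambda>0$ such that for all $x\in\mathbb{R}^n$, all $(t,y)\in S_\lambda(x,t_\lambda)$, all $h\in[0,t/2)$ and all $z\in B(0,\lambda t)$, $$A_{t+h}(x,y+z)+A_{t-h}(x,y-z)-2A_t(x,y)\geqslant-\frac{C_\lambda}{t}(h^2+|z|^2).$$ (b) For all $t\in(0,t_\lambda]$, $A_t(x,\cdot)$ is uniformly convex on $B(x,\lambda t)$, in the sense that there exists $C'_\lambda>0$ (independent of $t\in(0,t_\lambda]$ and $x$) such that for all $x\in\mathbb{R}^n$, all $y\in B(x,\lambda t)$ and all $z\in B(0,\lambda t)$, $$A_t(x,y+z)+A_t(x,y-z)-2A_t(x,y)\geqslant\frac{C'_\lambda}{t}|z|^2.$$ (c) For any $x\in\mathbb{R}^n$ the functions $(t,y)\mapsto A_t(x,y)$ and $(t,y)\mapsto A_t(y,x)$ are of class $C^{1,1}_{\mathrm{loc}}$ on $S_\lambda(x,t_\lambda)$.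
   Context: A function $\theta:[0,+\infty)\to[0,+\infty)$ is superlinear if $\theta(r)/r\to+\infty$ as $r\to+\infty$. A Tonelli Lagrangian is a $C^2$ function $L(x,v)$ on $\mathbb{R}^n\times\mathbb{R}^n$ such that: (1) there is a nonincreasing $\nu:[0,+\infty)\to(0,+\infty)$ with $L_{vv}(x,v)\geqslant\nu(|v|)I$ for all $(x,v)$; (2) there are superlinear functions $\theta,\overline\theta:[0,+\infty)\to[0,+\infty)$ and $c_0>0$ with $\overline\theta(|v|)\geqslant L(x,v)\geqslant\theta(|v|)-c_0$ for all $(x,v)$; (3) there is a nondecreasing $K:[0,+\infty)\to[0,+\infty)$ with $|D^\alpha L(x,v)|\leqslant K(|v|)$ for all $(x,v)$ and every multi-index with $|\alpha|=1,2$. The fundamental solution is $A_t(x,y)=\inf\{\int_0^tL(\gamma(s),\dot\gamma(s))\,ds:\ \gamma\in W^{1,1}([0,t];\mathbb{R}^n),\ \gamma(0)=x,\ \gamma(t)=y\}$ for $t>0$, $x,y\in\mathbb{R}^n$. $B(x,r)$ is the open ball of center $x$ and radius $r$. $C^{1,1}_{\mathrm{loc}}$ means $C^1$ with locally Lipschitz gradient. *)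

theory Defs
  imports "HOL-Analysis.Analysis"
begin

definition superlinear :: "(real \<Rightarrow> real) \<Rightarrow> bool" where
  "superlinear \<theta> \<longleftrightarrow> (\<forall>r\<ge>0. 0 \<le> \<theta> r) \<and> filterlim (\<lambda>r. \<theta> r / r) at_top at_top"

definition C2_with_derivs ::
  "('a::euclidean_space \<Rightarrow> real) \<Rightarrow> ('a \<Rightarrow> 'a \<Rightarrow>\<^sub>L real) \<Rightarrow> ('a \<Rightarrow> 'a \<Rightarrow>\<^sub>L 'a \<Rightarrow>\<^sub>L real) \<Rightarrow> bool" where
  "C2_with_derivs F DF D2F \<longleftrightarrow>
     (\<forall>p. (F has_derivative blinfun_apply (DF p)) (at p)) \<and>
     (\<forall>p. (DF has_derivative blinfun_apply (D2F p)) (at p)) \<and>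
     continuous_on UNIV D2F"

text \<open>
  The partial derivatives of order one and two in all 2n variables are the values of
  the derivatives on the standard basis of the product space; the Hessian in the velocity
  is the second derivative restricted to directions of the form (0, w).
\<close>

definition tonelli_lagrangian :: "(real^'n \<Rightarrow> real^'n \<Rightarrow> real) \<Rightarrow> bool" where
  "tonelli_lagrangian L \<longleftrightarrow>
    (\<exists>DL D2L. C2_with_derivs (\<lambda>(x, v). L x v) DL D2L \<and>
      (\<exists>\<nu>. antimono_on {0..} \<nu> \<and> (\<forall>r\<ge>0. 0 < \<nu> r) \<and>
         (\<forall>x v w. D2L (x, v) (0, w) (0, w) \<ge> \<nu> (norm v) * (norm w)\<^sup>2)) \<and>
      (\<exists>\<theta> \<theta>' c\<^sub>0. superlinear \<theta> \<and> superlinear \<theta>' \<and> c\<^sub>0 > 0 \<and>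
         (\<forall>x v. \<theta>' (norm v) \<ge> L x v \<and> L x v \<ge> \<theta> (norm v) - c\<^sub>0)) \<and>
      (\<exists>K. mono_on {0..} K \<and> (\<forall>r\<ge>0. 0 \<le> K r) \<and>
         (\<forall>x v. (\<forall>b\<in>Basis. \<bar>DL (x, v) b\<bar> \<le> K (norm v)) \<and>
                (\<forall>b\<in>Basis. \<forall>b'\<in>Basis. \<bar>D2L (x, v) b b'\<bar> \<le> K (norm v)))))"

text \<open>
  \<open>W11 t \<gamma> g\<close>: on the interval from 0 to t, \<open>\<gamma>\<close> is the continuous representative of an
  element of the Sobolev space of exponents (1,1), and \<open>g\<close> is its weak derivative, tested
  against C1 functions with compact support in the open interval. The continuous
  representative is what gives \<open>\<gamma> 0\<close> and \<open>\<gamma> t\<close> a meaning.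
\<close>

definition W11 :: "real \<Rightarrow> (real \<Rightarrow> 'a::euclidean_space) \<Rightarrow> (real \<Rightarrow> 'a) \<Rightarrow> bool" where
  "W11 t \<gamma> g \<longleftrightarrow>
     continuous_on {0..t} \<gamma> \<and> g absolutely_integrable_on {0..t} \<and>
     (\<forall>\<phi> \<phi>'. (\<forall>s. (\<phi> has_real_derivative \<phi>' s) (at s)) \<and> continuous_on UNIV \<phi>' \<and>
        closure {s. \<phi> s \<noteq> 0} \<subseteq> {0<..<t} \<longrightarrow>
        integral {0..t} (\<lambda>s. \<phi>' s *\<^sub>R \<gamma> s) = - integral {0..t} (\<lambda>s. \<phi> s *\<^sub>R g s))"

text \<open>
  A Tonelli Lagrangian is continuous and bounded below, so the action of every curve is well
  defined, and it is \<open>+\<infinity>\<close> exactly when the integrand is not absolutely integrable. Such curves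
  do not affect the infimum and are left out; the remaining set of actions is nonempty and
  bounded below for t > 0.
\<close>

definition fund_sol ::
  "(real^'n \<Rightarrow> real^'n \<Rightarrow> real) \<Rightarrow> real \<Rightarrow> real^'n \<Rightarrow> real^'n \<Rightarrow> real" where
  "fund_sol L t x y =
     Inf {integral {0..t} (\<lambda>s. L (\<gamma> s) (g s)) | \<gamma> g.
            W11 t \<gamma> g \<and> \<gamma> 0 = x \<and> \<gamma> t = y \<and>
            (\<lambda>s. L (\<gamma> s) (g s)) absolutely_integrable_on {0..t}}"

definition S_cone :: "real \<Rightarrow> real^'n \<Rightarrow> real \<Rightarrow> (real \<times> (real^'n)) set" where
  "S_cone lam x T = {(t, y). 0 < t \<and> t < T \<and> norm (y - x) < lam * t}"

definition C11_loc :: "('a::euclidean_space \<Rightarrow> real) \<Rightarrow> 'a set \<Rightarrow> bool" where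
  "C11_loc f S \<longleftrightarrow>
     (\<exists>G. (\<forall>p\<in>S. GDERIV f p :> G p) \<and> continuous_on S G \<and>
          (\<forall>p\<in>S. \<exists>r>0. \<exists>C. C-lipschitz_on (ball p r \<inter> S) G))"

end

theory Submission
  imports Defs
begin

text \<open>
  Curves are discretized: for velocities \<open>v 0, \<dots>, v (N - 1)\<close> on a uniform grid of \<open>{0..t}\<close>, the
  action becomes a finite sum, which has an exact minimizer among velocities of norm at most \<open>R\<close>.
  Comparing such a minimizer with the one obtained by moving two of its velocities towards each other
  shows that, for short times, its velocities differ by less than 1. They therefore stay away from the
  constraint, and the minimizer satisfies a discrete Euler-Lagrange equation. Convexity in the velocity
  then makes it calibrate: every Sobolev curve with the same end points has at least the same action, up to
  a multiple of \<open>1 / N\<close>. So the fundamental solution is the limit of the discrete minima, taken over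
  velocities that are bounded uniformly in \<open>N\<close>.

  Bounds from below for second differences follow by testing with the average of the minimizers at the
  two outer points, bounds from above by perturbing the minimizer at the centre affinely. Both
  end points and the time may vary. A locally bounded function whose second differences are of quadratic
  size is of class \<open>C\<^sup>1\<^sup>,\<^sup>1\<close>.
\<close>

section \<open>Functions with second differences of quadratic size\<close>

text \<open>Working with minimizing curves directly would require their existence in the Sobolev
  class and a bound on their speed, although ellipticity and the derivative bounds of the Lagrangian
  are uniform only over bounded speeds. The cap \<open>R\<close> breaks this circle: it depends on
  \<open>lam\<close> alone, so the constants of the Lagrangian are read off at a known speed, and
  only the admissible times shrink afterwards. It leaves room above the speed of the minimizers, so
  that affine perturbations of them, run over as little as half the time, still obey it. Short times
  always help for the same reason: up to the prescribed shifts, a displacement is at most the time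
  multiplied by a mean velocity gap, so what the dependence on the position costs carries additional
  powers of \<open>t\<close> compared with the gain from convexity in the velocity. Uniform
  convexity in the end point is the part of the gain that survives: \<open>t\<close> times the mean
  square of the velocity gaps, which is at least of order |z|^2 / t^2.\<close>

lemma additive_bounded_imp_linear:
  fixes l :: "'a::real_normed_vector \<Rightarrow> real"
  assumes add: "\<And>x y. l (x + y) = l x + l y"
    and bd: "\<And>x. norm x < r \<Longrightarrow> \<bar>l x\<bar> \<le> B" and r: "r > 0"
  shows "linear l"
proof -
  have l0: "l 0 = 0" using add[of 0 0] by simp
  have lm: "l (- x) = - l x" for x using add[of x "- x"] l0 by simp
  have lhalf: "l ((1 / 2) *\<^sub>R x) = l x / 2" for x
    using add[of "(1 / 2) *\<^sub>R x" "(1 / 2) *\<^sub>R x"]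
    by (simp flip: scaleR_add_left)
  have lpow: "l ((1 / 2 ^ k) *\<^sub>R x) = l x / 2 ^ k" for x k
  proof (induction k)
    case (Suc k)
    then show ?case using lhalf[of "(1 / 2 ^ k) *\<^sub>R x"] by simp
  qed simp
  \<comment> \<open>Every point of the segment is \<open>2 ^ k\<close> times a point of the ball of
    radius \<open>r\<close>, and \<open>lpow\<close> transports the bound.\<close>
  have segm: "\<exists>B'. \<forall>s\<in>{0..1}. \<bar>l (s *\<^sub>R q)\<bar> \<le> B'" for q
  proof -
    obtain k where k: "norm q / r < 2 ^ k" using real_arch_pow[of 2 "norm q / r"] by auto
    have "\<bar>l (s *\<^sub>R q)\<bar> \<le> 2 ^ k * B" if "s \<in> {0..1}" for s
    proof -
      have "norm ((1 / 2 ^ k) *\<^sub>R (s *\<^sub>R q)) = s * norm q / 2 ^ k" using that by simp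
      also have "\<dots> \<le> norm q / 2 ^ k" using that by (auto intro!: divide_right_mono mult_left_le_one_le)
      also have "\<dots> < r" using k r by (simp add: field_simps)
      finally have "\<bar>l ((1 / 2 ^ k) *\<^sub>R (s *\<^sub>R q))\<bar> \<le> B" by (rule bd)
      then show ?thesis unfolding lpow by (simp add: field_simps)
    qed
    then show ?thesis by blast
  qed
  have h01: "l (s *\<^sub>R q) = s * l q" if s: "s \<in> {0..1}" for s q
  proof -
    \<comment> \<open>The defect \<open>h\<close> from homogeneity is additive, vanishes at 1 and is
      bounded on the unit interval. So it has period 1, and \<open>2 * h s = h (2 * s)\<close>, with
      the argument reduced modulo 1, halves the bound again and again.\<close>
    define h where "h s = l (s *\<^sub>R q) - s * l q" for s
    have hadd: "h (a + b) = h a + h b" for a b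
      by (simp add: h_def scaleR_add_left add algebra_simps)
    have h1: "h 1 = 0" by (simp add: h_def)
    obtain B' where B': "\<And>s. s \<in> {0..1} \<Longrightarrow> \<bar>l (s *\<^sub>R q)\<bar> \<le> B'" using segm by blast
    define b where "b = B' + \<bar>l q\<bar>"
    have hb: "\<bar>h s\<bar> \<le> b" if "s \<in> {0..1}" for s
    proof -
      have "\<bar>s * l q\<bar> \<le> \<bar>l q\<bar>" using that by (auto simp: abs_mult intro!: mult_left_le_one_le)
      then show ?thesis using B'[OF that] unfolding h_def b_def by linarith
    qed
    have step: "\<bar>h s\<bar> \<le> b / 2 ^ k" if "s \<in> {0..1}" for s k
      using that
    proof (induction k arbitrary: s)
      case 0 then show ?case using hb by simp
    next
      case (Suc k)
      have d: "2 * h s = h (2 * s)" using hadd[of s s] by simp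
      show ?case
      proof (cases "s \<le> 1/2")
        case True
        then have "\<bar>h (2 * s)\<bar> \<le> b / 2 ^ k" using Suc by auto
        then show ?thesis using d by auto
      next
        case False
        then have "\<bar>h (2 * s - 1)\<bar> \<le> b / 2 ^ k" using Suc by auto
        moreover have "h (2 * s) = h (2 * s - 1)" using hadd[of "2 * s - 1" 1] h1 by simp
        ultimately show ?thesis using d by auto
      qed
    qed
    have "(\<lambda>k. b / 2 ^ k) \<longlonglongrightarrow> 0"
      using tendsto_mult_right_zero[OF LIMSEQ_power_zero[of "1/2::real"], of b]
      by (simp add: power_divide)
    then have "\<bar>h s\<bar> \<le> 0" by (rule LIMSEQ_le_const) (use step[OF s] in blast)
    then show ?thesis by (simp add: h_def)
  qed
  have hpos: "l (s *\<^sub>R q) = s * l q" if "s \<ge> 0" for s q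
  proof (cases "s \<le> 1")
    case False
    then have "l q = (1 / s) * l (s *\<^sub>R q)" using h01[of "1 / s" "s *\<^sub>R q"] by simp
    then show ?thesis using False by (simp add: field_simps)
  qed (use that h01 in auto)
  have "l (s *\<^sub>R q) = s * l q" for s q
    using hpos[of s q] hpos[of "- s" q] lm[of "s *\<^sub>R q"] by (cases "s \<ge> 0") auto
  then show ?thesis by (intro linearI) (auto simp: add)
qed

text \<open>The derivative is found as the dyadic limit of \<open>2 ^ k * (f (p + q / 2 ^ k) - f p)\<close>.\<close>

lemma second_difference_imp_expansion:
  fixes f :: "'a::euclidean_space \<Rightarrow> real"
  assumes sd: "\<And>p q. p + q \<in> ball p0 r \<Longrightarrow> p - q \<in> ball p0 r \<Longrightarrow>
                 \<bar>f (p + q) + f (p - q) - 2 * f p\<bar> \<le> C * (norm q)\<^sup>2"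
    and bd: "\<And>p. p \<in> ball p0 r \<Longrightarrow> \<bar>f p\<bar> \<le> M"
    and p: "p \<in> ball p0 r" and C: "C \<ge> 0"
  shows "\<exists>g. \<forall>q. p + q \<in> ball p0 r \<longrightarrow> \<bar>f (p + q) - f p - g \<bullet> q\<bar> \<le> C * (norm q)\<^sup>2"
proof -
  define F where "F q = f (p + q) - f p" for q
  define a where "a q k = 2 ^ k * F ((1 / 2 ^ k) *\<^sub>R q)" for q and k :: nat
  define \<rho> where "\<rho> = r - dist p0 p"
  have \<rho>: "\<rho> > 0" using p by (simp add: \<rho>_def)
  have inb: "p + q \<in> ball p0 r" if "norm q < \<rho>" for q
  proof -
    have "dist p0 (p + q) \<le> dist p0 p + dist p (p + q)" by (rule dist_triangle)
    then show ?thesis using that by (simp add: \<rho>_def dist_norm)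
  qed
  have mid: "\<bar>F q1 + F q2 - 2 * F ((1/2) *\<^sub>R (q1 + q2))\<bar> \<le> C / 4 * (norm (q1 - q2))\<^sup>2"
    if "p + q1 \<in> ball p0 r" "p + q2 \<in> ball p0 r" for q1 q2
  proof -
    have e1: "p + (1/2) *\<^sub>R (q1 + q2) + (1/2) *\<^sub>R (q1 - q2) = p + q1"
      by (simp add: algebra_simps flip: scaleR_add_left)
    have e2: "p + (1/2) *\<^sub>R (q1 + q2) - (1/2) *\<^sub>R (q1 - q2) = p + q2"
      by (simp add: algebra_simps flip: scaleR_add_left)
    have "\<bar>f (p + q1) + f (p + q2) - 2 * f (p + (1/2) *\<^sub>R (q1 + q2))\<bar>
       \<le> C * (norm ((1/2) *\<^sub>R (q1 - q2)))\<^sup>2"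
      using sd[of "p + (1/2) *\<^sub>R (q1 + q2)" "(1/2) *\<^sub>R (q1 - q2)"] that unfolding e1 e2 by blast
    then show ?thesis by (simp add: F_def power_mult_distrib power_divide add_diff_eq)
  qed
  have F0: "F 0 = 0" by (simp add: F_def)
  have shrink: "p + (1 / 2 ^ k) *\<^sub>R q \<in> ball p0 r" if "p + q \<in> ball p0 r" for q and k :: nat
  proof -
    have "(1 - 1 / 2 ^ k) *\<^sub>R p + (1 / 2 ^ k) *\<^sub>R (p + q) \<in> ball p0 r"
      using convexD[OF convex_ball p that, of "1 - 1 / 2 ^ k" "1 / 2 ^ k"] by simp
    then show ?thesis by (simp add: algebra_simps)
  qed
  \<comment> \<open>\<open>mid\<close> at \<open>q2 = 0\<close> on the scale
    \<open>1 / 2 ^ k\<close>: the defect is of order \<open>1 / 4 ^ k\<close>, the rescaling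
    multiplies it by \<open>2 ^ k\<close>. The geometric error that is left gives convergence and,
    summed from \<open>k = 0\<close>, the bound \<open>err\<close>.\<close>
  have astep: "\<bar>a q (Suc k) - a q k\<bar> \<le> C * (norm q)\<^sup>2 / 4 * (1 / 2) ^ k"
    if q: "p + (1 / 2 ^ k) *\<^sub>R q \<in> ball p0 r" for q k
  proof -
    have "\<bar>F ((1 / 2 ^ k) *\<^sub>R q) - 2 * F ((1 / 2 ^ Suc k) *\<^sub>R q)\<bar> \<le> C / 4 * (norm ((1 / 2 ^ k) *\<^sub>R q))\<^sup>2"
      using mid[OF q, of 0] p F0 by simp
    then have "2 ^ k * \<bar>F ((1 / 2 ^ k) *\<^sub>R q) - 2 * F ((1 / 2 ^ Suc k) *\<^sub>R q)\<bar>
        \<le> 2 ^ k * (C / 4 * (norm ((1 / 2 ^ k) *\<^sub>R q))\<^sup>2)"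
      by (intro mult_left_mono) auto
    also have "\<dots> = C * (norm q)\<^sup>2 / 4 * (1 / 2) ^ k"
      by (simp add: power2_eq_square field_simps)
    also have "2 ^ k * \<bar>F ((1 / 2 ^ k) *\<^sub>R q) - 2 * F ((1 / 2 ^ Suc k) *\<^sub>R q)\<bar> = \<bar>a q (Suc k) - a q k\<bar>"
    proof -
      have "a q (Suc k) - a q k = - (2 ^ k * (F ((1 / 2 ^ k) *\<^sub>R q) - 2 * F ((1 / 2 ^ Suc k) *\<^sub>R q)))"
        by (simp add: a_def algebra_simps)
      then show ?thesis by (simp only: abs_minus_cancel abs_mult) simp
    qed
    finally show ?thesis .
  qed
  have ev: "\<forall>\<^sub>F k in sequentially. norm ((1 / 2 ^ k) *\<^sub>R q) < \<rho>" for q :: 'a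
  proof -
    have "(\<lambda>k. (1/2) ^ k * norm q) \<longlonglongrightarrow> 0"
      by (rule tendsto_mult_left_zero[OF LIMSEQ_power_zero]) auto
    then have "\<forall>\<^sub>F k in sequentially. (1/2) ^ k * norm q < \<rho>" using \<rho> order_tendstoD(2) by blast
    then show ?thesis by (simp add: power_divide)
  qed
  have conv: "convergent (a q)" for q
  proof -
    have s: "summable (\<lambda>k. C * (norm q)\<^sup>2 / 4 * (1 / 2 :: real) ^ k)"
      by (intro summable_mult summable_geometric) auto
    have "summable (\<lambda>k. a q (Suc k) - a q k)"
      by (rule summable_comparison_test_ev[OF _ s])
        (use ev[of q] in eventually_elim, use astep inb in auto)
    from summable_LIMSEQ[OF this] have "(\<lambda>n. (\<Sum>k<n. a q (Suc k) - a q k)) \<longlonglongrightarrow> (\<Sum>k. a q (Suc k) - a q k)" .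
    then have "(\<lambda>n. a q n - a q 0) \<longlonglongrightarrow> (\<Sum>k. a q (Suc k) - a q k)"
      unfolding sum_lessThan_telescope .
    from tendsto_add[OF this tendsto_const[of "a q 0"]] show ?thesis by (auto simp: convergent_def)
  qed
  define l where "l q = lim (a q)" for q
  have l: "a q \<longlonglongrightarrow> l q" for q using conv unfolding l_def by (simp add: convergent_LIMSEQ_iff)
  have err: "\<bar>l q - F q\<bar> \<le> C * (norm q)\<^sup>2" if q: "p + q \<in> ball p0 r" for q
  proof -
    have i1: "\<bar>a q k - F q\<bar> \<le> C * (norm q)\<^sup>2 / 2 * (1 - (1/2) ^ k)" for k
    proof (induction k)
      case (Suc k)
      have "C * (norm q)\<^sup>2 / 2 * (1 - (1/2) ^ Suc k) = C * (norm q)\<^sup>2 / 2 * (1 - (1/2) ^ k) + C * (norm q)\<^sup>2 / 4 * (1 / 2) ^ k"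
        by (simp add: field_simps)
      then show ?case using Suc astep[OF shrink[OF q], of k] by linarith
    qed (simp add: a_def)
    have i2: "C * (norm q)\<^sup>2 / 2 * (1 - (1/2) ^ k) \<le> C * (norm q)\<^sup>2 * 1" for k :: nat
    proof -
      have "C * (norm q)\<^sup>2 * ((1 - (1/2) ^ k) / 2) \<le> C * (norm q)\<^sup>2 * 1"
        using C by (simp add: field_simps)
      then show ?thesis by (simp add: field_simps)
    qed
    have "\<bar>a q k - F q\<bar> \<le> C * (norm q)\<^sup>2" for k using i1[of k] i2[of k] by simp
    moreover have "(\<lambda>k. \<bar>a q k - F q\<bar>) \<longlonglongrightarrow> \<bar>l q - F q\<bar>" by (intro tendsto_intros l)
    ultimately show ?thesis by (intro LIMSEQ_le_const2) auto
  qed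
  have l2: "l (2 *\<^sub>R q) = 2 * l q" for q
  proof -
    have "(\<lambda>k. a (2 *\<^sub>R q) (Suc k)) \<longlonglongrightarrow> l (2 *\<^sub>R q)" using l LIMSEQ_Suc by blast
    moreover have "a (2 *\<^sub>R q) (Suc k) = 2 * a q k" for k by (simp add: a_def)
    ultimately have "(\<lambda>k. 2 * a q k) \<longlonglongrightarrow> l (2 *\<^sub>R q)" by simp
    moreover have "(\<lambda>k. 2 * a q k) \<longlonglongrightarrow> 2 * l q" by (intro tendsto_intros l)
    ultimately show ?thesis using LIMSEQ_unique by blast
  qed
  \<comment> \<open>In the limit the midpoint defect disappears, being \<open>2 ^ k\<close> times a
    quantity of order \<open>1 / 4 ^ k\<close>; with \<open>l2\<close> this is additivity.\<close>
  have lmid: "l q1 + l q2 = 2 * l ((1/2) *\<^sub>R (q1 + q2))" for q1 q2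
  proof -
    define q3 where "q3 = (1/2) *\<^sub>R (q1 + q2)"
    have lim0: "(\<lambda>k. a q1 k + a q2 k - 2 * a q3 k) \<longlonglongrightarrow> 0"
    proof (rule Lim_null_comparison)
      show "\<forall>\<^sub>F k in sequentially. norm (a q1 k + a q2 k - 2 * a q3 k) \<le> C / 4 * (norm (q1 - q2))\<^sup>2 * (1/2) ^ k"
        using ev[of q1] ev[of q2]
      proof eventually_elim
        case (elim k)
        have e3: "(1/2) *\<^sub>R ((1 / 2 ^ k) *\<^sub>R q1 + (1 / 2 ^ k) *\<^sub>R q2) = (1 / 2 ^ k) *\<^sub>R q3"
          by (simp add: q3_def algebra_simps)
        have "\<bar>F ((1 / 2 ^ k) *\<^sub>R q1) + F ((1 / 2 ^ k) *\<^sub>R q2) - 2 * F ((1 / 2 ^ k) *\<^sub>R q3)\<bar>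
           \<le> C / 4 * (norm ((1 / 2 ^ k) *\<^sub>R q1 - (1 / 2 ^ k) *\<^sub>R q2))\<^sup>2"
          using mid[OF inb[OF elim(1)] inb[OF elim(2)]] unfolding e3 .
        also have "\<dots> = C / 4 * (norm (q1 - q2))\<^sup>2 / 4 ^ k"
          by (simp flip: scaleR_diff_right add: power_mult_distrib power_divide power2_eq_square flip: power_mult_distrib)
        finally have "2 ^ k * \<bar>F ((1 / 2 ^ k) *\<^sub>R q1) + F ((1 / 2 ^ k) *\<^sub>R q2) - 2 * F ((1 / 2 ^ k) *\<^sub>R q3)\<bar>
           \<le> 2 ^ k * (C / 4 * (norm (q1 - q2))\<^sup>2 / 4 ^ k)" by (intro mult_left_mono) auto
        also have "\<dots> = C / 4 * (norm (q1 - q2))\<^sup>2 * (2 ^ k / (4 :: real) ^ k)" by simp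
        also have "(2 ^ k / (4 :: real) ^ k) = (1/2) ^ k" by (simp flip: power_divide)
        finally have "\<bar>2 ^ k * (F ((1 / 2 ^ k) *\<^sub>R q1) + F ((1 / 2 ^ k) *\<^sub>R q2) - 2 * F ((1 / 2 ^ k) *\<^sub>R q3))\<bar>
            \<le> C / 4 * (norm (q1 - q2))\<^sup>2 * (1/2) ^ k" by (simp add: abs_mult)
        moreover have "a q1 k + a q2 k - 2 * a q3 k = 2 ^ k * (F ((1 / 2 ^ k) *\<^sub>R q1) + F ((1 / 2 ^ k) *\<^sub>R q2) - 2 * F ((1 / 2 ^ k) *\<^sub>R q3))"
          by (simp add: a_def algebra_simps)
        ultimately show ?case by simp
      qed
      show "(\<lambda>k. C / 4 * (norm (q1 - q2))\<^sup>2 * (1/2) ^ k) \<longlonglongrightarrow> 0"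
        by (rule tendsto_mult_right_zero[OF LIMSEQ_power_zero]) auto
    qed
    moreover have "(\<lambda>k. a q1 k + a q2 k - 2 * a q3 k) \<longlonglongrightarrow> l q1 + l q2 - 2 * l q3"
      by (intro tendsto_intros l)
    ultimately have "l q1 + l q2 - 2 * l q3 = 0" using LIMSEQ_unique by blast
    then show ?thesis by (simp add: q3_def)
  qed
  have ladd: "l (q1 + q2) = l q1 + l q2" for q1 q2
    using lmid[of q1 q2] l2[of "(1/2) *\<^sub>R (q1 + q2)"] by simp
  \<comment> \<open>Here the local bound on \<open>f\<close> enters: a discontinuous additive
    function has zero second differences, and boundedness near 0 is what excludes it.\<close>
  have lbd: "\<bar>l q\<bar> \<le> 2 * M + C * \<rho>\<^sup>2" if "norm q < \<rho>" for q
  proof -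
    have "C * (norm q)\<^sup>2 \<le> C * \<rho>\<^sup>2" using that C by (intro mult_left_mono power_mono) auto
    then show ?thesis using err[OF inb[OF that]] bd[OF inb[OF that]] bd[OF p] unfolding F_def by linarith
  qed
  have lin: "linear l" by (rule additive_bounded_imp_linear[OF ladd lbd \<rho>])
  define g where "g = (\<Sum>b\<in>Basis. l b *\<^sub>R b)"
  have "l q = g \<bullet> q" for q
  proof -
    have "l q = l (\<Sum>b\<in>Basis. (q \<bullet> b) *\<^sub>R b)" by (simp add: euclidean_representation)
    also have "\<dots> = g \<bullet> q"
      by (simp add: linear_sum[OF lin] linear_scale[OF lin] g_def inner_sum_left) (simp add: inner_commute mult.commute)
    finally show ?thesis .
  qed
  then show ?thesis using err unfolding F_def by (intro exI[of _ g]) (metis abs_minus_commute)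
qed

text \<open>Around each point the expansion holds on a whole ball with one constant. Its quadratic
  error yields the gradient, and comparing the expansions at two points of a smaller ball makes the
  gradient Lipschitz there.\<close>

lemma C11_locI:
  fixes f :: "'a::euclidean_space \<Rightarrow> real"
  assumes loc: "\<And>p0. p0 \<in> S \<Longrightarrow> \<exists>r>0. \<exists>C\<ge>0. \<exists>M. ball p0 r \<subseteq> S \<and>
      (\<forall>p q. p + q \<in> ball p0 r \<longrightarrow> p - q \<in> ball p0 r \<longrightarrow>
                 \<bar>f (p + q) + f (p - q) - 2 * f p\<bar> \<le> C * (norm q)\<^sup>2) \<and>
      (\<forall>p\<in>ball p0 r. \<bar>f p\<bar> \<le> M)"
  shows "C11_loc f S"
proof -
  have exg: "\<exists>g. \<exists>r>0. \<exists>C\<ge>0. \<forall>q. norm q < r \<longrightarrow> \<bar>f (p + q) - f p - g \<bullet> q\<bar> \<le> C * (norm q)\<^sup>2"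
    if pS: "p \<in> S" for p
  proof -
    obtain r C M where r: "r > 0" "C \<ge> 0" and a: "\<And>x q. x + q \<in> ball p r \<Longrightarrow> x - q \<in> ball p r \<Longrightarrow>
                 \<bar>f (x + q) + f (x - q) - 2 * f x\<bar> \<le> C * (norm q)\<^sup>2" and b: "\<And>x. x\<in>ball p r \<Longrightarrow> \<bar>f x\<bar> \<le> M"
      using loc[OF pS] by metis
    obtain g where "\<And>q. p + q \<in> ball p r \<Longrightarrow> \<bar>f (p + q) - f p - g \<bullet> q\<bar> \<le> C * (norm q)\<^sup>2"
      using second_difference_imp_expansion[where f = f and ?p0.0 = p and r = r and C = C and M = M and p = p] a b r by auto
    then show ?thesis using r by (intro exI[of _ g] exI[of _ r] conjI exI[of _ C]) (auto simp: dist_norm)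
  qed
  have gd: "GDERIV f p :> g" if "r > 0" "C \<ge> 0" "\<forall>q. norm q < r \<longrightarrow> \<bar>f (p + q) - f p - g \<bullet> q\<bar> \<le> C * (norm q)\<^sup>2" for p g r C
    unfolding gderiv_def has_derivative_at
  proof (intro conjI bounded_linear_inner_right bounded_linear_inner_left)
    show "(\<lambda>h. norm (f (p + h) - f p - h \<bullet> g) / norm h) \<midarrow>0\<rightarrow> 0"
    proof (rule Lim_null_comparison)
      show "\<forall>\<^sub>F h in at 0. norm (norm (f (p + h) - f p - h \<bullet> g) / norm h) \<le> C * norm h"
        unfolding eventually_at
      proof (intro exI[of _ r] conjI ballI impI that(1))
        fix h :: 'a assume "h \<noteq> 0 \<and> dist h 0 < r"
        then have "\<bar>f (p + h) - f p - h \<bullet> g\<bar> \<le> C * (norm h)\<^sup>2" "norm h > 0" using that(3) by (auto simp: inner_commute)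
        then show "norm (norm (f (p + h) - f p - h \<bullet> g) / norm h) \<le> C * norm h"
          by (simp add: field_simps power2_eq_square)
      qed
      show "((\<lambda>h. C * norm h) \<longlongrightarrow> 0) (at (0::'a))" by (intro tendsto_eq_intros) auto
    qed
  qed
  have "\<exists>G. \<forall>p\<in>S. GDERIV f p :> G p" using exg gd by metis
  then obtain G where G: "\<And>p. p \<in> S \<Longrightarrow> GDERIV f p :> G p" by blast
  have lips: "\<exists>r>0. \<exists>C. C-lipschitz_on (ball p0 r \<inter> S) G" if p0: "p0 \<in> S" for p0
  proof -
    obtain r C M where r: "r > 0" "C \<ge> 0" "ball p0 r \<subseteq> S" and a: "\<And>x q. x + q \<in> ball p0 r \<Longrightarrow> x - q \<in> ball p0 r \<Longrightarrow>
                 \<bar>f (x + q) + f (x - q) - 2 * f x\<bar> \<le> C * (norm q)\<^sup>2" and b: "\<And>x. x\<in>ball p0 r \<Longrightarrow> \<bar>f x\<bar> \<le> M"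
      using loc[OF p0] by blast
    \<comment> \<open>\<open>G\<close> was chosen point by point, with no uniform constant.
      Uniqueness of the derivative identifies it with the vector of the expansion that has the
      constant \<open>C\<close> of this ball.\<close>
    have ex: "\<bar>f (p + q) - f p - G p \<bullet> q\<bar> \<le> C * (norm q)\<^sup>2" if p: "p \<in> ball p0 r" and q: "p + q \<in> ball p0 r" for p q
    proof -
      obtain g where g: "\<And>q. p + q \<in> ball p0 r \<Longrightarrow> \<bar>f (p + q) - f p - g \<bullet> q\<bar> \<le> C * (norm q)\<^sup>2"
        using second_difference_imp_expansion[where f = f and ?p0.0 = p0 and r = r and C = C and M = M and p = p] a b p r by auto
      have "GDERIV f p :> g"
      proof (rule gd[of "r - dist p0 p" C])
        have "p + q \<in> ball p0 r" if "norm q < r - dist p0 p" for q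
          using that dist_triangle[of p0 "p + q" p] by (simp add: dist_norm)
        then show "\<forall>q. norm q < r - dist p0 p \<longrightarrow> \<bar>f (p + q) - f p - g \<bullet> q\<bar> \<le> C * (norm q)\<^sup>2" using g by blast
      qed (use p r in auto)
      then have "(\<lambda>h. h \<bullet> g) = (\<lambda>h. h \<bullet> G p)"
        using G[of p] p r(3) unfolding gderiv_def by (blast intro: has_derivative_unique)
      then have "h \<bullet> g = h \<bullet> G p" for h by meson
      then have "G p = g" by (metis vector_eq_rdot inner_commute)
      then show ?thesis using g q by simp
    qed
    have "(6 * C)-lipschitz_on (ball p0 (r / 3)) G"
    proof (rule lipschitz_onI)
      fix p p' assume pp: "p \<in> ball p0 (r / 3)" "p' \<in> ball p0 (r / 3)"
      define d where "d = norm (p' - p)"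
      show "dist (G p) (G p') \<le> 6 * C * dist p p'"
      proof (cases "G p' = G p \<or> d = 0")
        case False
        \<comment> \<open>A test vector of length \<open>d\<close> in the direction of the gradient
          gap. The value at \<open>p' + w\<close> is expanded from \<open>p\<close> directly, with
          error at most \<open>4 * C * d\<^sup>2\<close>, and by way of \<open>p'\<close>, with
          error \<open>2 * C * d\<^sup>2\<close>: together 6. The radius \<open>r / 3\<close> keeps
          \<open>p' + w\<close> in the ball of radius \<open>r\<close>.\<close>
        define w where "w = (d / norm (G p' - G p)) *\<^sub>R (G p' - G p)"
        have d0: "d > 0" using False by (auto simp: d_def)
        have nw: "norm w = d" using False d0 by (simp add: w_def)
        have pr: "p \<in> ball p0 r" "p' \<in> ball p0 r" using pp r by auto
        have dd: "d < 2 * r / 3" using dist_triangle3[of p' p p0] pp by (simp add: d_def dist_norm)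
        have pw: "p' + w \<in> ball p0 r"
          using dist_triangle[of p0 "p' + w" p'] pp dd nw by (simp add: dist_norm)
        have e1: "\<bar>f (p' + w) - f p - G p \<bullet> (p' + w - p)\<bar> \<le> C * (norm (p' + w - p))\<^sup>2"
          using ex[of p "p' + w - p"] pr pw by simp
        have e2: "\<bar>f p' - f p - G p \<bullet> (p' - p)\<bar> \<le> C * d\<^sup>2"
          using ex[of p "p' - p"] pr by (simp add: d_def)
        have e3: "\<bar>f (p' + w) - f p' - G p' \<bullet> w\<bar> \<le> C * d\<^sup>2"
          using ex[of p' w] pr pw nw by simp
        have "norm (p' + w - p) \<le> 2 * d" using norm_triangle_ineq[of "p' - p" w] nw by (simp add: d_def algebra_simps)
        then have "C * (norm (p' + w - p))\<^sup>2 \<le> C * (2 * d)\<^sup>2" using r by (intro mult_left_mono power_mono) auto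
        then have "(G p' - G p) \<bullet> w \<le> 6 * C * d\<^sup>2"
          using e1 e2 e3 by (simp add: inner_diff_left inner_diff_right inner_add_right power2_eq_square abs_le_iff)
        moreover have "(G p' - G p) \<bullet> w = d * norm (G p' - G p)"
          using False by (simp add: w_def dot_square_norm power2_eq_square)
        ultimately have "d * norm (G p' - G p) \<le> d * (6 * C * d)" by (simp add: power2_eq_square algebra_simps)
        then have "norm (G p' - G p) \<le> 6 * C * d" using d0 by simp
        then show ?thesis by (simp add: d_def dist_norm norm_minus_commute)
      qed (use r in \<open>auto simp: d_def\<close>)
    qed (use r in auto)
    then show ?thesis using r by (intro exI[of _ "r / 3"] conjI exI[of _ "6 * C"]) (auto intro: lipschitz_on_subset)
  qed
  have "continuous_on S G"
  proof (subst continuous_on_eq_continuous_within, rule ballI)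
    fix p assume p: "p \<in> S"
    obtain r C where r: "r > 0" "C-lipschitz_on (ball p r \<inter> S) G" using lips[OF p] by blast
    obtain e where e: "e > 0" "ball p e \<subseteq> S" using loc[OF p] by blast
    have "continuous_on (ball p r \<inter> S) G" using r by (simp add: lipschitz_on_continuous_on)
    then have "continuous_on (ball p (min r e)) G" by (rule continuous_on_subset) (use e in auto)
    then have "isCont G p" using r e by (simp add: continuous_on_eq_continuous_at)
    then show "continuous (at p within S) G" by (rule continuous_at_imp_continuous_at_within)
  qed
  then show ?thesis unfolding C11_loc_def using G lips by (intro exI[of _ G]) auto
qed

section \<open>Sobolev curves are indefinite integrals\<close>

text \<open>A quadratic spline climbing from 0 to 1 on the unit interval: the coefficients 1, -2, 1
  cancel the growth beyond 1 and leave a constant. It has just the C1 regularity that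
  \<open>W11\<close> asks of test functions, and its derivative is a tent of height 2.\<close>

definition ramp :: "real \<Rightarrow> real" where
  "ramp r = 2 * ((max 0 r)\<^sup>2 - 2 * (max 0 (r - 1/2))\<^sup>2 + (max 0 (r - 1))\<^sup>2)"

definition ramp' :: "real \<Rightarrow> real" where
  "ramp' r = 4 * (max 0 r - 2 * max 0 (r - 1/2) + max 0 (r - 1))"

lemma has_real_derivative_max0_power2:
  "((\<lambda>r::real. (max 0 r)\<^sup>2) has_real_derivative 2 * max 0 r) (at r)"
proof -
  consider "r < 0" | "r = 0" | "r > 0" by linarith
  then show ?thesis
  proof cases
    case 1
    have "((\<lambda>r::real. 0) has_real_derivative 2 * max 0 r) (at r)" using 1 by auto
    then show ?thesis by (rule has_field_derivative_transform_within_open[of _ _ _ "{..<0}"]) (use 1 in auto)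
  next
    case 2
    have "(\<lambda>h::real. ((max 0 (r + h))\<^sup>2 - (max 0 r)\<^sup>2) / h) \<midarrow>0\<rightarrow> 0"
    proof (rule Lim_null_comparison)
      show "\<forall>\<^sub>F h in at 0. norm (((max 0 (r + h))\<^sup>2 - (max 0 r)\<^sup>2) / h) \<le> \<bar>h\<bar>"
        using 2 by (intro always_eventually) (auto simp: max_def power2_eq_square)
      show "((\<lambda>h::real. \<bar>h\<bar>) \<longlongrightarrow> 0) (at 0)" by (intro tendsto_eq_intros) auto
    qed
    then show ?thesis unfolding DERIV_def using 2 by simp
  next
    case 3
    have "((\<lambda>r::real. r\<^sup>2) has_real_derivative 2 * max 0 r) (at r)"
      using 3 by (auto intro!: derivative_eq_intros)
    then show ?thesis by (rule has_field_derivative_transform_within_open[of _ _ _ "{0<..}"]) (use 3 in auto)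
  qed
qed

lemma ramp_deriv: "(ramp has_real_derivative ramp' r) (at r)"
proof -
  have d: "((\<lambda>r::real. (max 0 (r - c))\<^sup>2) has_real_derivative 2 * max 0 (r - c)) (at r)" for c
  proof -
    have 1: "((\<lambda>r. r - c) has_real_derivative 1) (at r)" by (auto intro!: derivative_eq_intros)
    show ?thesis
      using DERIV_chain2[where f = "\<lambda>r. (max 0 r)\<^sup>2" and g = "\<lambda>r. r - c", OF has_real_derivative_max0_power2 1] by simp
  qed
  have "((\<lambda>r. 2 * ((max 0 r)\<^sup>2 - 2 * (max 0 (r - 1/2))\<^sup>2 + (max 0 (r - 1))\<^sup>2)) has_real_derivative
      2 * (2 * max 0 r - 2 * (2 * max 0 (r - 1/2)) + 2 * max 0 (r - 1))) (at r)"
    by (intro DERIV_cmult DERIV_add DERIV_diff d has_real_derivative_max0_power2)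
  then show ?thesis unfolding ramp_def[abs_def] ramp'_def by simp
qed

lemma ramp'_nonneg: "ramp' r \<ge> 0" and ramp'_eq_0: "r \<le> 0 \<or> r \<ge> 1 \<Longrightarrow> ramp' r = 0"
  by (auto simp: ramp'_def max_def)

lemma ramp_le_0: "r \<le> 0 \<Longrightarrow> ramp r = 0" and ramp_ge_1: "r \<ge> 1 \<Longrightarrow> ramp r = 1"
  by (auto simp: ramp_def max_def power2_eq_square algebra_simps)

lemma ramp_bounds: "0 \<le> ramp r" "ramp r \<le> 1"
proof -
  have mono: "x \<le> y \<Longrightarrow> ramp x \<le> ramp y" for x y
    by (rule DERIV_nonneg_imp_nondecreasing) (use ramp_deriv ramp'_nonneg in auto)
  show "0 \<le> ramp r" using mono[of "min 0 r" r] ramp_le_0[of "min 0 r"] by auto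
  show "ramp r \<le> 1" using mono[of r "max 1 r"] ramp_ge_1[of "max 1 r"] by auto
qed

lemma continuous_on_ramp': "continuous_on UNIV ramp'"
  unfolding ramp'_def[abs_def] by (intro continuous_intros)

lemma scaled_ramp_deriv:
  "((\<lambda>s. ramp ((s - a) / e)) has_real_derivative ramp' ((s - a) / e) / e) (at s)"
proof -
  have "((\<lambda>s. (s - a) / e) has_real_derivative 1 / e) (at s)"
    by (cases "e = 0") (auto intro!: derivative_eq_intros)
  from DERIV_chain2[OF ramp_deriv this] show ?thesis by simp
qed

lemma continuous_on_scaled_ramp': "continuous_on S (\<lambda>s. ramp' ((s - a) / e) / e)"
  by (cases "e = 0") (auto intro!: continuous_intros continuous_on_compose2[OF continuous_on_ramp'])

lemma continuous_on_scaled_ramp: "continuous_on S (\<lambda>s. ramp ((s - a) / e))"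
  by (rule DERIV_continuous_on, rule has_field_derivative_at_within, rule scaled_ramp_deriv)

text \<open>An approximate identity: the rescaled tent is nonnegative, has integral 1 because
  \<open>ramp\<close> climbs from 0 to 1, and lives on the interval from \<open>a\<close> to
  \<open>a + e n\<close>. The support to the right of \<open>a\<close> explains the condition
  \<open>a + e n \<le> t\<close>.\<close>

lemma mollifier_tendsto:
  fixes \<gamma> :: "real \<Rightarrow> 'a::euclidean_space"
  assumes \<gamma>: "continuous_on {0..t} \<gamma>" and a: "0 < a" "a < t"
    and e: "\<And>n. e n > 0" "\<And>n. a + e n \<le> t" "e \<longlonglongrightarrow> 0"
  shows "(\<lambda>n::nat. integral {0..t} (\<lambda>s. (ramp' ((s - a) / e n) / e n) *\<^sub>R \<gamma> s)) \<longlonglongrightarrow> \<gamma> a"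
proof (rule LIMSEQ_I)
  fix r :: real assume r: "r > 0"
  have "continuous (at a within {0..t}) \<gamma>" using \<gamma> a by (simp add: continuous_on_eq_continuous_within)
  then obtain d where d: "d > 0" "\<And>s. s \<in> {0..t} \<Longrightarrow> dist s a < d \<Longrightarrow> dist (\<gamma> s) (\<gamma> a) < r / 2"
    unfolding continuous_within_eps_delta using r half_gt_zero by metis
  obtain N where N: "\<And>n. n \<ge> N \<Longrightarrow> \<bar>e n\<bar> < d" using LIMSEQ_D[OF e(3) d(1)] by auto
  have "norm (integral {0..t} (\<lambda>s. (ramp' ((s - a) / e n) / e n) *\<^sub>R \<gamma> s) - \<gamma> a) < r" if n: "n \<ge> N" for n
  proof -
    define \<psi> where "\<psi> s = ramp' ((s - a) / e n) / e n" for s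
    have e0: "e n > 0" "a + e n \<le> t" by (rule e)+
    have c\<psi>: "continuous_on S \<psi>" for S unfolding \<psi>_def by (rule continuous_on_scaled_ramp')
    have p\<psi>: "\<psi> s \<ge> 0" for s using e0 by (simp add: \<psi>_def ramp'_nonneg)
    have "(\<psi> has_integral ramp ((t - a) / e n) - ramp ((0 - a) / e n)) {0..t}"
      by (rule fundamental_theorem_of_calculus)
        (use a scaled_ramp_deriv in \<open>auto simp: \<psi>_def[abs_def] has_real_derivative_iff_has_vector_derivative[symmetric] intro: has_field_derivative_at_within\<close>)
    moreover have "ramp ((t - a) / e n) = 1" using e0 by (intro ramp_ge_1) (simp add: field_simps)
    moreover have "ramp ((0 - a) / e n) = 0" using e0 a by (intro ramp_le_0) (simp add: field_simps)
    ultimately have I\<psi>: "(\<psi> has_integral 1) {0..t}" by simp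
    have i1: "((\<lambda>s. \<psi> s *\<^sub>R \<gamma> a) has_integral 1 *\<^sub>R \<gamma> a) {0..t}"
      by (rule has_integral_scaleR_left[OF I\<psi>])
    have i2: "(\<lambda>s. \<psi> s *\<^sub>R \<gamma> s) integrable_on {0..t}"
      by (intro integrable_continuous_real continuous_intros c\<psi> \<gamma>)
    have i3: "(\<lambda>s. \<psi> s *\<^sub>R (\<gamma> s - \<gamma> a)) integrable_on {0..t}"
      by (intro integrable_continuous_real continuous_intros c\<psi> \<gamma>)
    have "integral {0..t} (\<lambda>s. \<psi> s *\<^sub>R \<gamma> s) - \<gamma> a = integral {0..t} (\<lambda>s. \<psi> s *\<^sub>R (\<gamma> s - \<gamma> a))"
      using i1 i2 by (simp add: scaleR_diff_right integral_diff has_integral_integrable integral_unique)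
    also have "norm \<dots> \<le> integral {0..t} (\<lambda>s. \<psi> s * (r / 2))"
    proof (rule integral_norm_bound_integral[OF i3])
      show "(\<lambda>s. \<psi> s * (r / 2)) integrable_on {0..t}"
        by (intro integrable_continuous_real continuous_intros c\<psi>)
      fix s assume s: "s \<in> {0..t}"
      show "norm (\<psi> s *\<^sub>R (\<gamma> s - \<gamma> a)) \<le> \<psi> s * (r / 2)"
      proof (cases "s \<le> a \<or> s \<ge> a + e n")
        case True
        then have "\<psi> s = 0" unfolding \<psi>_def using e0 by (subst ramp'_eq_0) (auto simp: field_simps)
        then show ?thesis by simp
      next
        case False
        then have "dist s a < d" using N[OF n] e0 by (auto simp: dist_real_def)
        then have "norm (\<gamma> s - \<gamma> a) \<le> r / 2" using d(2)[OF s] by (simp add: dist_norm)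
        then show ?thesis using p\<psi>[of s] mult_left_mono[of "norm (\<gamma> s - \<gamma> a)" "r / 2" "\<psi> s"] by simp
      qed
    qed
    also have "\<dots> = r / 2" using has_integral_mult_left[OF I\<psi>, of "r / 2"] by fastforce
    also have "\<dots> < r" using r by simp
    finally show ?thesis unfolding \<psi>_def .
  qed
  then show "\<exists>N. \<forall>n\<ge>N. norm (integral {0..t} (\<lambda>s. (ramp' ((s - a) / e n) / e n) *\<^sub>R \<gamma> s) - \<gamma> a) < r" by blast
qed

text \<open>Dominated convergence: the cutoffs are bounded by 1 and tend to the indicator of the
  half-open interval, since \<open>ramp\<close> vanishes at 0 and both ramps start at their base
  points.\<close>

lemma cutoff_tendsto:
  fixes g :: "real \<Rightarrow> 'a::euclidean_space"
  assumes g: "g absolutely_integrable_on {0..t}" and a: "0 < a" "a < b" "b < t"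
    and e: "\<And>n. e n > 0" "e \<longlonglongrightarrow> 0"
  shows "(\<lambda>n::nat. integral {0..t} (\<lambda>s. (ramp ((s - a) / e n) - ramp ((s - b) / e n)) *\<^sub>R g s))
           \<longlonglongrightarrow> integral {a..b} g"
proof -
  define \<phi> where "\<phi> n s = ramp ((s - a) / e n) - ramp ((s - b) / e n)" for n s
  have c\<phi>: "continuous_on S (\<phi> n)" for n S
    unfolding \<phi>_def[abs_def] by (intro continuous_on_diff continuous_on_scaled_ramp)
  have b\<phi>: "\<bar>\<phi> n s\<bar> \<le> 1" for n s
    using ramp_bounds[of "(s - a) / e n"] ramp_bounds[of "(s - b) / e n"] unfolding \<phi>_def by linarith
  have lim: "(\<lambda>n. \<phi> n s) \<longlonglongrightarrow> (if s \<in> {a<..b} then 1 else 0)" for s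
  proof -
    have r0: "ramp ((s - c) / e n) = 0" if "s \<le> c" for n c
      using that e(1)[of n] by (intro ramp_le_0) (simp add: field_simps)
    have r1: "\<forall>\<^sub>F n in sequentially. ramp ((s - c) / e n) = 1" if "c < s" for c
    proof -
      have "\<forall>\<^sub>F n in sequentially. e n < s - c" using order_tendstoD(2)[OF e(2)] that by auto
      then show ?thesis
        by eventually_elim (rule ramp_ge_1, use e(1) in \<open>simp add: field_simps\<close>)
    qed
    consider "s \<le> a" | "a < s" "s \<le> b" | "b < s" by linarith
    then have "\<forall>\<^sub>F n in sequentially. \<phi> n s = (if s \<in> {a<..b} then 1 else 0)"
    proof cases
      case 1
      then show ?thesis using a by (auto simp: \<phi>_def r0)
    next
      case 2
      show ?thesis using r1[OF 2(1)] by eventually_elim (use 2 in \<open>simp add: \<phi>_def r0\<close>)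
    next
      case 3
      then have "a < s" using a by simp
      show ?thesis using r1[OF \<open>a < s\<close>] r1[OF 3] by eventually_elim (use 3 in \<open>simp add: \<phi>_def\<close>)
    qed
    then show ?thesis by (rule tendsto_eventually)
  qed
  have "(\<lambda>n. integral {0..t} (\<lambda>s. \<phi> n s *\<^sub>R g s)) \<longlonglongrightarrow>
        integral {0..t} (\<lambda>s. (if s \<in> {a<..b} then 1 else 0) *\<^sub>R g s)"
  proof (rule dominated_convergence(2))
    show "(\<lambda>s. \<phi> n s *\<^sub>R g s) integrable_on {0..t}" for n
    proof -
      have "bounded (\<phi> n ` {0..t})" using b\<phi> by (auto simp: bounded_iff)
      then have "(\<lambda>s. \<phi> n s *\<^sub>R g s) absolutely_integrable_on {0..t}"
        using absolutely_integrable_bounded_measurable_product[of scaleR "\<phi> n" "{0..t}" g]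
          continuous_imp_measurable_on_sets_lebesgue[OF c\<phi>] g
        by (simp add: bilinear_conv_bounded_bilinear bounded_bilinear_scaleR)
      then show ?thesis using set_lebesgue_integral_eq_integral(1) by blast
    qed
    show "(\<lambda>s. norm (g s)) integrable_on {0..t}" using g by (simp add: absolutely_integrable_on_def)
    show "norm (\<phi> n s *\<^sub>R g s) \<le> norm (g s)" for n s
      using mult_right_mono[OF b\<phi>[of n s], of "norm (g s)"] by simp
    show "(\<lambda>n. \<phi> n s *\<^sub>R g s) \<longlonglongrightarrow> (if s \<in> {a<..b} then 1 else 0) *\<^sub>R g s" for s
      by (intro tendsto_intros lim)
  qed
  also have "integral {0..t} (\<lambda>s. (if s \<in> {a<..b} then 1 else 0) *\<^sub>R g s) = integral {0..t} (\<lambda>s. if s \<in> {a..b} then g s else 0)"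
    by (rule integral_spike[of "{a}"]) auto
  also have "\<dots> = integral {a..b} g"
    using a by (subst integral_restrict_Int) (simp add: Int_absorb2)
  finally show ?thesis unfolding \<phi>_def .
qed

text \<open>The test functions are plateaus: a ramp up after \<open>a\<close>, a ramp down after
  \<open>b\<close>. Their derivatives are two approximate identities, which pick out
  \<open>\<gamma> a - \<gamma> b\<close>, and the plateaus tend to the indicator of the interval. As
  test functions stay away from 0 and \<open>t\<close>, these two end points are reached by
  continuity.\<close>

lemma W11_integral:
  fixes \<gamma> :: "real \<Rightarrow> 'a::euclidean_space"
  assumes W: "W11 t \<gamma> g" and t: "t > 0" and ab: "0 \<le> a" "a \<le> b" "b \<le> t"
  shows "integral {a..b} g = \<gamma> b - \<gamma> a"
proof -
  have \<gamma>: "continuous_on {0..t} \<gamma>" and g: "g absolutely_integrable_on {0..t}"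
    and weak: "\<And>\<phi> \<phi>'. (\<And>s. (\<phi> has_real_derivative \<phi>' s) (at s)) \<Longrightarrow> continuous_on UNIV \<phi>' \<Longrightarrow>
        closure {s. \<phi> s \<noteq> 0} \<subseteq> {0<..<t} \<Longrightarrow>
        integral {0..t} (\<lambda>s. \<phi>' s *\<^sub>R \<gamma> s) = - integral {0..t} (\<lambda>s. \<phi> s *\<^sub>R g s)"
    using W unfolding W11_def by blast+
  have gi: "g integrable_on {0..t}" using g set_lebesgue_integral_eq_integral(1) by blast
  have inner: "integral {a..b} g = \<gamma> b - \<gamma> a" if ab: "0 < a" "a < b" "b < t" for a b
  proof -
    \<comment> \<open>Half the gap to \<open>t\<close>: the falling ramp ends at
      \<open>b + e n\<close>, still strictly inside the open interval.\<close>
    define e where "e n = (t - b) / 2 * inverse (real (Suc n))" for n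
    have e0: "e n > 0" for n using ab by (simp add: e_def)
    have le: "e n \<le> (t - b) / 2" for n
      unfolding e_def by (rule mult_left_le) (use ab in \<open>auto simp: field_simps\<close>)
    have elim: "e \<longlonglongrightarrow> 0" unfolding e_def
      by (rule tendsto_mult_right_zero[OF LIMSEQ_inverse_real_of_nat])
    define \<phi> where "\<phi> n s = ramp ((s - a) / e n) - ramp ((s - b) / e n)" for n s
    define \<phi>' where "\<phi>' n s = ramp' ((s - a) / e n) / e n - ramp' ((s - b) / e n) / e n" for n s
    have eq: "integral {0..t} (\<lambda>s. \<phi>' n s *\<^sub>R \<gamma> s) = - integral {0..t} (\<lambda>s. \<phi> n s *\<^sub>R g s)" for n
    proof (rule weak)
      show "(\<phi> n has_real_derivative \<phi>' n s) (at s)" for s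
        unfolding \<phi>_def \<phi>'_def by (intro DERIV_diff scaled_ramp_deriv)
      show "continuous_on UNIV (\<phi>' n)"
        unfolding \<phi>'_def[abs_def] by (intro continuous_on_diff continuous_on_scaled_ramp')
      have "{s. \<phi> n s \<noteq> 0} \<subseteq> {a..b + e n}"
      proof
        fix s assume "s \<in> {s. \<phi> n s \<noteq> 0}"
        then have s: "\<phi> n s \<noteq> 0" by simp
        have "\<not> s < a"
        proof
          assume "s < a"
          then have "(s - a) / e n \<le> 0" "(s - b) / e n \<le> 0" using ab e0[of n] by (auto simp: field_simps)
          then show False using s by (simp add: \<phi>_def ramp_le_0)
        qed
        moreover have "\<not> s > b + e n"
        proof
          assume "s > b + e n"
          then have "(s - a) / e n \<ge> 1" "(s - b) / e n \<ge> 1" using ab e0[of n] by (auto simp: field_simps)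
          then show False using s by (simp add: \<phi>_def ramp_ge_1)
        qed
        ultimately show "s \<in> {a..b + e n}" by simp
      qed
      then have "closure {s. \<phi> n s \<noteq> 0} \<subseteq> {a..b + e n}" by (intro closure_minimal) auto
      also have "\<dots> \<subseteq> {0<..<t}" using ab le[of n] by (auto simp: field_simps)
      finally show "closure {s. \<phi> n s \<noteq> 0} \<subseteq> {0<..<t}" .
    qed
    have l1: "(\<lambda>n. integral {0..t} (\<lambda>s. \<phi> n s *\<^sub>R g s)) \<longlonglongrightarrow> integral {a..b} g"
      unfolding \<phi>_def by (rule cutoff_tendsto[OF g ab e0 elim])
    have la: "c + e n \<le> t" if "c \<le> b" for c n using that ab le[of n] by (simp add: field_simps)
    have "(\<lambda>n. integral {0..t} (\<lambda>s. (ramp' ((s - a) / e n) / e n) *\<^sub>R \<gamma> s) -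
        integral {0..t} (\<lambda>s. (ramp' ((s - b) / e n) / e n) *\<^sub>R \<gamma> s)) \<longlonglongrightarrow> \<gamma> a - \<gamma> b"
      by (intro tendsto_diff mollifier_tendsto \<gamma> e0 elim la) (use ab in auto)
    moreover have "integral {0..t} (\<lambda>s. \<phi>' n s *\<^sub>R \<gamma> s) =
        integral {0..t} (\<lambda>s. (ramp' ((s - a) / e n) / e n) *\<^sub>R \<gamma> s) -
        integral {0..t} (\<lambda>s. (ramp' ((s - b) / e n) / e n) *\<^sub>R \<gamma> s)" for n
      unfolding \<phi>'_def scaleR_diff_left
      by (intro integral_diff integrable_continuous_real continuous_on_scaleR continuous_on_scaled_ramp' \<gamma>)
    ultimately have "(\<lambda>n. - integral {0..t} (\<lambda>s. \<phi> n s *\<^sub>R g s)) \<longlonglongrightarrow> \<gamma> a - \<gamma> b"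
      by (simp add: eq)
    from LIMSEQ_unique[OF this tendsto_minus[OF l1]] show ?thesis by (metis minus_diff_eq minus_minus)
  qed
  define G where "G s = integral {0..s} g" for s
  have Gc: "continuous_on {0..t} G" unfolding G_def by (rule indefinite_integral_continuous_1[OF gi])
  have Gd: "integral {a..b} g = G b - G a" if "0 \<le> a" "a \<le> b" "b \<le> t" for a b
  proof -
    have "G a + integral {a..b} g = G b"
      unfolding G_def by (rule Henstock_Kurzweil_Integration.integral_combine) (use that integrable_subinterval_real[OF gi, of 0 b] in auto)
    then show ?thesis by (simp add: algebra_simps)
  qed
  have const: "G s - \<gamma> s = G (t/2) - \<gamma> (t/2)" if "s \<in> {0<..<t}" for s
  proof (cases "s = t/2")
    case False
    then consider "s < t/2" | "t/2 < s" by linarith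
    then show ?thesis
    proof cases
      case 1
      then show ?thesis using inner[of s "t/2"] Gd[of s "t/2"] that by (simp add: algebra_simps)
    next
      case 2
      then show ?thesis using inner[of "t/2" s] Gd[of "t/2" s] that by (simp add: algebra_simps)
    qed
  next
    case True
    then show ?thesis by (simp only:)
  qed
  have cl: "closure {0<..<t} = {0..t}" using t by simp
  have "G s - \<gamma> s = G (t/2) - \<gamma> (t/2)" if "s \<in> {0..t}" for s
    using continuous_constant_on_closure[of "{0<..<t}" "\<lambda>s. G s - \<gamma> s", OF _ const, of s] that
    unfolding cl by (auto intro!: continuous_intros Gc \<gamma>)
  from this[of a] this[of b] have "G a = G (t/2) - \<gamma> (t/2) + \<gamma> a" "G b = G (t/2) - \<gamma> (t/2) + \<gamma> b"
    using ab by (auto simp: diff_eq_eq)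
  then show ?thesis using Gd[OF ab] by simp
qed

section \<open>Tonelli Lagrangians at bounded speed\<close>

text \<open>
  \<open>D\<close> is the derivative of the Lagrangian. In the bound from below the second velocity is arbitrary:
  the ellipticity constant may tend to 0 at infinity, so beyond distance 1 convexity
  gives growth only to first order, whence the minimum.
\<close>

locale lagrangian_bounds =
  fixes L :: "'a::euclidean_space \<Rightarrow> 'a \<Rightarrow> real" and D :: "'a \<times> 'a \<Rightarrow> 'a \<times> 'a \<Rightarrow> real"
    and R c C :: real
  assumes R_pos: "R > 0" and c_pos: "c > 0" and C_ge_1: "C \<ge> 1"
    and linear_D: "linear (D p)"
    and lower: "norm v \<le> R \<Longrightarrow> L x' u \<ge> L x v + D (x, v) (x' - x, u - v)
        + c * min (norm (u - v)) ((norm (u - v))\<^sup>2) - C * norm (x' - x) * norm (u - v) - C * (norm (x' - x))\<^sup>2"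
    and upper: "norm v \<le> R \<Longrightarrow> norm u \<le> R \<Longrightarrow>
        L x' u \<le> L x v + D (x, v) (x' - x, u - v) + C * ((norm (x' - x))\<^sup>2 + (norm (u - v))\<^sup>2)"
    and D_bound: "norm v \<le> R \<Longrightarrow> \<bar>D (x, v) (a, b)\<bar> \<le> C * (norm a + norm b)"
    and D_lip: "norm v \<le> R \<Longrightarrow> \<bar>D (x, v) (0, b) - D (x', v) (0, b)\<bar> \<le> C * norm (x - x') * norm b"
    and L_bound: "norm v \<le> R \<Longrightarrow> \<bar>L x v\<bar> \<le> C"
    and L_coercive: "L x v \<ge> norm v - C"
    and continuous_L: "continuous_on UNIV (\<lambda>(x, v). L x v)"

section \<open>From the Tonelli conditions to uniform bounds at bounded speed\<close>

lemma C2_taylor: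
  assumes "C2_with_derivs F DF D2F"
  shows "\<exists>r\<in>{0<..<1}. F (p + q) = F p + DF p q + D2F (p + r *\<^sub>R q) q q / 2"
proof -
  have d1: "(F has_derivative blinfun_apply (DF p)) (at p)"
    and d2: "(DF has_derivative blinfun_apply (D2F p)) (at p)" for p
    using assms unfolding C2_with_derivs_def by auto
  define diff where "diff k r = (if k = (0::nat) then F (p + r *\<^sub>R q) else if k = 1 then DF (p + r *\<^sub>R q) q
      else D2F (p + r *\<^sub>R q) q q)" for k and r :: real
  have line: "((\<lambda>r. p + r *\<^sub>R q) has_derivative (\<lambda>h. h *\<^sub>R q)) (at r)" for r
    by (auto intro!: derivative_eq_intros)
  have e0: "(diff 0 has_real_derivative diff (Suc 0) r) (at r)" for r
  proof -
    have "((\<lambda>r. F (p + r *\<^sub>R q)) has_derivative (\<lambda>h. DF (p + r *\<^sub>R q) (h *\<^sub>R q))) (at r)"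
      using has_derivative_compose[OF line d1] .
    moreover have "(\<lambda>h. DF (p + r *\<^sub>R q) (h *\<^sub>R q)) = (*) (DF (p + r *\<^sub>R q) q)"
      by (auto simp: fun_eq_iff blinfun.scaleR_right)
    ultimately show ?thesis unfolding has_field_derivative_def diff_def by simp
  qed
  have e1: "(diff (Suc 0) has_real_derivative diff (Suc (Suc 0)) r) (at r)" for r
  proof -
    have "((\<lambda>r. DF (p + r *\<^sub>R q)) has_derivative (\<lambda>h. D2F (p + r *\<^sub>R q) (h *\<^sub>R q))) (at r)"
      using has_derivative_compose[OF line d2] .
    then have "((\<lambda>r. DF (p + r *\<^sub>R q) q) has_derivative (\<lambda>h. D2F (p + r *\<^sub>R q) (h *\<^sub>R q) q)) (at r)"
      by (rule bounded_linear.has_derivative[OF blinfun.bounded_linear_left])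
    moreover have "(\<lambda>h. D2F (p + r *\<^sub>R q) (h *\<^sub>R q) q) = (*) (D2F (p + r *\<^sub>R q) q q)"
      by (auto simp: fun_eq_iff blinfun.scaleR_right blinfun.scaleR_left)
    ultimately show ?thesis unfolding has_field_derivative_def diff_def by simp
  qed
  have "\<exists>t>0. t < 1 \<and> diff 0 1 = (\<Sum>m<2. diff m 0 / fact m * 1 ^ m) + diff 2 t / fact 2 * 1 ^ 2"
  proof (rule Maclaurin)
    show "\<forall>m t. m < 2 \<and> 0 \<le> t \<and> t \<le> 1 \<longrightarrow> (diff m has_real_derivative diff (Suc m) t) (at t)"
      using e0 e1 by (auto simp: less_2_cases_iff)
  qed auto
  then show ?thesis by (auto simp: diff_def numeral_2_eq_2)
qed

text \<open>The Tonelli conditions bound partial derivatives; expansion in the standard basis turns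
  this into an operator bound, at the price of the dimension.\<close>

lemma Basis_bound_linear:
  fixes f :: "'a::euclidean_space \<Rightarrow>\<^sub>L real" and K :: real
  assumes "\<And>b. b \<in> Basis \<Longrightarrow> \<bar>f b\<bar> \<le> K"
  shows "\<bar>f p\<bar> \<le> real (DIM('a)) * K * norm p"
proof -
  have "f p = f (\<Sum>b\<in>Basis. (p \<bullet> b) *\<^sub>R b)" by (simp add: euclidean_representation)
  also have "\<dots> = (\<Sum>b\<in>Basis. (p \<bullet> b) * f b)" by (simp add: blinfun.sum_right blinfun.scaleR_right)
  also have "\<bar>\<dots>\<bar> \<le> (\<Sum>b\<in>(Basis::'a set). norm p * K)"
    by (intro order_trans[OF sum_abs] sum_mono) (auto simp: abs_mult intro!: mult_mono assms Basis_le_norm)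
  finally show ?thesis by (simp add: mult_ac)
qed

lemma norm_segment_le:
  fixes v u :: "'a::real_normed_vector"
  assumes "norm v \<le> R" "norm u \<le> R" "r \<in> {0<..<1}"
  shows "norm (v + r *\<^sub>R (u - v)) \<le> R"
proof -
  have "(1 - r) *\<^sub>R v + r *\<^sub>R u \<in> cball 0 R"
    using assms by (intro convexD[OF convex_cball]) auto
  then show ?thesis by (simp add: algebra_simps)
qed

text \<open>For velocities in the ball of radius \<open>R\<close>, which is convex, Taylor
  expansions only see \<open>K R\<close>, whatever the positions. The delicate clause is
  \<open>lower\<close>, where the second velocity is unrestricted: convexity is used at a fixed
  position, and the position is moved at the bounded velocity only.\<close>

lemma C2_bounds_imp_lagrangian_bounds:
  fixes L :: "'a::euclidean_space \<Rightarrow> 'a \<Rightarrow> real"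
  assumes C2: "C2_with_derivs (\<lambda>(x, v). L x v) DL D2L"
    and nu: "antimono_on {0..} \<nu>" "\<And>r. r \<ge> 0 \<Longrightarrow> 0 < \<nu> r"
      "\<And>x v w. D2L (x, v) (0, w) (0, w) \<ge> \<nu> (norm v) * (norm w)\<^sup>2"
    and th: "superlinear \<theta>" "c\<^sub>0 > 0"
      "\<And>x v. \<theta>' (norm v) \<ge> L x v" "\<And>x v. L x v \<ge> \<theta> (norm v) - c\<^sub>0"
    and K: "mono_on {0..} K" "\<And>r. r \<ge> 0 \<Longrightarrow> 0 \<le> K r"
      "\<And>x v b. b \<in> Basis \<Longrightarrow> \<bar>DL (x, v) b\<bar> \<le> K (norm v)"
      "\<And>x v b b'. b \<in> Basis \<Longrightarrow> b' \<in> Basis \<Longrightarrow> \<bar>D2L (x, v) b b'\<bar> \<le> K (norm v)"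
    and R: "R > 0"
  shows "\<exists>c C. lagrangian_bounds L (\<lambda>p. blinfun_apply (DL p)) R c C"
proof -
  define m where "m = real (DIM('a \<times> 'a))"
  have m: "m \<ge> 1" unfolding m_def by (metis One_nat_def Suc_leI DIM_positive of_nat_1 of_nat_le_iff)
  \<comment> \<open>Two factors \<open>m\<close>, since the second derivative is estimated in each
    of its two arguments.\<close>
  define B where "B = m * (m * K R)"
  have KR: "K r \<le> K R" if "0 \<le> r" "r \<le> R" for r using monotone_onD[OF K(1), of r R] that by auto
  have mK: "0 \<le> m * K R" using m K(2)[of R] R by simp
  have B0: "B \<ge> 0" "m * K R \<le> B" unfolding B_def using m mK by (auto simp: mult_le_cancel_right1)
  have D1: "\<bar>DL (x, v) q\<bar> \<le> B * norm q" if "norm v \<le> R" for x v q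
  proof -
    have "\<bar>DL (x, v) q\<bar> \<le> m * K R * norm q"
      unfolding m_def by (rule Basis_bound_linear) (use K(3) KR[OF norm_ge_zero that] order_trans in blast)
    also have "\<dots> \<le> B * norm q" using B0 by (intro mult_right_mono) auto
    finally show ?thesis .
  qed
  have D2: "\<bar>D2L (x, v) q q'\<bar> \<le> B * norm q * norm q'" if v: "norm v \<le> R" for x v q q'
  proof -
    have "\<bar>D2L (x, v) q b\<bar> \<le> m * K R * norm q" if b: "b \<in> Basis" for b
    proof -
      have lin: "linear (\<lambda>q. D2L (x, v) q b)"
        by (rule linearI) (simp_all only: blinfun.add_left blinfun.add_right blinfun.scaleR_left blinfun.scaleR_right real_scaleR_def)
      have "bounded_linear (\<lambda>q. D2L (x, v) q b)" using lin by (rule linear_conv_bounded_linear[THEN iffD1])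
      then have ap: "blinfun_apply (Blinfun (\<lambda>q. D2L (x, v) q b)) = (\<lambda>q. D2L (x, v) q b)"
        by (rule bounded_linear_Blinfun_apply)
      have "\<bar>Blinfun (\<lambda>q. D2L (x, v) q b) q\<bar> \<le> m * K R * norm q"
        unfolding m_def by (rule Basis_bound_linear, unfold ap)
          (use K(4) b KR[OF norm_ge_zero v] order_trans in blast)
      then show ?thesis unfolding ap .
    qed
    then have "\<bar>D2L (x, v) q q'\<bar> \<le> real (DIM('a \<times> 'a)) * (m * K R * norm q) * norm q'"
      by (rule Basis_bound_linear)
    then show ?thesis by (simp add: B_def m_def mult_ac)
  qed
  have tay: "\<exists>r\<in>{0<..<1}. L x' u = L x v + DL (x, v) (x' - x, u - v)
      + D2L (x + r *\<^sub>R (x' - x), v + r *\<^sub>R (u - v)) (x' - x, u - v) (x' - x, u - v) / 2" for x x' v u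
    using C2_taylor[OF C2, of "(x, v)" "(x' - x, u - v)"] by (auto simp: algebra_simps)
  \<comment> \<open>Speeds up to \<open>R + 1\<close> occur: the ball of radius \<open>R\<close> and
    the unit step on which strong convexity is exploited. The half is that of the Taylor
    formula.\<close>
  define c where "c = \<nu> (R + 1) / 2"
  have c: "c > 0" unfolding c_def using nu(2)[of "R + 1"] R by simp
  have DL_scale: "DL p (0, a *\<^sub>R w) = a * DL p (0, w)" for p a w
    using blinfun.scaleR_right[of "DL p" a "(0, w)"] by simp
  have DL_Pair: "DL p (a, b) = DL p (a, 0) + DL p (0, b)" for p a b
    using blinfun.add_right[of "DL p" "(a, 0)" "(0, b)"] by simp
  have convv: "L x u \<ge> L x v + DL (x, v) (0, u - v)" for x u v
  proof -
    obtain r where "L x u = L x v + DL (x, v) (0, u - v)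
      + D2L (x, v + r *\<^sub>R (u - v)) (0, u - v) (0, u - v) / 2"
      using tay[where x = x and x' = x and u = u and v = v] by auto
    moreover have "D2L (x, v + r *\<^sub>R (u - v)) (0, u - v) (0, u - v) \<ge> 0"
      using nu(2)[of "norm (v + r *\<^sub>R (u - v))"]
      by (intro order_trans[OF _ nu(3)]) (auto intro!: mult_nonneg_nonneg)
    ultimately show ?thesis by simp
  qed
  have sconv: "L x u \<ge> L x v + DL (x, v) (0, u - v) + c * (norm (u - v))\<^sup>2"
    if uv: "norm v \<le> R + 1" "norm u \<le> R + 1" for x u v
  proof -
    obtain r where r: "r \<in> {0<..<1}" and t: "L x u = L x v + DL (x, v) (0, u - v)
      + D2L (x, v + r *\<^sub>R (u - v)) (0, u - v) (0, u - v) / 2"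
      using tay[where x = x and x' = x and u = u and v = v] by auto
    have "\<nu> (R + 1) \<le> \<nu> (norm (v + r *\<^sub>R (u - v)))"
      using monotone_onD[OF nu(1), of "norm (v + r *\<^sub>R (u - v))" "R + 1"] norm_segment_le[OF uv r] R by auto
    then have "\<nu> (R + 1) * (norm (u - v))\<^sup>2 \<le> D2L (x, v + r *\<^sub>R (u - v)) (0, u - v) (0, u - v)"
      by (intro order_trans[OF mult_right_mono nu(3)]) auto
    then show ?thesis unfolding t c_def by simp
  qed
  have low1: "L x u \<ge> L x v + DL (x, v) (0, u - v) + c * min (norm (u - v)) ((norm (u - v))\<^sup>2)"
    if v: "norm v \<le> R" for x u v
  proof (cases "norm (u - v) \<le> 1")
    case True
    have "norm u \<le> R + 1" using norm_triangle_ineq[of v "u - v"] v True by simp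
    then have "L x u \<ge> L x v + DL (x, v) (0, u - v) + c * (norm (u - v))\<^sup>2" using sconv v by simp
    moreover have "c * min (norm (u - v)) ((norm (u - v))\<^sup>2) \<le> c * (norm (u - v))\<^sup>2"
      using c by (intro mult_left_mono) auto
    ultimately show ?thesis by linarith
  next
    case False
    \<comment> \<open>Beyond distance 1, strong convexity is used on the first unit step
      \<open>e\<close> only. Adding \<open>a1\<close> and \<open>a2\<close> shows that the slope in
      the direction \<open>e\<close> has grown by \<open>2 * c\<close> at \<open>v + e\<close>;
      plain convexity carries this slope on, which gives growth of first order.\<close>
    define s where "s = norm (u - v)"
    define e where "e = (1 / s) *\<^sub>R (u - v)"
    have s: "s > 1" using False by (simp add: s_def)
    have e: "norm e = 1" "u - v = s *\<^sub>R e" using s by (auto simp: e_def s_def)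
    have w: "norm (v + e) \<le> R + 1" using norm_triangle_ineq[of v e] v e by simp
    have a1: "L x (v + e) \<ge> L x v + DL (x, v) (0, e) + c" using sconv[of v "v + e" x] w v e by simp
    have a2: "L x v \<ge> L x (v + e) - DL (x, v + e) (0, e) + c"
      using sconv[of "v + e" v x] w v e DL_scale[of "(x, v + e)" "-1" e] by simp
    have ue: "u - (v + e) = (s - 1) *\<^sub>R e" using e by (simp add: algebra_simps)
    have a3: "L x u \<ge> L x (v + e) + (s - 1) * DL (x, v + e) (0, e)"
      using convv[of x "v + e" u] unfolding ue DL_scale .
    have "(s - 1) * DL (x, v + e) (0, e) \<ge> (s - 1) * (DL (x, v) (0, e) + 2 * c)"
      using a1 a2 s by (intro mult_left_mono) auto
    then have "L x u \<ge> L x v + s * DL (x, v) (0, e) + c + (s - 1) * (2 * c)"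
      using a1 a3 by (simp add: algebra_simps)
    moreover have "c + (s - 1) * (2 * c) \<ge> c * s" using s c mult_left_mono[of 1 s c] by (simp add: algebra_simps)
    moreover have "c * min s (s\<^sup>2) \<le> c * s" using c by (intro mult_left_mono) auto
    moreover have "DL (x, v) (0, u - v) = s * DL (x, v) (0, e)" unfolding e(2) DL_scale ..
    ultimately show ?thesis unfolding s_def[symmetric] by linarith
  qed
  have nP: "(norm (a, b))\<^sup>2 = (norm a)\<^sup>2 + (norm b)\<^sup>2" for a b :: 'a by (simp add: norm_Pair)
  have tay2: "\<bar>L x' u - (L x v + DL (x, v) (x' - x, u - v))\<bar> \<le> B * ((norm (x' - x))\<^sup>2 + (norm (u - v))\<^sup>2)"
    if uv: "norm v \<le> R" "norm u \<le> R" for x x' u v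
  proof -
    obtain r where r: "r \<in> {0<..<1}" and t: "L x' u = L x v + DL (x, v) (x' - x, u - v)
      + D2L (x + r *\<^sub>R (x' - x), v + r *\<^sub>R (u - v)) (x' - x, u - v) (x' - x, u - v) / 2"
      using tay by blast
    define d where "d = D2L (x + r *\<^sub>R (x' - x), v + r *\<^sub>R (u - v)) (x' - x, u - v) (x' - x, u - v)"
    have "\<bar>d\<bar> \<le> B * norm (x' - x, u - v) * norm (x' - x, u - v)"
      unfolding d_def by (rule D2[OF norm_segment_le[OF uv r]])
    also have "\<dots> = B * ((norm (x' - x))\<^sup>2 + (norm (u - v))\<^sup>2)"
      unfolding nP[symmetric] by (simp add: power2_eq_square)
    finally show ?thesis using t unfolding d_def[symmetric] by (simp add: abs_le_iff)
  qed
  have Dl: "\<bar>DL (x, v) (0, b) - DL (x', v) (0, b)\<bar> \<le> B * norm (x - x') * norm b" if v: "norm v \<le> R" for x x' v b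
  proof -
    have d2: "(DL has_derivative blinfun_apply (D2L p)) (at p)" for p
      using C2 unfolding C2_with_derivs_def by fastforce
    have line: "((\<lambda>y. (y, v)) has_derivative (\<lambda>h. (h, 0))) (at y within UNIV)" for y
      by (auto intro!: derivative_eq_intros)
    have der: "((\<lambda>y. DL (y, v) (0, b)) has_derivative (\<lambda>h. D2L (y, v) (h, 0) (0, b))) (at y within UNIV)" for y
      by (rule bounded_linear.has_derivative[OF blinfun.bounded_linear_left has_derivative_compose[OF line d2]])
    have "norm (DL (x, v) (0, b) - DL (x', v) (0, b)) \<le> B * norm b * norm (x - x')"
    proof (rule differentiable_bound[OF convex_UNIV der])
      fix y
      show "onorm (\<lambda>h. D2L (y, v) (h, 0) (0, b)) \<le> B * norm b"
      proof (rule onorm_le)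
        fix h show "norm (D2L (y, v) (h, 0) (0, b)) \<le> B * norm b * norm h"
          using D2[OF v, of y "(h, 0)" "(0, b)"] by (simp add: norm_Pair mult_ac)
      qed
    qed auto
    then show ?thesis by (simp add: mult_ac)
  qed
  \<comment> \<open>Beyond some \<open>r0\<close> superlinearity gives slope 1; below it
    nonnegativity suffices, with \<open>\<bar>r0\<bar>\<close> moved into the constant.\<close>
  have "\<exists>r0. \<forall>r\<ge>r0. \<theta> r / r \<ge> 1"
    using th(1) unfolding superlinear_def filterlim_at_top eventually_at_top_linorder by blast
  then obtain r0 where r0: "\<And>r. r \<ge> r0 \<Longrightarrow> \<theta> r / r \<ge> 1" by blast
  have coer: "L x v \<ge> norm v - (\<bar>r0\<bar> + c\<^sub>0)" for x v
  proof (cases "norm v \<ge> \<bar>r0\<bar> \<and> norm v > 0")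
    case True
    then have "\<theta> (norm v) \<ge> norm v" using r0[of "norm v"] by (auto simp: field_simps split: if_splits)
    then show ?thesis using th(4)[of v x] by linarith
  next
    case False
    then have "norm v \<le> \<bar>r0\<bar>" by (metis abs_ge_zero linorder_not_less nle_le norm_ge_zero)
    moreover have "\<theta> (norm v) \<ge> 0" using th(1) unfolding superlinear_def by simp
    ultimately show ?thesis using th(4)[of v x] by linarith
  qed
  \<comment> \<open>One constant for all clauses: \<open>B\<close> for the derivatives,
    \<open>\<bar>r0\<bar> + c\<^sub>0\<close> for coercivity, and the remaining terms for the size
    of the Lagrangian at speed at most \<open>R\<close>, expanded around velocity 0.\<close>
  define C where "C = 1 + B + \<bar>r0\<bar> + c\<^sub>0 + \<bar>\<theta>' 0\<bar> + B * R + B * R\<^sup>2"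
  have BR: "0 \<le> B * R" "0 \<le> B * R\<^sup>2" using B0 R by auto
  have BC: "B \<le> C" "1 \<le> C" "\<bar>r0\<bar> + c\<^sub>0 \<le> C" unfolding C_def using B0 BR th(2) by auto
  have BCm: "B * a \<le> C * a" if "a \<ge> 0" for a using BC that by (intro mult_right_mono)
  show ?thesis
  proof (rule exI[of _ c], rule exI[of _ C], rule lagrangian_bounds.intro)
    show "R > 0" "c > 0" "1 \<le> C" using R c BC by auto
    show "linear (blinfun_apply (DL p))" for p by (rule linearI) (simp_all only: blinfun.add_right blinfun.scaleR_right)
    fix x x' v u a b :: 'a
    show "\<bar>DL (x, v) (0, b) - DL (x', v) (0, b)\<bar> \<le> C * norm (x - x') * norm b" if "norm v \<le> R"
      using Dl[OF that, of x b x'] BCm[of "norm (x - x') * norm b"] by (simp add: mult_ac)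
    show "\<bar>DL (x, v) (a, b)\<bar> \<le> C * (norm a + norm b)" if "norm v \<le> R"
    proof -
      have "\<bar>DL (x, v) (a, b)\<bar> \<le> B * norm (a, b)" by (rule D1[OF that])
      also have "\<dots> \<le> B * (norm a + norm b)" using B0 norm_Pair_le[of a b] by (intro mult_left_mono) auto
      also have "\<dots> \<le> C * (norm a + norm b)" by (intro BCm) auto
      finally show ?thesis .
    qed
    show "\<bar>L x v\<bar> \<le> C" if v: "norm v \<le> R"
    proof -
      have "\<bar>L x v - (L x 0 + DL (x, 0) (0, v))\<bar> \<le> B * (norm v)\<^sup>2"
        using tay2[of 0 v x x] v R by simp
      moreover have "B * (norm v)\<^sup>2 \<le> B * R\<^sup>2" using v B0 by (intro mult_left_mono power_mono) auto
      moreover have "\<bar>DL (x, 0) (0, v)\<bar> \<le> B * R"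
        using D1[of 0 x "(0, v)"] mult_left_mono[OF v B0(1)] R by (simp add: norm_Pair)
      moreover have "L x 0 \<le> \<theta>' 0" "- c\<^sub>0 \<le> L x 0"
        using th(3)[of x 0] th(4)[of 0 x] th(1) unfolding superlinear_def by (auto simp: algebra_simps dest!: spec[of _ 0])
      ultimately show ?thesis unfolding C_def using B0 th(2) by auto
    qed
    show "norm v - C \<le> L x v" using coer[of v x] BC by linarith
    show "L x' u \<le> L x v + DL (x, v) (x' - x, u - v) + C * ((norm (x' - x))\<^sup>2 + (norm (u - v))\<^sup>2)"
      if "norm v \<le> R" "norm u \<le> R"
      using tay2[OF that, of x' x] BCm[of "(norm (x' - x))\<^sup>2 + (norm (u - v))\<^sup>2"] by (simp add: abs_le_iff)
    show "L x' u \<ge> L x v + DL (x, v) (x' - x, u - v)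
        + c * min (norm (u - v)) ((norm (u - v))\<^sup>2) - C * norm (x' - x) * norm (u - v) - C * (norm (x' - x))\<^sup>2"
      if v: "norm v \<le> R"
    proof -
      \<comment> \<open>At \<open>x'\<close>, convexity in the velocity deals with a far
        \<open>u\<close>; the passage from \<open>x\<close> to \<open>x'\<close> is made at velocity
        \<open>v\<close>, where derivatives are bounded. The mixed term is the Lipschitz dependence
        of the velocity derivative on the position.\<close>
      have "L x' u \<ge> L x' v + DL (x', v) (0, u - v) + c * min (norm (u - v)) ((norm (u - v))\<^sup>2)" by (rule low1[OF v])
      moreover have "L x' v \<ge> L x v + DL (x, v) (x' - x, 0) - C * (norm (x' - x))\<^sup>2"
        using tay2[OF v v, of x' x] BCm[of "(norm (x' - x))\<^sup>2"] by (simp add: abs_le_iff)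
      moreover have "DL (x', v) (0, u - v) \<ge> DL (x, v) (0, u - v) - C * norm (x' - x) * norm (u - v)"
        using Dl[OF v, of x' "u - v" x] BCm[of "norm (x' - x) * norm (u - v)"] by (simp add: mult_ac abs_le_iff)
      moreover have "DL (x, v) (x' - x, u - v) = DL (x, v) (x' - x, 0) + DL (x, v) (0, u - v)" by (rule DL_Pair)
      ultimately show ?thesis by linarith
    qed
  next
    show "continuous_on UNIV (\<lambda>(x, v). L x v)"
      using C2 unfolding C2_with_derivs_def
      by (intro differentiable_imp_continuous_on) (auto simp: differentiable_on_def differentiable_def)
  qed
qed

lemma tonelli_imp_lagrangian_bounds:
  fixes L :: "real^'n \<Rightarrow> real^'n \<Rightarrow> real"
  assumes "tonelli_lagrangian L" "R > 0"
  shows "\<exists>D c C. lagrangian_bounds L D R c C"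
proof -
  obtain DL D2L \<nu> \<theta> \<theta>' c\<^sub>0 K where h: "C2_with_derivs (\<lambda>(x, v). L x v) DL D2L"
    "antimono_on {0..} \<nu>" "\<forall>r\<ge>0. 0 < \<nu> r"
      "\<forall>x v w. D2L (x, v) (0, w) (0, w) \<ge> \<nu> (norm v) * (norm w)\<^sup>2"
    "superlinear \<theta>" "c\<^sub>0 > 0"
      "\<forall>x v. \<theta>' (norm v) \<ge> L x v \<and> L x v \<ge> \<theta> (norm v) - c\<^sub>0"
    "mono_on {0..} K" "\<forall>r\<ge>0. 0 \<le> K r"
      "\<forall>x v. (\<forall>b\<in>Basis. \<bar>DL (x, v) b\<bar> \<le> K (norm v)) \<and>
                (\<forall>b\<in>Basis. \<forall>b'\<in>Basis. \<bar>D2L (x, v) b b'\<bar> \<le> K (norm v))"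
    using assms(1) unfolding tonelli_lagrangian_def by (elim exE conjE)
  show ?thesis
    using C2_bounds_imp_lagrangian_bounds[of L DL D2L \<nu> \<theta> c\<^sub>0 \<theta>' K R, OF h(1,2) _ _ h(5,6) _ _ h(8) _ _ _ assms(2)] h
    by blast
qed

section \<open>Minimizers of the discrete action\<close>

text \<open>Velocities are the unknowns: admissible curves form a product of balls cut by one affine
  equation, curves over different times are compared step by step, and averaging curves means
  averaging velocities.\<close>

definition node :: "nat \<Rightarrow> real \<Rightarrow> 'a::real_vector \<Rightarrow> (nat \<Rightarrow> 'a) \<Rightarrow> nat \<Rightarrow> 'a" where
  "node N t x v i = x + (t / real N) *\<^sub>R (\<Sum>j<i. v j)"

text \<open>A left-end Riemann sum: node \<open>i\<close> is the position before the step with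
  velocity \<open>v i\<close>.\<close>

definition discrete_action ::
  "('a::real_vector \<Rightarrow> 'a \<Rightarrow> real) \<Rightarrow> nat \<Rightarrow> real \<Rightarrow> 'a \<Rightarrow> (nat \<Rightarrow> 'a) \<Rightarrow> real" where
  "discrete_action L N t x v = (\<Sum>i<N. (t / real N) * L (node N t x v i) (v i))"

lemma node_shift: "node N t x (\<lambda>i. v i + e *\<^sub>R w i) i = node N t x v i + e *\<^sub>R node N t 0 w i"
  by (simp add: node_def sum.distrib scaleR_sum_right[symmetric] algebra_simps)

lemma norm_node_diff_le:
  fixes v :: "nat \<Rightarrow> 'a::real_normed_vector"
  assumes "t \<ge> 0" "i \<le> N" "j \<le> N" "N > 0" and v: "\<And>k. k < N \<Longrightarrow> norm (v k) \<le> B" and B: "B \<ge> 0"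
  shows "norm (node N t x v i - node N t x v j) \<le> t * B"
proof -
  have *: "norm (node N t x v i - node N t x v j) \<le> t * B" if "j \<le> i" "i \<le> N" for i j
  proof -
    have "(\<Sum>k<i. v k) - (\<Sum>k<j. v k) = (\<Sum>k\<in>{j..<i}. v k)"
      using that by (simp add: sum_diff_nat_ivl lessThan_atLeast0 sum.atLeastLessThan_concat[symmetric, of 0 j i])
    then have "node N t x v i - node N t x v j = (t / real N) *\<^sub>R (\<Sum>k\<in>{j..<i}. v k)"
      by (simp add: node_def scaleR_diff_right[symmetric])
    moreover have "norm (\<Sum>k\<in>{j..<i}. v k) \<le> real N * B"
    proof -
      have "norm (\<Sum>k\<in>{j..<i}. v k) \<le> (\<Sum>k\<in>{j..<i}. B)" using that by (intro order_trans[OF norm_sum sum_mono] v) auto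
      also have "\<dots> \<le> real N * B" using that B by (auto intro!: mult_right_mono)
      finally show ?thesis .
    qed
    then have "(t / real N) * norm (\<Sum>k\<in>{j..<i}. v k) \<le> (t / real N) * (real N * B)"
      using assms by (intro mult_left_mono) auto
    ultimately have "norm (node N t x v i - node N t x v j) \<le> (t / real N) * (real N * B)"
      using assms by simp
    then show ?thesis using assms by simp
  qed
  show ?thesis
  proof (cases "j \<le> i")
    case True then show ?thesis using * assms by blast
  next
    case False
    then show ?thesis using *[of i j] assms by (simp add: norm_minus_commute)
  qed
qed

context lagrangian_bounds
begin

lemma R_nonneg: "R \<ge> 0" using R_pos by simp

lemma D_add: "D p (q + q') = D p q + D p q'" using linear_add[OF linear_D] .
lemma D_scale: "D p (r *\<^sub>R q) = r * D p q" using linear_scale[OF linear_D] by simp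
lemma D_split: "D p (a, b) = D p (a, 0) + D p (0, b)" using D_add[of p "(a, 0)" "(0, b)"] by simp
lemma D_scale_snd: "D p (0, r *\<^sub>R b) = r * D p (0, b)" using D_scale[of p r "(0, b)"] by simp
lemma D_minus_fst: "D p (- a, 0) = - D p (a, 0)" using D_scale[of p "-1" "(a, 0)"] by simp
lemma D_zero: "D p 0 = 0" using linear_0[OF linear_D] .

section \<open>Existence, first variation and speed of discrete minimizers\<close>

text \<open>Bounding \<open>v\<close> at every index spares an index condition in later uses;
  competitors are constrained only at the indices that matter.\<close>

definition is_minimizer :: "nat \<Rightarrow> real \<Rightarrow> 'a \<Rightarrow> 'a \<Rightarrow> (nat \<Rightarrow> 'a) \<Rightarrow> bool" where
  "is_minimizer N t x y v \<longleftrightarrow> (\<forall>i. norm (v i) \<le> R) \<and> node N t x v N = y \<and>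
     (\<forall>u. (\<forall>i<N. norm (u i) \<le> R) \<longrightarrow> node N t x u N = y \<longrightarrow>
        discrete_action L N t x v \<le> discrete_action L N t x u)"

text \<open>Tychonoff makes the sequences with values in the ball compact, the end point condition
  is closed, the action is continuous, and the constant velocity is admissible because
  \<open>norm (y - x) \<le> R * t\<close>.\<close>

lemma minimizer_exists:
  assumes N: "N > 0" and t: "t > 0" and xy: "norm (y - x) \<le> R * t"
  shows "\<exists>v. is_minimizer N t x y v"
proof -
  define K where "K = PiE UNIV (\<lambda>_::nat. cball (0::'a) R) \<inter> {v. node N t x v N = y}"
  have nodec: "continuous_on UNIV (\<lambda>v. node N t x v i)" for i
    unfolding node_def by (intro continuous_intros continuous_on_product_coordinates)
  have "compactin (product_topology (\<lambda>_. euclidean) UNIV) (PiE UNIV (\<lambda>_::nat. cball (0::'a) R))"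
    by (subst compactin_PiE) auto
  then have "compact (PiE UNIV (\<lambda>_::nat. cball (0::'a) R))"
    by (simp add: euclidean_product_topology)
  moreover have "closed {v. node N t x v N = y}"
    by (rule closed_Collect_eq[OF nodec]) (rule continuous_on_const)
  ultimately have cK: "compact K" unfolding K_def by (rule compact_Int_closed)
  have "norm ((y - x) /\<^sub>R t) = norm (y - x) / t" using t by (simp add: divide_inverse mult.commute)
  also have "\<dots> \<le> R" using t xy by (simp add: pos_divide_le_eq)
  finally have const: "(\<lambda>_. (y - x) /\<^sub>R t) \<in> K"
    using N t by (auto simp: K_def node_def sum_constant_scaleR)
  have cL: "continuous_on UNIV (\<lambda>v. L (node N t x v i) (v i))" for i
  proof -
    have "continuous_on UNIV (\<lambda>v. (node N t x v i, v i))"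
      by (intro continuous_on_Pair nodec continuous_on_product_coordinates)
    from continuous_on_compose2[OF continuous_L this] show ?thesis by simp
  qed
  have "continuous_on UNIV (\<lambda>v. discrete_action L N t x v)"
    unfolding discrete_action_def by (intro continuous_intros cL)
  then have "continuous_on K (discrete_action L N t x)" by (rule continuous_on_subset) auto
  then obtain v where v: "v \<in> K" "\<And>u. u \<in> K \<Longrightarrow> discrete_action L N t x v \<le> discrete_action L N t x u"
    using continuous_attains_inf[OF cK] const by blast
  have "discrete_action L N t x v \<le> discrete_action L N t x u"
    if u: "\<forall>i<N. norm (u i) \<le> R" "node N t x u N = y" for u
  proof -
    \<comment> \<open>Entries from \<open>N\<close> on are set to 0, to fit the compact set of full
      sequences; neither the nodes up to \<open>N\<close> nor the action change.\<close>
    define u' where "u' i = (if i < N then u i else 0)" for i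
    have nu: "node N t x u' i = node N t x u i" if "i \<le> N" for i
    proof -
      have "(\<Sum>j<i. u' j) = (\<Sum>j<i. u j)" using that by (intro sum.cong) (auto simp: u'_def)
      then show ?thesis by (simp add: node_def)
    qed
    have "u' \<in> K" using u nu[of N] R_nonneg by (auto simp: K_def u'_def)
    moreover have "discrete_action L N t x u' = discrete_action L N t x u"
      unfolding discrete_action_def by (intro sum.cong refl) (simp add: nu u'_def)
    ultimately show ?thesis using v(2) by metis
  qed
  then show ?thesis using v(1) unfolding is_minimizer_def K_def by (intro exI[of _ v]) (auto simp: PiE_UNIV_domain)
qed

text \<open>The variation is one-sided because the speed constraint may be active. By
  \<open>upper\<close> the remainder is quadratic in \<epsilon>, so a negative first-order sum would
  lower the action for small \<epsilon>.\<close>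

lemma minimizer_variation:
  assumes min: "is_minimizer N t x y v" and N: "N > 0" and t: "t > 0"
    and w: "node N t 0 w N = 0" and e: "e > 0"
    and adm: "\<And>\<epsilon> i. 0 < \<epsilon> \<Longrightarrow> \<epsilon> \<le> e \<Longrightarrow> i < N \<Longrightarrow> norm (v i + \<epsilon> *\<^sub>R w i) \<le> R"
  shows "0 \<le> (\<Sum>i<N. D (node N t x v i, v i) (node N t 0 w i, w i))" (is "0 \<le> ?S")
proof -
  define Q where "Q = (\<Sum>i<N. C * ((norm (node N t 0 w i))\<^sup>2 + (norm (w i))\<^sup>2))"
  have Q: "Q \<ge> 0" unfolding Q_def using C_ge_1 by (intro sum_nonneg) auto
  have step: "0 \<le> ?S + \<epsilon> * Q" if \<epsilon>: "0 < \<epsilon>" "\<epsilon> \<le> e" for \<epsilon>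
  proof -
    define u where "u = (\<lambda>i. v i + \<epsilon> *\<^sub>R w i)"
    have un: "u i = v i + \<epsilon> *\<^sub>R w i" for i by (simp add: u_def)
    have nu: "node N t x u i = node N t x v i + \<epsilon> *\<^sub>R node N t 0 w i" for i
      unfolding u_def by (rule node_shift)
    have "discrete_action L N t x v \<le> discrete_action L N t x u"
      using min adm[OF \<epsilon>] nu[of N] w un unfolding is_minimizer_def by simp
    also have "\<dots> \<le> (\<Sum>i<N. (t / real N) * (L (node N t x v i) (v i)
        + \<epsilon> * D (node N t x v i, v i) (node N t 0 w i, w i)
        + \<epsilon>\<^sup>2 * (C * ((norm (node N t 0 w i))\<^sup>2 + (norm (w i))\<^sup>2))))"
      unfolding discrete_action_def
    proof (intro sum_mono mult_left_mono)
      fix i assume i: "i \<in> {..<N}"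
      have "norm (v i) \<le> R" using min unfolding is_minimizer_def by simp
      from upper[OF this, of "u i" "node N t x u i" "node N t x v i"]
      show "L (node N t x u i) (u i) \<le> L (node N t x v i) (v i)
        + \<epsilon> * D (node N t x v i, v i) (node N t 0 w i, w i)
        + \<epsilon>\<^sup>2 * (C * ((norm (node N t 0 w i))\<^sup>2 + (norm (w i))\<^sup>2))"
        using adm[OF \<epsilon>, of i] i \<epsilon> D_scale[of _ \<epsilon> "(node N t 0 w i, w i)"]
        by (simp add: nu un power_mult_distrib distrib_left mult_ac)
    qed (use t in auto)
    also have "\<dots> = discrete_action L N t x v + (t / real N * \<epsilon>) * (?S + \<epsilon> * Q)"
      unfolding discrete_action_def Q_def
      by (simp add: sum.distrib distrib_left sum_distrib_left power2_eq_square mult_ac)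
    finally have "0 \<le> (t / real N * \<epsilon>) * (?S + \<epsilon> * Q)" by simp
    moreover have "t / real N * \<epsilon> > 0" using t \<epsilon> N by simp
    ultimately show ?thesis by (simp only: zero_le_mult_iff) linarith
  qed
  show ?thesis
  proof (rule ccontr)
    assume "\<not> 0 \<le> ?S"
    then have neg: "?S < 0" by simp
    define \<epsilon> where "\<epsilon> = min e (- ?S / (2 * (Q + 1)))"
    have \<epsilon>: "\<epsilon> > 0" "\<epsilon> \<le> e" unfolding \<epsilon>_def using e neg Q by (auto simp: field_simps)
    have "\<epsilon> * Q \<le> (- ?S / (2 * (Q + 1))) * (Q + 1)"
      using Q \<epsilon> neg by (intro mult_mono) (auto simp: \<epsilon>_def)
    also have "\<dots> = - ?S / 2" using Q by (simp add: field_simps)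
    finally show False using step[OF \<epsilon>] neg by linarith
  qed
qed

text \<open>Moving the velocities of two time steps towards each other is always admissible.\<close>

lemma minimizer_oscillation:
  assumes min: "is_minimizer N t x y v" and N: "N > 0" and t: "t > 0"
    and small: "C * (1 + R) * t < 2 * c" and ij: "i < N" "j < N"
  shows "norm (v i - v j) < 1"
proof (cases "v i = v j")
  case False
  then have ne: "i \<noteq> j" by auto
  define a where "a = v j - v i"
  have a0: "norm a > 0" using False by (simp add: a_def)
  have vR: "norm (v k) \<le> R" for k using min unfolding is_minimizer_def by simp
  define w where "w k = (if k = i then a else 0) - (if k = j then a else 0)" for k
  have sw: "(\<Sum>l<k. w l) = (if i < k then a else 0) - (if j < k then a else 0)" for k
    unfolding w_def sum_subtractf by simp
  \<comment> \<open>Only nodes between the two time steps are displaced, by one step length times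
    \<open>a\<close>. The position terms thus total at most \<open>C * t * norm a\<close>, with a
    factor \<open>t\<close> that the velocity terms lack.\<close>
  define \<xi> where "\<xi> k = node N t 0 w k" for k
  have n\<xi>: "norm (\<xi> k) \<le> t / real N * norm a" for k
    using t by (auto simp: \<xi>_def node_def sw)
  have wN: "node N t 0 w N = 0" using ij by (simp add: node_def sw)
  have "0 \<le> (\<Sum>k<N. D (node N t x v k, v k) (node N t 0 w k, w k))"
  proof (rule minimizer_variation[OF min N t wN, of 1])
    fix \<epsilon> :: real and k assume \<epsilon>: "0 < \<epsilon>" "\<epsilon> \<le> 1" "k < N"
    have cv: "norm (p + \<epsilon> *\<^sub>R (q - p)) \<le> R" if "norm p \<le> R" "norm q \<le> R" for p q :: 'a
    proof -
      have "(1 - \<epsilon>) *\<^sub>R p + \<epsilon> *\<^sub>R q \<in> cball 0 R"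
        using that \<epsilon> by (intro convexD[OF convex_cball]) auto
      then show ?thesis by (simp add: algebra_simps)
    qed
    show "norm (v k + \<epsilon> *\<^sub>R w k) \<le> R"
      using cv[OF vR vR, of i j] cv[OF vR vR, of j i] vR[of k] ne unfolding w_def a_def by auto
  qed simp
  also have "\<dots> = (\<Sum>k<N. D (node N t x v k, v k) (\<xi> k, 0)) + (\<Sum>k<N. D (node N t x v k, v k) (0, w k))"
    unfolding \<xi>_def by (subst D_split) (rule sum.distrib)
  also have "(\<Sum>k<N. D (node N t x v k, v k) (\<xi> k, 0)) \<le> (\<Sum>k<N. C * (t / real N * norm a))"
  proof (intro sum_mono)
    fix k
    have "D (node N t x v k, v k) (\<xi> k, 0) \<le> C * norm (\<xi> k)" using D_bound[OF vR[of k], of "node N t x v k" "\<xi> k" 0] by simp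
    also have "\<dots> \<le> C * (t / real N * norm a)" using n\<xi> C_ge_1 by (intro mult_left_mono) auto
    finally show "D (node N t x v k, v k) (\<xi> k, 0) \<le> C * (t / real N * norm a)" .
  qed
  also have "\<dots> = C * t * norm a" using N by simp
  also have "(\<Sum>k<N. D (node N t x v k, v k) (0, w k)) = D (node N t x v i, v i) (0, a) - D (node N t x v j, v j) (0, a)"
  proof -
    have "D p (0, w k) = (if k = i then D p (0, a) else 0) - (if k = j then D p (0, a) else 0)" for p k
      using D_scale_snd[of p "-1" a] ne D_zero[of p] by (auto simp: w_def zero_prod_def)
    then show ?thesis using ij by (simp add: sum_subtractf)
  qed
  finally have 1: "0 \<le> C * t * norm a + (D (node N t x v i, v i) (0, a) - D (node N t x v j, v j) (0, a))" by simp
  have "\<bar>D (node N t x v j, v j) (0, a) - D (node N t x v i, v j) (0, a)\<bar>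
      \<le> C * norm (node N t x v j - node N t x v i) * norm a" by (rule D_lip[OF vR])
  also have "\<dots> \<le> C * (t * R) * norm a"
    using norm_node_diff_le[of t j N i v R x] t N ij vR R_nonneg C_ge_1
    by (intro mult_right_mono mult_left_mono) auto
  finally have 2: "- D (node N t x v j, v j) (0, a) \<le> - D (node N t x v i, v j) (0, a) + C * (t * R) * norm a" by linarith
  \<comment> \<open>\<open>D_lip\<close> has brought both derivatives to one node, at the cost of a
    drift of at most \<open>t * R\<close>. There the two convexity bounds \<open>3\<close> and
    \<open>4\<close> force a gap of at least \<open>2 * m\<close> between them; at distance 1 or
    more this is linear in \<open>norm a\<close> and contradicts \<open>small\<close>.\<close>
  define m where "m = c * min (norm a) ((norm a)\<^sup>2)"
  define X where "X = node N t x v i"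
  have 3: "L X (v j) \<ge> L X (v i) + D (X, v i) (0, a) + m"
    using lower[OF vR[of i], of X X "v j"] by (simp add: a_def m_def)
  have 4: "L X (v i) \<ge> L X (v j) - D (X, v j) (0, a) + m"
    using lower[OF vR[of j], of X X "v i"] D_scale_snd[of "(X, v j)" "-1" a]
    by (simp add: a_def m_def norm_minus_commute)
  have le: "2 * m \<le> C * (1 + R) * t * norm a"
    using 1 2 3 4 unfolding X_def[symmetric] by (simp add: algebra_simps)
  have "norm a < 1"
  proof (rule ccontr)
    assume "\<not> norm a < 1"
    then have "norm a * 1 \<le> norm a * norm a" by (intro mult_left_mono) auto
    then have "m = c * norm a" unfolding m_def by (simp add: power2_eq_square)
    then have "2 * c \<le> C * (1 + R) * t" using le a0 by simp
    then show False using small by simp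
  qed
  then show ?thesis by (simp add: a_def norm_minus_commute)
qed simp

text \<open>The mean velocity is \<open>(y - x) /\<^sub>R t\<close>, and each velocity is within 1
  of all the others, hence of the mean.\<close>

lemma minimizer_speed:
  assumes min: "is_minimizer N t x y v" and N: "N > 0" and t: "t > 0"
    and small: "C * (1 + R) * t < 2 * c" and xy: "norm (y - x) \<le> \<Lambda> * t" and i: "i < N"
  shows "norm (v i) < \<Lambda> + 1"
proof -
  have "y - x = (t / real N) *\<^sub>R (\<Sum>j<N. v j)" using min unfolding is_minimizer_def node_def by auto
  then have "(t / real N) * norm (\<Sum>j<N. v j) \<le> \<Lambda> * t" using xy t by simp
  then have sv: "norm (\<Sum>j<N. v j) \<le> real N * \<Lambda>" using t N by (simp add: field_simps)
  have "norm (\<Sum>j<N. v i - v j) \<le> (\<Sum>j<N. norm (v i - v j))" by (rule norm_sum)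
  also have "\<dots> < (\<Sum>j<N. 1)"
    using minimizer_oscillation[OF min N t small i] N by (intro sum_strict_mono) auto
  finally have "norm (\<Sum>j<N. v i - v j) < real N" by simp
  moreover have "real N *\<^sub>R v i = (\<Sum>j<N. v i - v j) + (\<Sum>j<N. v j)"
    by (simp add: sum_subtractf sum_constant_scaleR)
  then have "real N * norm (v i) \<le> norm (\<Sum>j<N. v i - v j) + norm (\<Sum>j<N. v j)"
    by (metis norm_triangle_ineq norm_scaleR abs_of_nat)
  ultimately have "real N * norm (v i) < real N * (\<Lambda> + 1)" using sv by (simp add: algebra_simps)
  then show ?thesis using N by simp
qed

text \<open>With unit slack below the speed bound, \<open>w\<close> and its negative are both
  admissible directions, so the one-sided inequality becomes the weak form of the discrete
  Euler-Lagrange equation.\<close>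

lemma minimizer_first_order:
  assumes min: "is_minimizer N t x y v" and N: "N > 0" and t: "t > 0"
    and vs: "\<And>i. i < N \<Longrightarrow> norm (v i) \<le> R - 1" and w: "node N t 0 w N = 0"
  shows "(\<Sum>i<N. D (node N t x v i, v i) (node N t 0 w i, w i)) = 0"
proof -
  have ge: "0 \<le> (\<Sum>i<N. D (node N t x v i, v i) (node N t 0 w i, w i))" if w: "node N t 0 w N = 0" for w
  proof (rule minimizer_variation[OF min N t w])
    define s where "s = (\<Sum>i<N. norm (w i))"
    have s: "s \<ge> 0" unfolding s_def by (intro sum_nonneg) auto
    show "1 / (1 + s) > 0" using s by simp
    fix \<epsilon> i assume \<epsilon>: "0 < \<epsilon>" "\<epsilon> \<le> 1 / (1 + s)" and i: "i < N"
    have "norm (w i) \<le> s" unfolding s_def using i by (intro member_le_sum) auto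
    then have "\<epsilon> * norm (w i) \<le> 1 / (1 + s) * (1 + s)" using \<epsilon> s by (intro mult_mono) auto
    also have "\<dots> = 1" using s by simp
    finally show "norm (v i + \<epsilon> *\<^sub>R w i) \<le> R"
      using vs[OF i] norm_triangle_ineq[of "v i" "\<epsilon> *\<^sub>R w i"] \<epsilon> by simp
  qed
  have "node N t 0 (\<lambda>i. - w i) i = - node N t 0 w i" for i
    by (simp add: node_def sum_negf)
  then have "0 \<le> (\<Sum>i<N. D (node N t x v i, v i) (- node N t 0 w i, - w i))"
    using ge[of "\<lambda>i. - w i"] w by simp
  also have "\<dots> = - (\<Sum>i<N. D (node N t x v i, v i) (node N t 0 w i, w i))"
  proof -
    have "D p (- a, - b) = - D p (a, b)" for p a b using D_scale[of p "-1" "(a, b)"] by simp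
    then show ?thesis by (simp add: sum_negf)
  qed
  finally show ?thesis using ge[OF w] by simp
qed

end

section \<open>Second differences of the discrete action\<close>

lemma average_power2_le:
  fixes f :: "nat \<Rightarrow> real"
  shows "((\<Sum>i<N. f i) / real N)\<^sup>2 \<le> (\<Sum>i<N. (f i)\<^sup>2) / real N"
proof (cases "N = 0")
  case False
  have "(\<Sum>i<N. f i)\<^sup>2 \<le> (\<Sum>i<N. (f i)\<^sup>2) * real N"
    using sum_squared_le_sum_of_squares[of f "{..<N}"] by simp
  then show ?thesis using False by (simp add: power2_eq_square field_simps)
qed simp

lemma power2_sum3_le: "(a + b + c)\<^sup>2 \<le> 3 * (a\<^sup>2 + b\<^sup>2 + (c::real)\<^sup>2)"
  using sum_squares_bound[of a b] sum_squares_bound[of a c] sum_squares_bound[of b c]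
  by (simp add: power2_eq_square algebra_simps)

lemma power2_sum2_le: "(a + b)\<^sup>2 \<le> 2 * (a\<^sup>2 + (b::real)\<^sup>2)"
  using sum_squares_bound[of a b] by (simp add: power2_eq_square algebra_simps)

context lagrangian_bounds
begin

section \<open>Bound from below for second differences\<close>

text \<open>Two velocities of norm at most \<open>R\<close> differ by at most \<open>2 * R\<close>,
  and on that range the minimum in \<open>lower\<close> is at least the square divided by
  \<open>1 + 2 * R\<close>: quadratic convexity is recovered.\<close>

definition \<kappa> :: real where "\<kappa> = c / (1 + 2 * R)"

lemma \<kappa>_pos: "\<kappa> > 0" using c_pos R_pos by (simp add: \<kappa>_def)

lemma \<kappa>_bound:
  assumes "0 \<le> r" "r \<le> 2 * R"
  shows "\<kappa> * r\<^sup>2 \<le> c * min r (r\<^sup>2)"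
proof -
  have "r\<^sup>2 \<le> (1 + 2 * R) * min r (r\<^sup>2)"
  proof (cases "r \<le> r\<^sup>2")
    case True
    have "r * r \<le> (1 + 2 * R) * r" using assms R_nonneg by (intro mult_right_mono) auto
    then show ?thesis using True by (simp add: power2_eq_square)
  next
    case False
    have "1 * r\<^sup>2 \<le> (1 + 2 * R) * r\<^sup>2" using R_nonneg by (intro mult_right_mono) auto
    then show ?thesis using False by simp
  qed
  then have "\<kappa> * r\<^sup>2 \<le> \<kappa> * ((1 + 2 * R) * min r (r\<^sup>2))" using \<kappa>_pos by (intro mult_left_mono) auto
  also have "\<dots> = c * min r (r\<^sup>2)" using R_pos by (simp add: \<kappa>_def)
  finally show ?thesis .
qed

text \<open>The price of a displacement: two expansions with weights \<open>t + h\<close> and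
  \<open>t - h\<close>, adding up to \<open>2 * t\<close>, and one more \<open>C\<close> for the
  first-order position terms, which do not cancel when the durations differ.\<close>

definition remainder_const where "remainder_const = 2 * (C + C\<^sup>2 / (2 * \<kappa>)) + C"

lemma remainder_const_pos: "remainder_const > 0" unfolding remainder_const_def using C_ge_1 \<kappa>_pos by (intro add_nonneg_pos) auto

text \<open>Young's inequality: half of the convexity gain absorbs the mixed term in position and
  velocity.\<close>

lemma lower_bounded_speed:
  assumes "norm v \<le> R" "norm u \<le> R"
  shows "L x' u \<ge> L x v + D (x, v) (x' - x, 0) + D (x, v) (0, u - v)
           + \<kappa> / 2 * (norm (u - v))\<^sup>2 - (C + C\<^sup>2 / (2 * \<kappa>)) * (norm (x' - x))\<^sup>2"
proof -
  define r where "r = norm (u - v)"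
  define s where "s = norm (x' - x)"
  have r: "0 \<le> r" "r \<le> 2 * R" using assms norm_triangle_ineq4[of u v] by (auto simp: r_def)
  have "0 \<le> (\<kappa> * r - C * s)\<^sup>2 / (2 * \<kappa>)" using \<kappa>_pos by simp
  also have "\<dots> = \<kappa> / 2 * r\<^sup>2 - C * s * r + C\<^sup>2 / (2 * \<kappa>) * s\<^sup>2"
    using \<kappa>_pos by (simp add: power2_eq_square field_simps)
  finally have "C * s * r \<le> \<kappa> / 2 * r\<^sup>2 + C\<^sup>2 / (2 * \<kappa>) * s\<^sup>2" by simp
  then show ?thesis
    using lower[OF assms(1), where x = x and x' = x' and u = u] \<kappa>_bound[OF r] D_split[of "(x, v)" "x' - x" "u - v"]
    unfolding r_def[symmetric] s_def[symmetric] by (simp add: algebra_simps)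
qed

text \<open>\<open>v\<close> is the mean of the outer velocities weighted by their durations, so the
  first-order velocity terms cancel. The position terms leave \<open>2 * h * a\<close>, which
  Young's inequality splits into h^2 / t and t times the squared displacement. The convexity gain is
  kept for \<open>vp\<close> and dropped for \<open>vm\<close>.\<close>

lemma pointwise_second_difference_lower:
  fixes h t :: real and v vp vm X \<eta> :: 'a
  assumes t: "t > 0" "\<bar>h\<bar> \<le> t / 2" and vp: "norm vp \<le> R" and vm: "norm vm \<le> R"
    and v: "v = (1 / (2 * t)) *\<^sub>R ((t + h) *\<^sub>R vp + (t - h) *\<^sub>R vm)" "norm v \<le> R"
  shows "(t + h) * L (X + \<eta>) vp + (t - h) * L (X - \<eta>) vm - 2 * t * L X v
      \<ge> \<kappa> * t / 4 * (norm (vp - v))\<^sup>2 - remainder_const * t * (norm \<eta>)\<^sup>2 - C * h\<^sup>2 / t"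
proof -
  define F where "F = C + C\<^sup>2 / (2 * \<kappa>)"
  define n where "n = norm \<eta>"
  define a where "a = D (X, v) (\<eta>, 0)"
  have F0: "F \<ge> 0" unfolding F_def using C_ge_1 \<kappa>_pos by auto
  have tp: "t + h \<ge> t / 2" "t - h \<ge> 0" using t by auto
  have "(t + h) *\<^sub>R (vp - v) + (t - h) *\<^sub>R (vm - v) = (t + h) *\<^sub>R vp + (t - h) *\<^sub>R vm - (2 * t) *\<^sub>R v"
    by (simp add: algebra_simps flip: scaleR_add_left)
  also have "\<dots> = 0" unfolding v(1) using t by simp
  finally have z: "(t + h) *\<^sub>R (vp - v) + (t - h) *\<^sub>R (vm - v) = 0" .
  have "0 = D (X, v) ((0, (t + h) *\<^sub>R (vp - v)) + (0, (t - h) *\<^sub>R (vm - v)))"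
    using z D_zero by (simp add: zero_prod_def)
  then have lin: "(t + h) * D (X, v) (0, vp - v) + (t - h) * D (X, v) (0, vm - v) = 0"
    unfolding D_add D_scale_snd by simp
  have "L (X + \<eta>) vp \<ge> L X v + a + D (X, v) (0, vp - v) + \<kappa> / 2 * (norm (vp - v))\<^sup>2 - F * n\<^sup>2"
    using lower_bounded_speed[OF v(2) vp, of X "X + \<eta>"] by (simp add: F_def n_def a_def)
  from mult_left_mono[OF this, of "t + h"]
  have p: "(t + h) * L (X + \<eta>) vp \<ge> (t + h) * (L X v + a - F * n\<^sup>2) + (t + h) * D (X, v) (0, vp - v)
      + (t + h) * (\<kappa> / 2 * (norm (vp - v))\<^sup>2)"
    using tp t by (simp add: algebra_simps)
  have "L (X - \<eta>) vm \<ge> L X v - a + D (X, v) (0, vm - v) + \<kappa> / 2 * (norm (vm - v))\<^sup>2 - F * n\<^sup>2"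
    using lower_bounded_speed[OF v(2) vm, of X "X - \<eta>"] by (simp add: F_def n_def a_def D_minus_fst)
  moreover have "\<kappa> / 2 * (norm (vm - v))\<^sup>2 \<ge> 0" using \<kappa>_pos by simp
  ultimately have "L (X - \<eta>) vm \<ge> L X v - a + D (X, v) (0, vm - v) - F * n\<^sup>2" by linarith
  from mult_left_mono[OF this, of "t - h"]
  have m: "(t - h) * L (X - \<eta>) vm \<ge> (t - h) * (L X v - a - F * n\<^sup>2) + (t - h) * D (X, v) (0, vm - v)"
    using tp by (simp add: algebra_simps)
  have q: "(t + h) * (\<kappa> / 2 * (norm (vp - v))\<^sup>2) \<ge> (t / 2) * (\<kappa> / 2 * (norm (vp - v))\<^sup>2)"
    using tp \<kappa>_pos by (intro mult_right_mono) auto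
  have "\<bar>a\<bar> \<le> C * n" using D_bound[OF v(2), of X \<eta> 0] by (simp add: a_def n_def)
  then have "\<bar>h\<bar> * \<bar>a\<bar> \<le> \<bar>h\<bar> * (C * n)" by (intro mult_left_mono) auto
  then have "\<bar>h * a\<bar> \<le> C * (\<bar>h\<bar> * n)" by (simp add: abs_mult mult_ac)
  then have ha: "- (2 * h * a) \<le> C * (2 * \<bar>h\<bar> * n)" by (simp add: abs_le_iff mult_ac)
  have "0 \<le> (\<bar>h\<bar> - t * n)\<^sup>2 / t" using t by simp
  also have "\<dots> = h\<^sup>2 / t + t * n\<^sup>2 - 2 * \<bar>h\<bar> * n" using t by (simp add: power2_eq_square field_simps)
  finally have "C * (2 * \<bar>h\<bar> * n) \<le> C * (h\<^sup>2 / t + t * n\<^sup>2)" using C_ge_1 by (intro mult_left_mono) auto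
  then have "2 * h * a \<ge> - (C * h\<^sup>2 / t) - C * t * n\<^sup>2" using ha by (simp add: algebra_simps)
  moreover have "remainder_const * t * n\<^sup>2 = 2 * t * F * n\<^sup>2 + C * t * n\<^sup>2" unfolding remainder_const_def F_def[symmetric] by (simp add: algebra_simps)
  moreover have "(t + h) * (L X v + a - F * n\<^sup>2) + (t - h) * (L X v - a - F * n\<^sup>2) = 2 * t * L X v + 2 * h * a - 2 * t * F * n\<^sup>2"
    by (simp add: algebra_simps)
  moreover have "(t / 2) * (\<kappa> / 2 * (norm (vp - v))\<^sup>2) = \<kappa> * t / 4 * (norm (vp - v))\<^sup>2" by simp
  ultimately show ?thesis using p m q lin unfolding n_def[symmetric] by linarith
qed

definition semiconvexity_const where "semiconvexity_const = 3 * remainder_const * (1 + R\<^sup>2) + C"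

lemma semiconvexity_const_pos: "semiconvexity_const > 0" unfolding semiconvexity_const_def using remainder_const_pos C_ge_1 by (intro add_nonneg_pos) auto

text \<open>The nodes of the weighted mean are the midpoints of the outer nodes, and
  \<open>\<eta>\<close> is half the difference of these. It is driven by the velocity gaps, so
  Cauchy-Schwarz bounds its square by the shifts and \<open>t\<^sup>2 * a\<close>, with
  \<open>a\<close> the mean square gap. The loss in \<open>a\<close> has two powers of
  \<open>t\<close> more than the gain and uses up at most half of it.\<close>

lemma discrete_second_difference_lower:
  fixes h t :: real and v vp vm :: "nat \<Rightarrow> 'a"
  assumes N: "N > 0" and t: "0 < t" "t \<le> 1" "54 * remainder_const * t\<^sup>2 \<le> \<kappa>" "\<bar>h\<bar> \<le> t / 2"
    and vp: "\<And>i. norm (vp i) \<le> R" and vm: "\<And>i. norm (vm i) \<le> R"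
    and v: "\<And>i. v i = (1 / (2 * t)) *\<^sub>R ((t + h) *\<^sub>R vp i + (t - h) *\<^sub>R vm i)" and vR: "\<And>i. norm (v i) \<le> R"
  shows "discrete_action L N (t + h) (x + z) vp + discrete_action L N (t - h) (x - z) vm - 2 * discrete_action L N t x v
     \<ge> \<kappa> * t / 8 * ((\<Sum>i<N. (norm (vp i - v i))\<^sup>2) / real N) - semiconvexity_const / t * (h\<^sup>2 + (norm z)\<^sup>2)"
proof -
  define \<eta> where "\<eta> i = z + (1 / real N) *\<^sub>R (\<Sum>j<i. (1/2) *\<^sub>R ((t + h) *\<^sub>R vp j - (t - h) *\<^sub>R vm j))" for i
  define a where "a = (\<Sum>i<N. (norm (vp i - v i))\<^sup>2) / real N"
  have a0: "a \<ge> 0" unfolding a_def by (intro divide_nonneg_nonneg sum_nonneg) auto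
  have vsum: "(2 * t) *\<^sub>R (\<Sum>j<i. v j) = (t + h) *\<^sub>R (\<Sum>j<i. vp j) + (t - h) *\<^sub>R (\<Sum>j<i. vm j)" for i
    unfolding v using t by (simp add: scaleR_sum_right sum.distrib)
  have half: "(1/2) *\<^sub>R ((2 * t) *\<^sub>R s) = t *\<^sub>R s" for s :: 'a by simp
  have tv: "t *\<^sub>R (\<Sum>j<i. v j) = (1/2) *\<^sub>R ((t + h) *\<^sub>R (\<Sum>j<i. vp j) + (t - h) *\<^sub>R (\<Sum>j<i. vm j))" for i
    using half[of "\<Sum>j<i. v j"] unfolding vsum by simp
  have \<eta>': "\<eta> i = z + (1 / real N) *\<^sub>R ((1/2) *\<^sub>R ((t + h) *\<^sub>R (\<Sum>j<i. vp j) - (t - h) *\<^sub>R (\<Sum>j<i. vm j)))" for i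
    unfolding \<eta>_def by (simp only: scaleR_sum_right[symmetric] sum_subtractf)
  have node': "node N s y u i = y + (1 / real N) *\<^sub>R (s *\<^sub>R (\<Sum>j<i. u j))" for s y u i
    by (simp add: node_def)
  have hh: "(1/2) *\<^sub>R (p + q) + (1/2) *\<^sub>R (p - q) = p" "(1/2) *\<^sub>R (p + q) - (1/2) *\<^sub>R (p - q) = q" for p q :: 'a
    by (simp_all add: algebra_simps flip: scaleR_add_left)
  have np: "node N (t + h) (x + z) vp i = node N t x v i + \<eta> i" for i
  proof -
    have "node N t x v i + \<eta> i = x + z + (1 / real N) *\<^sub>R
      ((1/2) *\<^sub>R ((t + h) *\<^sub>R (\<Sum>j<i. vp j) + (t - h) *\<^sub>R (\<Sum>j<i. vm j)) +
       (1/2) *\<^sub>R ((t + h) *\<^sub>R (\<Sum>j<i. vp j) - (t - h) *\<^sub>R (\<Sum>j<i. vm j)))"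
      unfolding node' \<eta>' tv by (simp only: scaleR_add_right add_ac)
    then show ?thesis unfolding hh node' by simp
  qed
  have nm: "node N (t - h) (x - z) vm i = node N t x v i - \<eta> i" for i
  proof -
    have "node N t x v i - \<eta> i = x - z + (1 / real N) *\<^sub>R
      ((1/2) *\<^sub>R ((t + h) *\<^sub>R (\<Sum>j<i. vp j) + (t - h) *\<^sub>R (\<Sum>j<i. vm j)) -
       (1/2) *\<^sub>R ((t + h) *\<^sub>R (\<Sum>j<i. vp j) - (t - h) *\<^sub>R (\<Sum>j<i. vm j)))"
      unfolding node' \<eta>' tv scaleR_diff_right[of "1 / real N"] by (simp only: add_diff_eq diff_diff_eq diff_add_eq add_ac)
    then show ?thesis unfolding hh node' by simp
  qed
  \<comment> \<open>Elimination of \<open>vm\<close>: what drives \<open>\<eta>\<close> is a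
    multiple of the velocity gap, and a term due to the change of duration.\<close>
  have om: "(1/2) *\<^sub>R ((t + h) *\<^sub>R vp j - (t - h) *\<^sub>R vm j) = (t + h) *\<^sub>R (vp j - v j) + h *\<^sub>R v j" for j
  proof -
    have "(2 * t) *\<^sub>R v j = (t + h) *\<^sub>R vp j + (t - h) *\<^sub>R vm j" unfolding v using t by simp
    then have e: "(t - h) *\<^sub>R vm j = (2 * t) *\<^sub>R v j - (t + h) *\<^sub>R vp j" by simp
    have "(1/2) *\<^sub>R (p - ((2 * t) *\<^sub>R q - p)) = p - t *\<^sub>R q" for p q :: 'a
      by (simp add: algebra_simps flip: scaleR_add_left)
    from this[of "(t + h) *\<^sub>R vp j" "v j"] show ?thesis unfolding e by (simp only:) (simp add: algebra_simps)
  qed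
  have n\<eta>: "(norm (\<eta> i))\<^sup>2 \<le> 3 * ((norm z)\<^sup>2 + h\<^sup>2 * R\<^sup>2 + 9/4 * t\<^sup>2 * a)" if i: "i < N" for i
  proof -
    have "norm (\<Sum>j<i. (t + h) *\<^sub>R (vp j - v j) + h *\<^sub>R v j) \<le> (\<Sum>j<i. 3/2 * t * norm (vp j - v j) + \<bar>h\<bar> * R)"
    proof (rule order_trans[OF norm_sum sum_mono])
      fix j
      have "norm ((t + h) *\<^sub>R (vp j - v j)) \<le> 3/2 * t * norm (vp j - v j)"
      proof -
        have "0 \<le> t + h" "t + h \<le> 3/2 * t" using t by auto
        then show ?thesis
          using mult_right_mono[of "t + h" "3/2 * t" "norm (vp j - v j)"] by simp
      qed
      moreover have "norm (h *\<^sub>R v j) \<le> \<bar>h\<bar> * R" using vR by (auto intro!: mult_left_mono)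
      ultimately show "norm ((t + h) *\<^sub>R (vp j - v j) + h *\<^sub>R v j) \<le> 3/2 * t * norm (vp j - v j) + \<bar>h\<bar> * R"
        by (intro order_trans[OF norm_triangle_ineq add_mono])
    qed
    also have "\<dots> \<le> (\<Sum>j<N. 3/2 * t * norm (vp j - v j) + \<bar>h\<bar> * R)"
      using i t R_nonneg by (intro sum_mono2) auto
    also have "\<dots> = 3/2 * t * (\<Sum>j<N. norm (vp j - v j)) + real N * (\<bar>h\<bar> * R)"
      by (simp add: sum.distrib sum_distrib_left)
    finally have "(1 / real N) * norm (\<Sum>j<i. (t + h) *\<^sub>R (vp j - v j) + h *\<^sub>R v j)
        \<le> (1 / real N) * (3/2 * t * (\<Sum>j<N. norm (vp j - v j)) + real N * (\<bar>h\<bar> * R))"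
      by (intro mult_left_mono) auto
    also have "\<dots> = 3/2 * t * ((\<Sum>j<N. norm (vp j - v j)) / real N) + \<bar>h\<bar> * R" using N by (simp add: field_simps)
    finally have "norm (\<eta> i) \<le> norm z + \<bar>h\<bar> * R + 3/2 * t * ((\<Sum>j<N. norm (vp j - v j)) / real N)"
      unfolding \<eta>_def om using norm_triangle_ineq[of z "(1 / real N) *\<^sub>R (\<Sum>j<i. (t + h) *\<^sub>R (vp j - v j) + h *\<^sub>R v j)"] by simp
    then have "(norm (\<eta> i))\<^sup>2 \<le> (norm z + \<bar>h\<bar> * R + 3/2 * t * ((\<Sum>j<N. norm (vp j - v j)) / real N))\<^sup>2"
      by (intro power_mono) auto
    also have "\<dots> \<le> 3 * ((norm z)\<^sup>2 + (\<bar>h\<bar> * R)\<^sup>2 + (3/2 * t * ((\<Sum>j<N. norm (vp j - v j)) / real N))\<^sup>2)"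
      by (rule power2_sum3_le)
    also have "(3/2 * t * ((\<Sum>j<N. norm (vp j - v j)) / real N))\<^sup>2 \<le> 9/4 * t\<^sup>2 * a"
    proof -
      have "9/4 * t\<^sup>2 * ((\<Sum>j<N. norm (vp j - v j)) / real N)\<^sup>2 \<le> 9/4 * t\<^sup>2 * a"
        unfolding a_def by (intro mult_left_mono average_power2_le) auto
      then show ?thesis by (simp add: power_mult_distrib power_divide)
    qed
    finally show ?thesis by (simp add: power_mult_distrib)
  qed
  define b where "b = 3 * ((norm z)\<^sup>2 + h\<^sup>2 * R\<^sup>2 + 9/4 * t\<^sup>2 * a)"
  have "discrete_action L N (t + h) (x + z) vp + discrete_action L N (t - h) (x - z) vm - 2 * discrete_action L N t x v
      = (\<Sum>i<N. (1 / real N) * ((t + h) * L (node N t x v i + \<eta> i) (vp i) + (t - h) * L (node N t x v i - \<eta> i) (vm i) - 2 * t * L (node N t x v i) (v i)))"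
    unfolding discrete_action_def np nm by (simp add: sum_subtractf sum.distrib sum_distrib_left algebra_simps diff_divide_distrib add_divide_distrib)
  also have "\<dots> \<ge> (\<Sum>i<N. (1 / real N) * (\<kappa> * t / 4 * (norm (vp i - v i))\<^sup>2 - remainder_const * t * b - C * h\<^sup>2 / t))"
  proof (intro sum_mono mult_left_mono)
    fix i assume "i \<in> {..<N}"
    then have "remainder_const * t * (norm (\<eta> i))\<^sup>2 \<le> remainder_const * t * b" using n\<eta> remainder_const_pos t by (intro mult_left_mono) (auto simp: b_def)
    then show "\<kappa> * t / 4 * (norm (vp i - v i))\<^sup>2 - remainder_const * t * b - C * h\<^sup>2 / t
      \<le> (t + h) * L (node N t x v i + \<eta> i) (vp i) + (t - h) * L (node N t x v i - \<eta> i) (vm i) - 2 * t * L (node N t x v i) (v i)"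
      using pointwise_second_difference_lower[OF t(1,4) vp[of i] vm[of i] v[of i] vR[of i], where X = "node N t x v i" and \<eta> = "\<eta> i"] by linarith
  qed auto
  also have "(\<Sum>i<N. (1 / real N) * (\<kappa> * t / 4 * (norm (vp i - v i))\<^sup>2 - remainder_const * t * b - C * h\<^sup>2 / t))
     = \<kappa> * t / 4 * a - remainder_const * t * b - C * h\<^sup>2 / t"
  proof -
    have "(\<Sum>i<N. (1 / real N) * (\<kappa> * t / 4 * (norm (vp i - v i))\<^sup>2 - remainder_const * t * b - C * h\<^sup>2 / t))
      = (1 / real N) * (\<kappa> * t / 4 * (\<Sum>i<N. (norm (vp i - v i))\<^sup>2) - real N * (remainder_const * t * b + C * h\<^sup>2 / t))"
      unfolding sum_distrib_left[symmetric] by (simp add: sum_subtractf sum_distrib_left algebra_simps)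
    then show ?thesis using N unfolding a_def by (simp add: right_diff_distrib algebra_simps)
  qed
  finally have main: "discrete_action L N (t + h) (x + z) vp + discrete_action L N (t - h) (x - z) vm - 2 * discrete_action L N t x v
     \<ge> \<kappa> * t / 4 * a - remainder_const * t * b - C * h\<^sup>2 / t" .
  \<comment> \<open>The smallness condition on \<open>t\<close> is made for this step:
    \<open>54 / 8\<close> is \<open>3 * 9 / 4\<close>, the coefficient of
    \<open>t\<^sup>2 * a\<close> in \<open>b\<close>.\<close>
  have "54 * remainder_const * t\<^sup>2 * (t * a / 8) \<le> \<kappa> * (t * a / 8)" using t a0 by (intro mult_right_mono) auto
  then have 1: "remainder_const * t * (27/4 * t\<^sup>2 * a) \<le> \<kappa> * t / 8 * a" by (simp add: algebra_simps power2_eq_square)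
  have "t * t \<le> 1 * 1" using t by (intro mult_mono) auto
  then have tt: "t \<le> 1 / t" using t by (simp add: pos_le_divide_eq)
  have "(norm z)\<^sup>2 + h\<^sup>2 * R\<^sup>2 \<le> (1 + R\<^sup>2) * (h\<^sup>2 + (norm z)\<^sup>2)" by (simp add: algebra_simps)
  then have "3 * remainder_const * ((norm z)\<^sup>2 + h\<^sup>2 * R\<^sup>2) \<le> 3 * remainder_const * ((1 + R\<^sup>2) * (h\<^sup>2 + (norm z)\<^sup>2))"
    using remainder_const_pos by (intro mult_left_mono) auto
  then have "t * (3 * remainder_const * ((norm z)\<^sup>2 + h\<^sup>2 * R\<^sup>2)) \<le> (1 / t) * (3 * remainder_const * ((1 + R\<^sup>2) * (h\<^sup>2 + (norm z)\<^sup>2)))"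
    using tt t remainder_const_pos by (intro mult_mono) auto
  moreover have "C * h\<^sup>2 / t \<le> (1 / t) * (C * (h\<^sup>2 + (norm z)\<^sup>2))" using C_ge_1 t by (simp add: divide_right_mono)
  moreover have "semiconvexity_const / t * (h\<^sup>2 + (norm z)\<^sup>2) = (1 / t) * (3 * remainder_const * ((1 + R\<^sup>2) * (h\<^sup>2 + (norm z)\<^sup>2))) + (1 / t) * (C * (h\<^sup>2 + (norm z)\<^sup>2))"
    unfolding semiconvexity_const_def by (simp add: algebra_simps add_divide_distrib)
  moreover have "remainder_const * t * b = t * (3 * remainder_const * ((norm z)\<^sup>2 + h\<^sup>2 * R\<^sup>2)) + remainder_const * t * (27/4 * t\<^sup>2 * a)"
    unfolding b_def by (simp add: algebra_simps)
  ultimately show ?thesis using main 1 unfolding a_def[symmetric] by linarith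
qed

section \<open>Bound from above for second differences\<close>

text \<open>In multiples of \<open>C\<close>: 1 from the unequal durations, \<open>3 * 2\<close>
  from the displacements and \<open>4 * 3 * (1 + R\<^sup>2)\<close> from the changes of
  velocity.\<close>

definition semiconcavity_const where "semiconcavity_const = 19 * C + 12 * C * R\<^sup>2"

lemma semiconcavity_const_pos: "semiconcavity_const > 0" unfolding semiconcavity_const_def using C_ge_1 by (intro add_pos_nonneg) auto

text \<open>The steps change by \<open>w\<close> and its negative, so the velocity changes weighted
  by the durations are opposite and their first-order terms cancel. A velocity change squared and
  weighted by its duration is a squared change of step divided by that duration, at least
  \<open>t / 2\<close>; hence the factor \<open>1 / t\<close>.\<close>

lemma pointwise_second_difference_upper:
  fixes h t :: real and v vp vm X \<eta> w :: 'a
  assumes t: "t > 0" "\<bar>h\<bar> \<le> t / 2" and vp: "norm vp \<le> R" and vm: "norm vm \<le> R" and v: "norm v \<le> R"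
    and p: "(t + h) *\<^sub>R vp = t *\<^sub>R v + w" and m: "(t - h) *\<^sub>R vm = t *\<^sub>R v - w"
  shows "(t + h) * L (X + \<eta>) vp + (t - h) * L (X - \<eta>) vm - 2 * t * L X v
      \<le> C * h\<^sup>2 / t + 3 * C * t * (norm \<eta>)\<^sup>2 + 4 * C * (norm w + \<bar>h\<bar> * R)\<^sup>2 / t"
proof -
  define n where "n = norm \<eta>"
  define a where "a = D (X, v) (\<eta>, 0)"
  define q where "q = w - h *\<^sub>R v"
  define M where "M = norm w + \<bar>h\<bar> * R"
  have tp: "t + h \<ge> t / 2" "t - h \<ge> t / 2" using t by auto
  have dp: "(t + h) *\<^sub>R (vp - v) = q" and dm: "(t - h) *\<^sub>R (vm - v) = - q"
    unfolding scaleR_diff_right p m by (auto simp: q_def algebra_simps)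
  have "norm q \<le> norm w + norm (h *\<^sub>R v)" unfolding q_def by (rule norm_triangle_ineq4)
  also have "\<dots> \<le> M" unfolding M_def using v by (auto intro!: mult_left_mono)
  finally have qM: "(norm q)\<^sup>2 \<le> M\<^sup>2" by (intro power_mono) auto
  have sq: "s * (norm d)\<^sup>2 \<le> 2 * M\<^sup>2 / t" if "s \<ge> t / 2" "norm (s *\<^sub>R d) = norm q" for s and d :: 'a
  proof -
    have s0: "s > 0" using that t by linarith
    have "s * (norm d)\<^sup>2 = (norm (s *\<^sub>R d))\<^sup>2 / s" using s0 by (simp add: power2_eq_square field_simps)
    also have "\<dots> \<le> M\<^sup>2 / (t / 2)" unfolding that(2) using that(1) t qM by (intro frac_le) auto
    finally show ?thesis by (simp add: mult.commute)
  qed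
  have sp: "(t + h) * (norm (vp - v))\<^sup>2 \<le> 2 * M\<^sup>2 / t" by (rule sq) (use tp dp in auto)
  have sm: "(t - h) * (norm (vm - v))\<^sup>2 \<le> 2 * M\<^sup>2 / t" by (rule sq) (use tp dm in auto)
  have "D (X, v) (0, (t + h) *\<^sub>R (vp - v)) + D (X, v) (0, (t - h) *\<^sub>R (vm - v)) = 0"
    unfolding dp dm using D_scale_snd[of "(X, v)" "-1" q] by simp
  then have lin: "(t + h) * D (X, v) (0, vp - v) + (t - h) * D (X, v) (0, vm - v) = 0"
    unfolding D_scale_snd .
  have "L (X + \<eta>) vp \<le> L X v + a + D (X, v) (0, vp - v) + C * n\<^sup>2 + C * (norm (vp - v))\<^sup>2"
    using upper[OF v vp, of "X + \<eta>" X] D_split[of "(X, v)" \<eta> "vp - v"] by (simp add: n_def a_def algebra_simps)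
  from mult_left_mono[OF this, of "t + h"]
  have P: "(t + h) * L (X + \<eta>) vp \<le> (t + h) * (L X v + a + C * n\<^sup>2) + (t + h) * D (X, v) (0, vp - v)
      + C * ((t + h) * (norm (vp - v))\<^sup>2)" using tp t by (simp add: algebra_simps)
  have "L (X - \<eta>) vm \<le> L X v - a + D (X, v) (0, vm - v) + C * n\<^sup>2 + C * (norm (vm - v))\<^sup>2"
    using upper[OF v vm, of "X - \<eta>" X] D_split[of "(X, v)" "- \<eta>" "vm - v"] D_minus_fst[of "(X, v)" \<eta>]
    by (simp add: n_def a_def algebra_simps)
  from mult_left_mono[OF this, of "t - h"]
  have Q: "(t - h) * L (X - \<eta>) vm \<le> (t - h) * (L X v - a + C * n\<^sup>2) + (t - h) * D (X, v) (0, vm - v)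
      + C * ((t - h) * (norm (vm - v))\<^sup>2)" using tp t by (simp add: algebra_simps)
  have CC: "C * ((t + h) * (norm (vp - v))\<^sup>2) \<le> C * (2 * M\<^sup>2 / t)" "C * ((t - h) * (norm (vm - v))\<^sup>2) \<le> C * (2 * M\<^sup>2 / t)"
    using mult_left_mono[OF sp, of C] mult_left_mono[OF sm, of C] C_ge_1 by auto
  have "\<bar>a\<bar> \<le> C * n" using D_bound[OF v, of X \<eta> 0] by (simp add: a_def n_def)
  then have "\<bar>h\<bar> * \<bar>a\<bar> \<le> \<bar>h\<bar> * (C * n)" by (intro mult_left_mono) auto
  then have "\<bar>h * a\<bar> \<le> C * (\<bar>h\<bar> * n)" by (simp add: abs_mult mult_ac)
  then have ha: "2 * h * a \<le> C * (2 * \<bar>h\<bar> * n)" by (simp add: abs_le_iff mult_ac)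
  have "0 \<le> (\<bar>h\<bar> - t * n)\<^sup>2 / t" using t by simp
  also have "\<dots> = h\<^sup>2 / t + t * n\<^sup>2 - 2 * \<bar>h\<bar> * n" using t by (simp add: power2_eq_square field_simps)
  finally have "C * (2 * \<bar>h\<bar> * n) \<le> C * (h\<^sup>2 / t + t * n\<^sup>2)" using C_ge_1 by (intro mult_left_mono) auto
  then have "2 * h * a \<le> C * h\<^sup>2 / t + C * t * n\<^sup>2" using ha by (simp add: algebra_simps)
  moreover have "(t + h) * (L X v + a + C * n\<^sup>2) + (t - h) * (L X v - a + C * n\<^sup>2) = 2 * t * L X v + 2 * h * a + 2 * (C * t * n\<^sup>2)"
    by (simp add: algebra_simps)
  moreover have "C * (2 * M\<^sup>2 / t) + C * (2 * M\<^sup>2 / t) = 4 * C * M\<^sup>2 / t" by (simp add: field_simps)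
  moreover have "3 * C * t * n\<^sup>2 = C * t * n\<^sup>2 + 2 * (C * t * n\<^sup>2)" by simp
  ultimately show ?thesis using P Q CC lin unfolding n_def[symmetric] M_def[symmetric] by linarith
qed

text \<open>Changing every step by the same vector shifts the nodes by the affine interpolation
  between \<open>z\<close> and \<open>z'\<close>, which is never longer than
  \<open>norm z + norm z'\<close>.\<close>

lemma discrete_second_difference_upper:
  fixes h t :: real and v vp vm :: "nat \<Rightarrow> 'a"
  assumes N: "N > 0" and t: "0 < t" "t \<le> 1" "\<bar>h\<bar> \<le> t / 2"
    and vp: "\<And>i. i < N \<Longrightarrow> norm (vp i) \<le> R" and vm: "\<And>i. i < N \<Longrightarrow> norm (vm i) \<le> R" and vR: "\<And>i. i < N \<Longrightarrow> norm (v i) \<le> R"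
    and p: "\<And>i. (t + h) *\<^sub>R vp i = t *\<^sub>R v i + (z' - z)" and m: "\<And>i. (t - h) *\<^sub>R vm i = t *\<^sub>R v i - (z' - z)"
  shows "discrete_action L N (t + h) (x + z) vp + discrete_action L N (t - h) (x - z) vm - 2 * discrete_action L N t x v
     \<le> semiconcavity_const / t * (h\<^sup>2 + (norm z)\<^sup>2 + (norm z')\<^sup>2)"
proof -
  define \<eta> where "\<eta> i = z + (real i / real N) *\<^sub>R (z' - z)" for i
  define S where "S = h\<^sup>2 + (norm z)\<^sup>2 + (norm z')\<^sup>2"
  have node': "node N s y u i = y + (1 / real N) *\<^sub>R (\<Sum>j<i. s *\<^sub>R u j)" for s y u i
    by (simp add: node_def scaleR_sum_right)
  have np: "node N (t + h) (x + z) vp i = node N t x v i + \<eta> i" for i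
    unfolding node' p \<eta>_def by (simp add: sum.distrib sum_constant_scaleR scaleR_add_right)
  have nm: "node N (t - h) (x - z) vm i = node N t x v i - \<eta> i" for i
    unfolding node' m \<eta>_def by (simp add: sum_subtractf sum_constant_scaleR scaleR_diff_right)
  have bd: "(t + h) * L (node N t x v i + \<eta> i) (vp i) + (t - h) * L (node N t x v i - \<eta> i) (vm i) - 2 * t * L (node N t x v i) (v i)
     \<le> semiconcavity_const / t * S" if i: "i < N" for i
  proof -
    have "\<eta> i = (1 - real i / real N) *\<^sub>R z + (real i / real N) *\<^sub>R z'" by (simp add: \<eta>_def algebra_simps)
    then have "norm (\<eta> i) \<le> norm ((1 - real i / real N) *\<^sub>R z) + norm ((real i / real N) *\<^sub>R z')"
      using norm_triangle_ineq by metis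
    also have "\<dots> \<le> 1 * norm z + 1 * norm z'" unfolding norm_scaleR using i by (intro add_mono mult_right_mono) auto
    finally have "(norm (\<eta> i))\<^sup>2 \<le> (norm z + norm z')\<^sup>2" by (intro power_mono) auto
    also have "\<dots> \<le> 2 * ((norm z)\<^sup>2 + (norm z')\<^sup>2)" by (rule power2_sum2_le)
    also have "\<dots> \<le> 2 * S" by (simp add: S_def)
    finally have n\<eta>: "t * (3 * C * (norm (\<eta> i))\<^sup>2) \<le> (1 / t) * (3 * C * (2 * S))"
    proof (intro mult_mono)
      have "t * t \<le> 1 * 1" using t by (intro mult_mono) auto
      then show "t \<le> 1 / t" using t by (simp add: pos_le_divide_eq)
    qed (use t C_ge_1 in auto)
    have S0: "(norm z)\<^sup>2 + (norm z')\<^sup>2 \<le> S" "h\<^sup>2 \<le> S" by (auto simp: S_def)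
    have "norm (z' - z) + \<bar>h\<bar> * R \<le> norm z + norm z' + \<bar>h\<bar> * R" using norm_triangle_ineq4[of z' z] by simp
    then have "(norm (z' - z) + \<bar>h\<bar> * R)\<^sup>2 \<le> (norm z + norm z' + \<bar>h\<bar> * R)\<^sup>2" using R_nonneg by (intro power_mono) auto
    also have "\<dots> \<le> 3 * ((norm z)\<^sup>2 + (norm z')\<^sup>2 + (\<bar>h\<bar> * R)\<^sup>2)" by (rule power2_sum3_le)
    also have "\<dots> \<le> 3 * (S + S * R\<^sup>2)"
      using S0 mult_right_mono[OF S0(2), of "R\<^sup>2"] by (simp add: power_mult_distrib)
    finally have "4 * C * (norm (z' - z) + \<bar>h\<bar> * R)\<^sup>2 \<le> 4 * C * (3 * (S + S * R\<^sup>2))" using C_ge_1 by (intro mult_left_mono) auto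
    then have q: "4 * C * (norm (z' - z) + \<bar>h\<bar> * R)\<^sup>2 / t \<le> 4 * C * (3 * (S + S * R\<^sup>2)) / t" using t by (intro divide_right_mono) auto
    have "C * h\<^sup>2 / t \<le> C * S / t" using S0 C_ge_1 t by (intro divide_right_mono mult_left_mono) auto
    moreover have "semiconcavity_const / t * S = C * S / t + (1 / t) * (3 * C * (2 * S)) + 4 * C * (3 * (S + S * R\<^sup>2)) / t"
      unfolding semiconcavity_const_def by argo
    ultimately show ?thesis
      using pointwise_second_difference_upper[OF t(1,3) vp[OF i] vm[OF i] vR[OF i] p m, of "node N t x v i" "\<eta> i"] n\<eta> q by (simp add: mult_ac)
  qed
  have "discrete_action L N (t + h) (x + z) vp + discrete_action L N (t - h) (x - z) vm - 2 * discrete_action L N t x v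
      = (\<Sum>i<N. (1 / real N) * ((t + h) * L (node N t x v i + \<eta> i) (vp i) + (t - h) * L (node N t x v i - \<eta> i) (vm i) - 2 * t * L (node N t x v i) (v i)))"
    unfolding discrete_action_def np nm by (simp add: sum_subtractf sum.distrib sum_distrib_left algebra_simps diff_divide_distrib add_divide_distrib)
  also have "\<dots> \<le> (\<Sum>i<N. (1 / real N) * (semiconcavity_const / t * S))"
    by (intro sum_mono mult_left_mono bd) auto
  also have "\<dots> = semiconcavity_const / t * S" using N by simp
  finally show ?thesis unfolding S_def .
qed

end

section \<open>Discrete and continuous actions\<close>

lemma has_integral_grid:
  fixes f :: "real \<Rightarrow> 'b::banach"
  assumes "\<tau> \<ge> 0" "\<And>k. k < N \<Longrightarrow> (f has_integral I k) {real k * \<tau>..real (Suc k) * \<tau>}"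
  shows "(f has_integral (\<Sum>k<N. I k)) {0..real N * \<tau>}"
  using assms(2)
proof (induction N)
  case (Suc N)
  have "(f has_integral (\<Sum>k<N. I k) + I N) {0..real (Suc N) * \<tau>}"
    by (rule has_integral_combine[OF _ _ Suc.IH]) (use Suc.prems assms(1) in \<open>auto simp: mult_right_mono\<close>)
  then show ?case by simp
qed (simp add: has_integral_refl)

lemma has_integral_grid_continuous:
  fixes f :: "real \<Rightarrow> 'b::banach"
  assumes \<tau>: "\<tau> \<ge> 0" and c: "\<And>k. k < N \<Longrightarrow> continuous_on {real k * \<tau>..real (Suc k) * \<tau>} (F k)"
    and e: "\<And>k s. k < N \<Longrightarrow> s \<in> {real k * \<tau><..<real (Suc k) * \<tau>} \<Longrightarrow> f s = F k s"
  shows "(f has_integral (\<Sum>k<N. integral {real k * \<tau>..real (Suc k) * \<tau>} (F k))) {0..real N * \<tau>}"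
proof (rule has_integral_grid[OF \<tau>])
  fix k assume k: "k < N"
  show "(f has_integral integral {real k * \<tau>..real (Suc k) * \<tau>} (F k)) {real k * \<tau>..real (Suc k) * \<tau>}"
  proof (rule has_integral_spike_finite[of "{real k * \<tau>, real (Suc k) * \<tau>}"])
    show "(F k has_integral integral {real k * \<tau>..real (Suc k) * \<tau>} (F k)) {real k * \<tau>..real (Suc k) * \<tau>}"
      by (intro integrable_integral integrable_continuous_real c k)
  qed (use e[OF k] in auto)
qed

lemma grid_cell_exists:
  fixes s \<tau> :: real
  assumes "\<tau> > 0" "0 \<le> s" "s < real N * \<tau>"
  obtains k where "k < N" "real k * \<tau> \<le> s" "s < real (Suc k) * \<tau>"
proof
  define k where "k = nat \<lfloor>s / \<tau>\<rfloor>"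
  have k: "real k \<le> s / \<tau>" "s / \<tau> < real k + 1" using assms by (auto simp: k_def)
  show 1: "real k * \<tau> \<le> s" "s < real (Suc k) * \<tau>" using k assms by (auto simp: field_simps)
  have "real k * \<tau> < real N * \<tau>" using 1 assms by linarith
  then show "k < N" using assms by simp
qed

section \<open>Polygons as competitors\<close>

text \<open>The clamped factor is the time spent in cell \<open>i\<close> up to \<open>s\<close>;
  this closed form makes continuity immediate.\<close>

definition polygon :: "nat \<Rightarrow> real \<Rightarrow> 'a::real_normed_vector \<Rightarrow> (nat \<Rightarrow> 'a) \<Rightarrow> real \<Rightarrow> 'a" where
  "polygon N \<tau> x v s = x + (\<Sum>i<N. max 0 (min (s - real i * \<tau>) \<tau>) *\<^sub>R v i)"

text \<open>It is 0 at the grid points, a finite set that no integral sees.\<close>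

definition polygon_velocity :: "nat \<Rightarrow> real \<Rightarrow> (nat \<Rightarrow> 'a::real_normed_vector) \<Rightarrow> real \<Rightarrow> 'a" where
  "polygon_velocity N \<tau> v s = (\<Sum>i<N. if real i * \<tau> < s \<and> s < real (Suc i) * \<tau> then v i else 0)"

lemma continuous_on_polygon: "continuous_on S (polygon N \<tau> x v)"
  unfolding polygon_def[abs_def] by (intro continuous_intros)

lemma polygon_eq:
  assumes \<tau>: "\<tau> > 0" and k: "k < N" and s: "s \<in> {real k * \<tau>..real (Suc k) * \<tau>}"
  shows "polygon N \<tau> x v s = (x + \<tau> *\<^sub>R (\<Sum>j<k. v j)) + (s - real k * \<tau>) *\<^sub>R v k"
proof -
  have "max 0 (min (s - real i * \<tau>) \<tau>) *\<^sub>R v i =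
      (if i < k then \<tau> *\<^sub>R v i else 0) + (if i = k then (s - real k * \<tau>) *\<^sub>R v k else 0)" for i
  proof -
    consider "i < k" | "i = k" | "k < i" by linarith
    then show ?thesis
    proof cases
      case 1
      then have "real (Suc i) * \<tau> \<le> real k * \<tau>" using \<tau> by (intro mult_right_mono) auto
      then have "\<tau> \<le> s - real i * \<tau>" using s by (simp add: algebra_simps)
      then show ?thesis using 1 \<tau> by simp
    next
      case 2
      then show ?thesis using s \<tau> by (simp add: algebra_simps)
    next
      case 3
      then have "real (Suc k) * \<tau> \<le> real i * \<tau>" using \<tau> by (intro mult_right_mono) auto
      then have "s - real i * \<tau> \<le> 0" using s by simp
      then show ?thesis using 3 \<tau> by (simp add: min_def)
    qed
  qed
  moreover have "(\<Sum>i<N. if i < k then \<tau> *\<^sub>R v i else 0) = (\<Sum>i<k. \<tau> *\<^sub>R v i)"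
    using k by (intro sum.mono_neutral_cong_right) auto
  ultimately show ?thesis using k by (simp add: polygon_def sum.distrib scaleR_sum_right)
qed

lemma polygon_velocity_eq:
  assumes \<tau>: "\<tau> > 0" and k: "k < N" and s: "s \<in> {real k * \<tau><..<real (Suc k) * \<tau>}"
  shows "polygon_velocity N \<tau> v s = v k"
proof -
  have "(if real i * \<tau> < s \<and> s < real (Suc i) * \<tau> then v i else 0) = (if i = k then v k else 0)" for i
  proof -
    have "\<not> (real i * \<tau> < s \<and> s < real (Suc i) * \<tau>)" if "i \<noteq> k"
    proof (cases "i < k")
      case True
      then have "real (Suc i) * \<tau> \<le> real k * \<tau>" using \<tau> by (intro mult_right_mono) auto
      then show ?thesis using s by auto
    next
      case False
      then have "real (Suc k) * \<tau> \<le> real i * \<tau>" using \<tau> that by (intro mult_right_mono) auto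
      then show ?thesis using s by auto
    qed
    then show ?thesis using s by auto
  qed
  then show ?thesis using k by (simp add: polygon_velocity_def)
qed

text \<open>Integration by parts with the grid points as finite exceptional set; the boundary terms
  vanish because the test function does at 0 and \<open>t\<close>.\<close>

lemma W11_polygon:
  fixes v :: "nat \<Rightarrow> 'a::euclidean_space"
  assumes N: "N > 0" and \<tau>: "\<tau> > 0"
  shows "W11 (real N * \<tau>) (polygon N \<tau> x v) (polygon_velocity N \<tau> v)"
proof -
  define \<gamma> where "\<gamma> = polygon N \<tau> x v"
  define g where "g = polygon_velocity N \<tau> v"
  define t where "t = real N * \<tau>"
  have t: "t > 0" using N \<tau> by (simp add: t_def)
  have gk: "g s = v k" if "k < N" "s \<in> {real k * \<tau><..<real (Suc k) * \<tau>}" for k s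
    unfolding g_def by (rule polygon_velocity_eq[OF \<tau> that])
  have gi: "g integrable_on {0..t}"
    unfolding t_def using has_integral_grid_continuous[of \<tau> N "\<lambda>k _. v k" g] gk \<tau> by (auto simp: integrable_on_def)
  have gb: "norm (g s) \<le> (\<Sum>i<N. norm (v i))" for s
    unfolding g_def polygon_velocity_def by (rule order_trans[OF norm_sum sum_mono]) auto
  have ga: "g absolutely_integrable_on {0..t}"
    by (rule absolutely_integrable_integrable_bound[OF gb gi]) (rule integrable_const_ivl)
  have weak: "integral {0..t} (\<lambda>s. \<phi>' s *\<^sub>R \<gamma> s) = - integral {0..t} (\<lambda>s. \<phi> s *\<^sub>R g s)"
    if \<phi>: "\<And>s. (\<phi> has_real_derivative \<phi>' s) (at s)" "continuous_on UNIV \<phi>'"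
      "closure {s. \<phi> s \<noteq> 0} \<subseteq> {0<..<t}" for \<phi> \<phi>'
  proof -
    have \<phi>c: "continuous_on S \<phi>" for S using \<phi>(1) DERIV_continuous_on has_field_derivative_at_within by blast
    have \<phi>0: "\<phi> 0 = 0" "\<phi> t = 0" using \<phi>(3) closure_subset[of "{s. \<phi> s \<noteq> 0}"] by auto
    have i: "(\<lambda>s. \<phi> s *\<^sub>R g s) integrable_on {0..t}"
      unfolding t_def
    proof (rule has_integral_integrable, rule has_integral_grid_continuous[where F = "\<lambda>k s. \<phi> s *\<^sub>R v k"])
      show "continuous_on {real k * \<tau>..real (Suc k) * \<tau>} (\<lambda>s. \<phi> s *\<^sub>R v k)" for k
        by (intro continuous_intros \<phi>c)
    qed (use gk \<tau> in auto)
    have "((\<lambda>s. \<phi>' s *\<^sub>R \<gamma> s) has_integral - integral {0..t} (\<lambda>s. \<phi> s *\<^sub>R g s)) {0..t}"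
    proof (rule integration_by_parts_interior_strong[where prod = "(*\<^sub>R)" and f = \<phi> and f' = \<phi>' and g = \<gamma> and g' = g and s = "(\<lambda>k. real k * \<tau>) ` {..N}"])
      show "bounded_bilinear ((*\<^sub>R) :: real \<Rightarrow> 'a \<Rightarrow> 'a)" by (rule bounded_bilinear_scaleR)
      show "continuous_on {0..t} \<gamma>" unfolding \<gamma>_def by (rule continuous_on_polygon)
      show "(\<phi> has_vector_derivative \<phi>' s) (at s)" for s
        using \<phi>(1) by (simp add: has_real_derivative_iff_has_vector_derivative)
      show "((\<lambda>s. \<phi> s *\<^sub>R g s) has_integral \<phi> t *\<^sub>R \<gamma> t - \<phi> 0 *\<^sub>R \<gamma> 0 - - integral {0..t} (\<lambda>s. \<phi> s *\<^sub>R g s)) {0..t}"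
        using i \<phi>0 by (simp add: integrable_integral)
      fix s assume s: "s \<in> {0<..<t} - (\<lambda>k. real k * \<tau>) ` {..N}"
      obtain k where k: "k < N" "real k * \<tau> \<le> s" "s < real (Suc k) * \<tau>"
        using grid_cell_exists[OF \<tau>, of s N] s unfolding t_def by auto
      have "s \<noteq> real k * \<tau>" using s k by auto
      then have sk: "s \<in> {real k * \<tau><..<real (Suc k) * \<tau>}" using k by auto
      have "((\<lambda>s. (x + \<tau> *\<^sub>R (\<Sum>j<k. v j)) + (s - real k * \<tau>) *\<^sub>R v k) has_vector_derivative v k) (at s)"
        by (auto intro!: derivative_eq_intros)
      then have "(\<gamma> has_vector_derivative v k) (at s)"
        by (rule has_vector_derivative_transform_within_open[OF _ open_greaterThanLessThan sk])
          (simp add: \<gamma>_def polygon_eq[OF \<tau> k(1)])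
      then show "(\<gamma> has_vector_derivative g s) (at s)" using gk[OF k(1) sk] by simp
    qed (use t \<phi>c in auto)
    then show ?thesis by (rule integral_unique)
  qed
  show ?thesis unfolding W11_def t_def[symmetric] \<gamma>_def[symmetric] g_def[symmetric]
    using ga weak continuous_on_polygon[of "{0..t}" N \<tau> x v] unfolding \<gamma>_def[symmetric] by blast
qed

context lagrangian_bounds
begin

text \<open>Within a cell the polygon is at most \<open>R / N\<close> away from its node, since
  \<open>t \<le> 1\<close>, so its action exceeds the left-end sum by at most a multiple of
  \<open>1 / N\<close>.\<close>

lemma polygon_action:
  assumes N: "N > 0" and t: "0 < t" "t \<le> 1" and v: "\<And>i. i < N \<Longrightarrow> norm (v i) \<le> R"
  shows "\<exists>\<gamma> g. W11 t \<gamma> g \<and> \<gamma> 0 = x \<and> \<gamma> t = node N t x v N \<and>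
     (\<lambda>s. L (\<gamma> s) (g s)) absolutely_integrable_on {0..t} \<and>
     integral {0..t} (\<lambda>s. L (\<gamma> s) (g s)) \<le> discrete_action L N t x v + C * (R + R\<^sup>2) / real N"
proof -
  define \<tau> where "\<tau> = t / real N"
  have \<tau>: "\<tau> > 0" using N t by (simp add: \<tau>_def)
  have tN: "t = real N * \<tau>" using N by (simp add: \<tau>_def)
  define \<gamma> where "\<gamma> = polygon N \<tau> x v"
  define g where "g = polygon_velocity N \<tau> v"
  define F where "F k s = L (node N t x v k + (s - real k * \<tau>) *\<^sub>R v k) (v k)" for k s
  have gk: "g s = v k" if "k < N" "s \<in> {real k * \<tau><..<real (Suc k) * \<tau>}" for k s
    unfolding g_def by (rule polygon_velocity_eq[OF \<tau> that])
  have \<gamma>k: "\<gamma> s = node N t x v k + (s - real k * \<tau>) *\<^sub>R v k" if "k < N" "s \<in> {real k * \<tau>..real (Suc k) * \<tau>}" for k s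
    using polygon_eq[OF \<tau> that] unfolding \<gamma>_def node_def \<tau>_def[symmetric] .
  have W: "W11 t \<gamma> g" unfolding \<gamma>_def g_def tN by (rule W11_polygon[OF N \<tau>])
  have e0: "\<gamma> 0 = x" using \<gamma>k[of 0 0] N \<tau> by (simp add: node_def)
  have e1: "\<gamma> t = node N t x v N"
  proof -
    obtain M where M: "N = Suc M" using N by (cases N) auto
    have "\<gamma> t = node N t x v M + (t - real M * \<tau>) *\<^sub>R v M"
      using \<gamma>k[of M t] M \<tau> tN by auto
    also have "t - real M * \<tau> = \<tau>" using tN M by (simp add: algebra_simps)
    finally show ?thesis unfolding node_def \<tau>_def[symmetric] by (simp add: M scaleR_add_right)
  qed
  have Fc: "continuous_on S (F k)" for S k
  proof -
    have "continuous_on S (\<lambda>s. (node N t x v k + (s - real k * \<tau>) *\<^sub>R v k, v k))" by (intro continuous_intros)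
    from continuous_on_compose2[OF continuous_L this] show ?thesis by (simp add: F_def[abs_def])
  qed
  have hi: "((\<lambda>s. L (\<gamma> s) (g s)) has_integral (\<Sum>k<N. integral {real k * \<tau>..real (Suc k) * \<tau>} (F k))) {0..t}"
    unfolding tN by (rule has_integral_grid_continuous) (use \<tau> gk \<gamma>k Fc in \<open>auto simp: F_def\<close>)
  have gR: "norm (g s) \<le> R" for s
  proof (cases "\<exists>k<N. s \<in> {real k * \<tau><..<real (Suc k) * \<tau>}")
    case True
    then show ?thesis using gk v by metis
  next
    case False
    then have "g s = 0" unfolding g_def polygon_velocity_def by (intro sum.neutral) auto
    then show ?thesis using R_nonneg by simp
  qed
  have ai: "(\<lambda>s. L (\<gamma> s) (g s)) absolutely_integrable_on {0..t}"
    by (rule absolutely_integrable_integrable_bound[where g = "\<lambda>_. C"])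
      (use L_bound[OF gR] hi integrable_const_ivl in \<open>auto simp: integrable_on_def\<close>)
  have Fb: "integral {real k * \<tau>..real (Suc k) * \<tau>} (F k) \<le> \<tau> * (L (node N t x v k) (v k) + C * (R + R\<^sup>2) / real N)"
    if k: "k < N" for k
  proof -
    have "integral {real k * \<tau>..real (Suc k) * \<tau>} (F k)
       \<le> integral {real k * \<tau>..real (Suc k) * \<tau>} (\<lambda>_. L (node N t x v k) (v k) + C * (R + R\<^sup>2) / real N)"
    proof (rule integral_le)
      fix s assume s: "s \<in> {real k * \<tau>..real (Suc k) * \<tau>}"
      define a where "a = (s - real k * \<tau>) *\<^sub>R v k"
      have "norm a \<le> \<tau> * R" unfolding a_def norm_scaleR using s v[OF k] R_nonneg
        by (intro mult_mono) (auto simp: algebra_simps)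
      also have \<tau>N: "\<tau> \<le> 1 / real N" unfolding \<tau>_def using t by (intro divide_right_mono) auto
      finally have na: "norm a \<le> (1 / real N) * R" using R_nonneg by (simp add: mult_right_mono)
      have "(norm a)\<^sup>2 \<le> ((1 / real N) * R)\<^sup>2" using na by (intro power_mono) auto
      also have "\<dots> = (1 / real N) * ((1 / real N) * R\<^sup>2)" by (simp add: power2_eq_square)
      also have "\<dots> \<le> (1 / real N) * (1 * R\<^sup>2)" using N by (intro mult_left_mono mult_right_mono) auto
      finally have na2: "(norm a)\<^sup>2 \<le> (1 / real N) * R\<^sup>2" by simp
      have "F k s \<le> L (node N t x v k) (v k) + D (node N t x v k, v k) (a, 0) + C * (norm a)\<^sup>2"
        using upper[OF v[OF k] v[OF k], of "node N t x v k + a" "node N t x v k"] by (simp add: F_def a_def)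
      also have "D (node N t x v k, v k) (a, 0) \<le> C * norm a"
        using D_bound[OF v[OF k], of "node N t x v k" a 0] by simp
      also have "C * norm a \<le> C * ((1 / real N) * R)" using na C_ge_1 by (intro mult_left_mono) auto
      also have "C * (norm a)\<^sup>2 \<le> C * ((1 / real N) * R\<^sup>2)" using na2 C_ge_1 by (intro mult_left_mono) auto
      finally show "F k s \<le> L (node N t x v k) (v k) + C * (R + R\<^sup>2) / real N"
        by (simp add: distrib_left add_divide_distrib)
    qed (auto intro!: integrable_continuous_real Fc)
    then show ?thesis using \<tau> by (simp add: algebra_simps)
  qed
  have "integral {0..t} (\<lambda>s. L (\<gamma> s) (g s)) \<le> (\<Sum>k<N. \<tau> * (L (node N t x v k) (v k) + C * (R + R\<^sup>2) / real N))"
    unfolding integral_unique[OF hi] by (intro sum_mono Fb) auto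
  also have "\<dots> = discrete_action L N t x v + t * (C * (R + R\<^sup>2) / real N)"
    unfolding discrete_action_def \<tau>_def[symmetric] by (simp add: distrib_left sum.distrib tN)
  also have "\<dots> \<le> discrete_action L N t x v + 1 * (C * (R + R\<^sup>2) / real N)"
    using t C_ge_1 R_nonneg by (intro add_left_mono mult_right_mono) auto
  finally show ?thesis using W e0 e1 ai by auto
qed

section \<open>Calibration by discrete minimizers\<close>

text \<open>The three mesh errors left over in \<open>calibration_arith\<close>, with
  \<open>D0\<close> replaced by its bound \<open>2 * C + R\<close>.\<close>

definition calibration_const where "calibration_const = C * (2 * C + 2 * R) + C * R * (2 * C + R) + 2 * C * R\<^sup>2"

lemma calibration_const_nonneg: "calibration_const \<ge> 0" unfolding calibration_const_def using C_ge_1 R_nonneg by (intro add_nonneg_nonneg mult_nonneg_nonneg) auto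

text \<open>The velocity of a competitor is merely integrable, so its squared deviation need not
  have a finite integral. The tangent to the square at \<epsilon> is linear in \<open>r\<close>, and
  with slope at most 1 it lies below both branches of the minimum.\<close>

lemma min_tangent:
  fixes r \<epsilon> :: real
  assumes "r \<ge> 0" "0 \<le> \<epsilon>" "\<epsilon> \<le> 1/2"
  shows "min r (r\<^sup>2) \<ge> 2 * \<epsilon> * r - \<epsilon>\<^sup>2"
proof -
  have "0 \<le> (r - \<epsilon>)\<^sup>2" by simp
  then have 1: "r\<^sup>2 \<ge> 2 * \<epsilon> * r - \<epsilon>\<^sup>2" by (simp add: power2_eq_square algebra_simps)
  have "2 * \<epsilon> * r \<le> 1 * r" using assms by (intro mult_right_mono) auto
  then have "r \<ge> 2 * \<epsilon> * r - \<epsilon>\<^sup>2" by (smt (verit) zero_le_power2)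
  then show ?thesis using 1 by simp
qed

text \<open>\<open>D0\<close> is the total velocity deviation, and \<epsilon> is proportional to its
  time average. In units of \<open>c * D0\<^sup>2 / (4 * B * t)\<close> the gain is 4; by
  \<open>small\<close>, the square of \<epsilon> costs at most 1, the product of \<open>Q\<close>
  and \<open>D0\<close> 1 and the square of \<open>Q\<close> 2. The balance is exactly 0, and terms
  of order \<open>1 / N\<close> remain.\<close>

lemma calibration_arith:
  fixes D0 :: real
  assumes N: "N > 0" and t: "0 < t" "t \<le> 1" and small: "4 * C * (2 * C + R) * t \<le> c"
    and D0: "0 \<le> D0" "D0 \<le> (2 * C + R) * t" and \<epsilon>: "\<epsilon> = D0 / (2 * (2 * C + R) * t)"
    and Q: "Q = D0 + t / real N * R"
  shows "- (C * (t / real N) * (D0 + t * R)) + (2 * c * \<epsilon> - C * Q) * D0 - (c * \<epsilon>\<^sup>2 + C * Q\<^sup>2) * t \<ge> - (calibration_const / real N)"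
proof -
  define B where "B = 2 * C + R"
  define \<tau> where "\<tau> = t / real N"
  have B: "B \<ge> 1" unfolding B_def using C_ge_1 R_nonneg by simp
  have \<tau>: "0 \<le> \<tau>" "\<tau> \<le> 1 / real N" "\<tau> \<le> 1" unfolding \<tau>_def using t N by (auto simp: field_simps intro: order_trans[of _ 1])
  have e: "\<epsilon> = D0 / (2 * B * t)" using \<epsilon> by (simp add: B_def)
  have "c * \<epsilon>\<^sup>2 * t = c * D0\<^sup>2 / (4 * B * t) * (1 / B)"
    unfolding e using t B by (simp add: power2_eq_square field_simps)
  also have "\<dots> \<le> c * D0\<^sup>2 / (4 * B * t) * 1" using B t c_pos by (intro mult_left_mono) auto
  finally have 1: "c * \<epsilon>\<^sup>2 * t \<le> c * D0\<^sup>2 / (4 * B * t)" by simp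
  have 2: "2 * c * \<epsilon> * D0 = 4 * (c * D0\<^sup>2 / (4 * B * t))"
    unfolding e using t B by (simp add: power2_eq_square field_simps)
  have "4 * C * B * t * (D0\<^sup>2 / (4 * B * t)) \<le> c * (D0\<^sup>2 / (4 * B * t))"
    using small B t unfolding B_def[symmetric] by (intro mult_right_mono) auto
  moreover have "4 * C * B * t * (D0\<^sup>2 / (4 * B * t)) = C * D0\<^sup>2" using B t by simp
  ultimately have 3: "C * D0\<^sup>2 \<le> c * D0\<^sup>2 / (4 * B * t)" by simp
  have 4: "C * Q * D0 = C * D0\<^sup>2 + C * R * (\<tau> * D0)" unfolding Q \<tau>_def[symmetric] by (simp add: power2_eq_square algebra_simps)
  have "Q\<^sup>2 \<le> 2 * (D0\<^sup>2 + (\<tau> * R)\<^sup>2)" unfolding Q \<tau>_def[symmetric] by (rule power2_sum2_le)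
  then have "C * Q\<^sup>2 * t \<le> C * (2 * (D0\<^sup>2 + (\<tau> * R)\<^sup>2)) * 1"
    using t C_ge_1 by (intro mult_mono mult_left_mono) auto
  then have 5: "C * Q\<^sup>2 * t \<le> 2 * (C * D0\<^sup>2) + 2 * C * R\<^sup>2 * (\<tau> * \<tau>)"
    by (simp add: power_mult_distrib power2_eq_square algebra_simps)
  have DB: "D0 \<le> B" using D0 t B mult_left_mono[of t 1 B] unfolding B_def[symmetric] by argo
  have tR: "t * R \<le> R" using t R_nonneg by (simp add: mult_left_le_one_le)
  have 6: "C * \<tau> * (D0 + t * R) \<le> C * \<tau> * (B + R)" using \<tau> C_ge_1 DB tR by (intro mult_left_mono) auto
  have 7: "C * R * (\<tau> * D0) \<le> C * R * (\<tau> * B)" using \<tau> C_ge_1 R_nonneg DB by (intro mult_left_mono) auto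
  have 8: "2 * C * R\<^sup>2 * (\<tau> * \<tau>) \<le> 2 * C * R\<^sup>2 * (\<tau> * 1)" using \<tau> C_ge_1 by (intro mult_left_mono) auto
  have "\<tau> * calibration_const \<le> 1 / real N * calibration_const" using \<tau> calibration_const_nonneg by (intro mult_right_mono) auto
  moreover have "\<tau> * calibration_const = C * \<tau> * (B + R) + C * R * (\<tau> * B) + 2 * C * R\<^sup>2 * (\<tau> * 1)"
    unfolding calibration_const_def B_def by (simp add: algebra_simps)
  moreover have "0 \<le> c * D0\<^sup>2 / (4 * B * t)" using c_pos B t by auto
  moreover have "(2 * c * \<epsilon> - C * Q) * D0 - (c * \<epsilon>\<^sup>2 + C * Q\<^sup>2) * t = 2 * c * \<epsilon> * D0 - C * Q * D0 - c * \<epsilon>\<^sup>2 * t - C * Q\<^sup>2 * t"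
    by (simp add: algebra_simps)
  ultimately show ?thesis unfolding \<tau>_def[symmetric] using 1 2 3 4 5 6 7 8 by simp
qed

text \<open>A discrete minimizer with slack in the speed bound calibrates: expanding the Lagrangian along an arbitrary
  curve around the nodes of the minimizer, the terms of first order cancel by
  \<open>minimizer_first_order\<close>, and the remainder is nonnegative up to the mesh size for small times.\<close>

lemma calibration:
  assumes min: "is_minimizer N t x y v" and N: "N > 0" and t: "0 < t" "t \<le> 1"
    and small: "4 * C * (2 * C + R) * t \<le> c" and vs: "\<And>i. i < N \<Longrightarrow> norm (v i) \<le> R - 1"
    and W: "W11 t \<gamma> g" and \<gamma>0: "\<gamma> 0 = x" and \<gamma>t: "\<gamma> t = y"
    and ai: "(\<lambda>s. L (\<gamma> s) (g s)) absolutely_integrable_on {0..t}"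
  shows "discrete_action L N t x v - calibration_const / real N \<le> integral {0..t} (\<lambda>s. L (\<gamma> s) (g s))"
proof -
  define A where "A = integral {0..t} (\<lambda>s. L (\<gamma> s) (g s))"
  have vR: "norm (v i) \<le> R" for i using min unfolding is_minimizer_def by simp
  have Li: "(\<lambda>s. L (\<gamma> s) (g s)) integrable_on {0..t}" using ai set_lebesgue_integral_eq_integral(1) by blast
  have ga: "g absolutely_integrable_on {0..t}" and \<gamma>c: "continuous_on {0..t} \<gamma>" using W unfolding W11_def by auto
  have gi: "g integrable_on {0..t}" using ga set_lebesgue_integral_eq_integral(1) by blast
  have ngi: "(\<lambda>s. norm (g s)) integrable_on {0..t}" using ga by (simp add: absolutely_integrable_on_def)
  show ?thesis
  \<comment> \<open>Velocities of norm at most \<open>R\<close> have action at most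
    \<open>C * t\<close>, so competitors above that value are harmless. For the others coercivity
    bounds the integral of the speed, hence \<open>D0\<close>.\<close>
  proof (cases "A \<ge> C * t")
    case True
    have "discrete_action L N t x v \<le> (\<Sum>i<N. (t / real N) * C)"
      unfolding discrete_action_def using t L_bound[OF vR] by (intro sum_mono mult_left_mono) (auto simp: abs_le_iff)
    also have "\<dots> = C * t" using N by simp
    finally have "discrete_action L N t x v - calibration_const / real N \<le> A" using True calibration_const_nonneg by (smt (verit) divide_nonneg_nonneg of_nat_0_le_iff)
    then show ?thesis unfolding A_def .
  next
    case False
    define \<tau> where "\<tau> = t / real N"
    have \<tau>: "\<tau> > 0" using N t by (simp add: \<tau>_def)
    have tN: "t = real N * \<tau>" using N by (simp add: \<tau>_def)
    define I where "I k = {real k * \<tau>..real (Suc k) * \<tau>}" for k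
    have Ile: "real k * \<tau> \<le> real (Suc k) * \<tau>" for k using \<tau> by (simp add: mult_right_mono)
    have kt: "0 \<le> real k * \<tau>" "real (Suc k) * \<tau> \<le> t" if "k < N" for k
      using that \<tau> unfolding tN by (auto intro!: mult_right_mono)
    have kt': "real k * \<tau> \<le> t" if "k \<le> N" for k
      using that \<tau> unfolding tN by (auto intro!: mult_right_mono)
    have Isub: "I k \<subseteq> {0..t}" if "k < N" for k using kt[OF that] by (auto simp: I_def)
    have onI: "f integrable_on I k" if "f integrable_on {0..t}" "k < N" for k and f :: "real \<Rightarrow> 'z::banach"
      using integrable_on_subinterval[OF that(1)] Isub[OF that(2)] unfolding I_def by blast
    have cI: "((\<lambda>_. z) has_integral \<tau> *\<^sub>R z) (I k)" for k and z :: "'z::banach"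
      using has_integral_const_real[of z "real k * \<tau>" "real (Suc k) * \<tau>"] \<tau> unfolding I_def by (simp add: algebra_simps)
    define X where "X k = node N t x v k" for k
    \<comment> \<open>The deviation from the minimizer is recorded at grid times only; inside a cell
      the curve is controlled by \<open>m k\<close>.\<close>
    define d where "d k = \<gamma> (real k * \<tau>) - X k" for k
    have gvi: "(\<lambda>s. g s - v k) integrable_on I k" if "k < N" for k
      using onI[OF gi that] cI by (intro integrable_diff) (auto simp: integrable_on_def)
    have gva: "(\<lambda>s. norm (g s - v k)) integrable_on I k" if "k < N" for k
    proof -
      have "g absolutely_integrable_on I k"
        by (rule set_integrable_subset[OF ga _ Isub[OF that]]) (simp add: I_def)
      moreover have "(\<lambda>_. v k) absolutely_integrable_on I k" unfolding I_def by (rule absolutely_integrable_on_const) simp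
      ultimately have "(\<lambda>s. g s - v k) absolutely_integrable_on I k" by (rule set_integral_diff(1))
      then show ?thesis by (simp add: absolutely_integrable_on_def)
    qed
    define m where "m k = integral (I k) (\<lambda>s. norm (g s - v k))" for k
    have m0: "m k \<ge> 0" for k unfolding m_def
      by (cases "(\<lambda>s. norm (g s - v k)) integrable_on I k") (simp_all add: integral_nonneg not_integrable_integral)
    define D0 where "D0 = (\<Sum>k<N. m k)"
    have D00: "D0 \<ge> 0" unfolding D0_def using m0 by (intro sum_nonneg) auto
    have D0le: "D0 \<le> (2 * C + R) * t"
    proof -
      have "m k \<le> integral (I k) (\<lambda>s. norm (g s)) + \<tau> * R" if k: "k < N" for k
      proof -
        have h: "((\<lambda>s. norm (g s) + R) has_integral integral (I k) (\<lambda>s. norm (g s)) + \<tau> * R) (I k)"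
          using has_integral_add[OF integrable_integral[OF onI[OF ngi k]] cI[of R k]] by simp
        have "m k \<le> integral (I k) (\<lambda>s. norm (g s) + R)" unfolding m_def
        proof (rule integral_le[OF gva[OF k]])
          show "(\<lambda>s. norm (g s) + R) integrable_on I k" using h by (auto simp: integrable_on_def)
          show "norm (g s - v k) \<le> norm (g s) + R" for s
            using norm_triangle_ineq4[of "g s" "v k"] vR[of k] by linarith
        qed
        then show ?thesis using h by (simp add: integral_unique)
      qed
      then have "D0 \<le> (\<Sum>k<N. integral (I k) (\<lambda>s. norm (g s)) + \<tau> * R)" unfolding D0_def by (intro sum_mono) auto
      also have "\<dots> = integral {0..t} (\<lambda>s. norm (g s)) + t * R"
      proof -
        have "((\<lambda>s. norm (g s)) has_integral (\<Sum>k<N. integral (I k) (\<lambda>s. norm (g s)))) {0..real N * \<tau>}"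
          by (rule has_integral_grid) (use \<tau> integrable_integral[OF onI[OF ngi]] in \<open>auto simp: I_def\<close>)
        then show ?thesis by (simp add: sum.distrib tN integral_unique)
      qed
      also have "integral {0..t} (\<lambda>s. norm (g s)) \<le> integral {0..t} (\<lambda>s. L (\<gamma> s) (g s) + C)"
        using L_coercive by (intro integral_le ngi integrable_add Li integrable_const_ivl) (simp add: algebra_simps)
      also have "\<dots> = A + C * t"
        unfolding A_def using t by (subst Henstock_Kurzweil_Integration.integral_add[OF Li integrable_const_ivl]) simp
      finally show ?thesis using False by (simp add: algebra_simps)
    qed
    define \<epsilon> where "\<epsilon> = D0 / (2 * (2 * C + R) * t)"
    have CR: "2 * C + R > 0" using C_ge_1 R_nonneg by simp
    have "D0 \<le> 1/2 * (2 * (2 * C + R) * t)" using D0le by (simp add: algebra_simps)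
    then have \<epsilon>: "0 \<le> \<epsilon>" "\<epsilon> \<le> 1/2"
      unfolding \<epsilon>_def using D00 CR t by (simp_all add: pos_divide_le_eq)
    define Q where "Q = D0 + t / real N * R"
    have dS: "d (Suc k) - d k = integral (I k) (\<lambda>s. g s - v k)" if k: "k < N" for k
    proof -
      have 1: "integral (I k) g = \<gamma> (real (Suc k) * \<tau>) - \<gamma> (real k * \<tau>)"
        unfolding I_def by (rule W11_integral[OF W t(1) kt(1)[OF k] Ile kt(2)[OF k]])
      have 2: "X (Suc k) - X k = \<tau> *\<^sub>R v k" by (simp add: X_def node_def \<tau>_def scaleR_add_right)
      have 3: "integral (I k) (\<lambda>s. g s - v k) = integral (I k) g - \<tau> *\<^sub>R v k"
        using has_integral_diff[OF integrable_integral[OF onI[OF gi k]] cI[of "v k" k]] by (simp add: integral_unique)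
      have "d (Suc k) - d k = (\<gamma> (real (Suc k) * \<tau>) - \<gamma> (real k * \<tau>)) - (X (Suc k) - X k)"
        unfolding d_def by (metis (no_types, lifting) add_diff_eq diff_add_eq diff_diff_eq2 diff_right_commute)
      then show ?thesis unfolding 1[symmetric] 2 3[symmetric] .
    qed
    have nd: "norm (d k) \<le> (\<Sum>j<k. m j)" if "k \<le> N" for k
      using that
    proof (induction k)
      case 0
      then show ?case by (simp add: d_def X_def node_def \<gamma>0)
    next
      case (Suc k)
      have "norm (d (Suc k) - d k) \<le> m k" unfolding dS[OF Suc_le_lessD[OF Suc.prems]] m_def
        using Suc.prems by (intro integral_norm_bound_integral gvi gva) auto
      then show ?case using Suc norm_triangle_ineq2[of "d (Suc k)" "d k"] by simp
    qed
    have d0: "d 0 = 0" by (simp add: d_def X_def node_def \<gamma>0)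
    have dN: "d N = 0" using min \<gamma>t unfolding is_minimizer_def by (simp add: d_def X_def tN[symmetric])
    \<comment> \<open>The difference quotient of the deviation, so that \<open>d\<close> is the
      displacement caused by \<open>w\<close>. As the end points agree, \<open>d\<close> vanishes at
      both ends and the first-order condition applies.\<close>
    define w where "w k = (1 / \<tau>) *\<^sub>R (d (Suc k) - d k)" for k
    have nw: "node N t 0 w k = d k" for k
    proof -
      have "(\<Sum>j<k. w j) = (1 / \<tau>) *\<^sub>R (d k - d 0)"
        unfolding w_def scaleR_sum_right[symmetric] sum_lessThan_telescope ..
      then show ?thesis using d0 \<tau> by (simp add: node_def \<tau>_def[symmetric])
    qed
    have fo: "(\<Sum>k<N. D (X k, v k) (d k, w k)) = 0"
      using minimizer_first_order[OF min N t(1) vs, of w] nw dN unfolding X_def by simp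
    \<comment> \<open>The integrals \<open>m j\<close> up to and including this cell sum to at most
      \<open>D0\<close>; the extra \<open>\<tau> * R\<close> is the path of the minimizer during one
      step.\<close>
    have near: "norm (\<gamma> s - X k - d k) \<le> m k + \<tau> * R" "norm (\<gamma> s - X k) \<le> Q" if k: "k < N" and s: "s \<in> I k" for k s
    proof -
      have sub: "{real k * \<tau>..s} \<subseteq> I k" using s by (auto simp: I_def)
      have gs: "integral {real k * \<tau>..s} g = \<gamma> s - \<gamma> (real k * \<tau>)"
        using s kt[OF k] by (intro W11_integral[OF W t(1)]) (auto simp: I_def)
      have i1: "(\<lambda>s. norm (g s - v k)) integrable_on {real k * \<tau>..s}"
        using integrable_on_subinterval[OF gva[OF k, unfolded I_def]] sub unfolding I_def by blast
      have i2: "g integrable_on {real k * \<tau>..s}"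
        using integrable_on_subinterval[OF onI[OF gi k, unfolded I_def]] sub unfolding I_def by blast
      have i3: "(\<lambda>s. norm (g s - v k) + R) integrable_on {real k * \<tau>..s}"
        by (intro integrable_add i1 integrable_const_ivl)
      have "norm (integral {real k * \<tau>..s} g) \<le> integral {real k * \<tau>..s} (\<lambda>s. norm (g s - v k) + R)"
      proof (rule integral_norm_bound_integral[OF i2 i3])
        show "norm (g s) \<le> norm (g s - v k) + R" for s
          using norm_triangle_ineq2[of "g s" "v k"] vR[of k] by linarith
      qed
      also have "\<dots> = integral {real k * \<tau>..s} (\<lambda>s. norm (g s - v k)) + (s - real k * \<tau>) * R"
        using s by (subst Henstock_Kurzweil_Integration.integral_add[OF i1 integrable_const_ivl]) (simp add: I_def)
      also have "integral {real k * \<tau>..s} (\<lambda>s. norm (g s - v k)) \<le> m k"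
        unfolding m_def by (rule integral_subset_le[OF sub i1 gva[OF k]]) simp
      also have "(s - real k * \<tau>) * R \<le> \<tau> * R" using s R_nonneg by (intro mult_right_mono) (auto simp: I_def algebra_simps)
      finally show 1: "norm (\<gamma> s - X k - d k) \<le> m k + \<tau> * R" unfolding gs by (simp add: d_def)
      have "(\<Sum>j<k. m j) + m k = (\<Sum>j<Suc k. m j)" by simp
      also have "\<dots> \<le> D0" unfolding D0_def using k m0 by (intro sum_mono2) auto
      finally have "(\<Sum>j<k. m j) + m k \<le> D0" .
      then show "norm (\<gamma> s - X k) \<le> Q"
        using norm_triangle_ineq[of "\<gamma> s - X k - d k" "d k"] 1 nd[of k] k unfolding Q_def \<tau>_def[symmetric] by simp
    qed
    have Q0: "Q \<ge> 0" unfolding Q_def using D00 t R_nonneg by simp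
    \<comment> \<open>The part of the lower bound that is constant on a cell. What remains is linear
      in \<open>g s - v k\<close> or in its norm, and both integrate exactly.\<close>
    define a where "a k = L (X k) (v k) + D (X k, v k) (d k, 0) - C * (m k + \<tau> * R) - (c * \<epsilon>\<^sup>2 + C * Q\<^sup>2)" for k
    have pt: "a k + D (X k, v k) (0, g s - v k) + (2 * c * \<epsilon> - C * Q) * norm (g s - v k) \<le> L (\<gamma> s) (g s)"
      if k: "k < N" and s: "s \<in> I k" for k s
    proof -
      define r where "r = norm (g s - v k)"
      have "C * norm (\<gamma> s - X k) * r \<le> C * Q * r"
        using near(2)[OF k s] C_ge_1 by (intro mult_right_mono mult_left_mono) (auto simp: r_def)
      moreover have "C * (norm (\<gamma> s - X k))\<^sup>2 \<le> C * Q\<^sup>2"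
        using near(2)[OF k s] C_ge_1 by (intro mult_left_mono power_mono) auto
      moreover have "c * (2 * \<epsilon> * r - \<epsilon>\<^sup>2) \<le> c * min r (r\<^sup>2)"
        using min_tangent[OF _ \<epsilon>, of r] c_pos by (intro mult_left_mono) (auto simp: r_def)
      moreover have "D (X k, v k) (\<gamma> s - X k, g s - v k) = D (X k, v k) (d k, 0) + D (X k, v k) (\<gamma> s - X k - d k, 0) + D (X k, v k) (0, g s - v k)"
        using D_add[of "(X k, v k)" "(d k, 0)" "(\<gamma> s - X k - d k, 0)"] D_split[of "(X k, v k)" "\<gamma> s - X k" "g s - v k"] by simp
      moreover have "D (X k, v k) (\<gamma> s - X k - d k, 0) \<ge> - (C * norm (\<gamma> s - X k - d k))"
        using D_bound[OF vR[of k], of "X k" "\<gamma> s - X k - d k" 0] by (simp add: abs_le_iff)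
      moreover have "C * norm (\<gamma> s - X k - d k) \<le> C * (m k + \<tau> * R)"
        using near(1)[OF k s] C_ge_1 by (intro mult_left_mono) auto
      ultimately show ?thesis
        using lower[OF vR[of k], where x = "X k" and x' = "\<gamma> s" and u = "g s"] unfolding a_def r_def[symmetric]
        by (simp add: algebra_simps)
    qed
    \<comment> \<open>Over a cell \<open>g s - v k\<close> integrates to
      \<open>d (Suc k) - d k\<close>, which is \<open>\<tau> *\<^sub>R w k\<close>: the first-order
      terms assemble to those of \<open>fo\<close> and vanish in the sum over all cells.\<close>
    have seg: "\<tau> * L (X k) (v k) + \<tau> * D (X k, v k) (d k, w k) + (- (C * \<tau> * (m k + \<tau> * R)) + (2 * c * \<epsilon> - C * Q) * m k - (c * \<epsilon>\<^sup>2 + C * Q\<^sup>2) * \<tau>)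
        \<le> integral (I k) (\<lambda>s. L (\<gamma> s) (g s))" if k: "k < N" for k
    proof -
      have bl: "bounded_linear (\<lambda>b. D (X k, v k) (0, b))"
      proof -
        have "linear (\<lambda>b. D (X k, v k) (0, b))"
          by (rule linearI) (use D_add[of "(X k, v k)" "(0, _)" "(0, _)"] D_scale_snd in auto)
        then show ?thesis by (rule linear_conv_bounded_linear[THEN iffD1])
      qed
      have "((\<lambda>s. D (X k, v k) (0, g s - v k)) has_integral D (X k, v k) (0, d (Suc k) - d k)) (I k)"
        using has_integral_linear[OF integrable_integral[OF gvi[OF k]] bl] unfolding dS[OF k] by (simp add: o_def)
      from has_integral_add[OF has_integral_add[OF cI[of "a k" k] this] has_integral_mult_right[OF integrable_integral[OF gva[OF k]], of "2 * c * \<epsilon> - C * Q"]]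
      have h: "((\<lambda>s. a k + D (X k, v k) (0, g s - v k) + (2 * c * \<epsilon> - C * Q) * norm (g s - v k)) has_integral
          \<tau> * a k + D (X k, v k) (0, d (Suc k) - d k) + (2 * c * \<epsilon> - C * Q) * m k) (I k)"
        by (simp add: m_def)
      have "\<tau> * a k + D (X k, v k) (0, d (Suc k) - d k) + (2 * c * \<epsilon> - C * Q) * m k \<le> integral (I k) (\<lambda>s. L (\<gamma> s) (g s))"
        by (rule has_integral_le[OF h integrable_integral[OF onI[OF Li k]]]) (rule pt[OF k])
      moreover have "D (X k, v k) (0, d (Suc k) - d k) = \<tau> * D (X k, v k) (0, w k)"
        using D_scale_snd[of "(X k, v k)" \<tau> "w k"] \<tau> by (simp add: w_def)
      moreover have "D (X k, v k) (d k, w k) = D (X k, v k) (d k, 0) + D (X k, v k) (0, w k)" by (rule D_split)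
      ultimately show ?thesis unfolding a_def by (simp add: algebra_simps)
    qed
    have "A = (\<Sum>k<N. integral (I k) (\<lambda>s. L (\<gamma> s) (g s)))"
    proof -
      have "((\<lambda>s. L (\<gamma> s) (g s)) has_integral (\<Sum>k<N. integral (I k) (\<lambda>s. L (\<gamma> s) (g s)))) {0..real N * \<tau>}"
        by (rule has_integral_grid) (use \<tau> integrable_integral[OF onI[OF Li]] in \<open>auto simp: I_def\<close>)
      then show ?thesis unfolding A_def tN[symmetric] by (rule integral_unique)
    qed
    also have "\<dots> \<ge> (\<Sum>k<N. \<tau> * L (X k) (v k) + \<tau> * D (X k, v k) (d k, w k) + (- (C * \<tau> * (m k + \<tau> * R)) + (2 * c * \<epsilon> - C * Q) * m k - (c * \<epsilon>\<^sup>2 + C * Q\<^sup>2) * \<tau>))"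
      by (intro sum_mono seg) auto
    also have "(\<Sum>k<N. \<tau> * L (X k) (v k) + \<tau> * D (X k, v k) (d k, w k) + (- (C * \<tau> * (m k + \<tau> * R)) + (2 * c * \<epsilon> - C * Q) * m k - (c * \<epsilon>\<^sup>2 + C * Q\<^sup>2) * \<tau>))
      = (\<Sum>k<N. \<tau> * L (X k) (v k)) + \<tau> * (\<Sum>k<N. D (X k, v k) (d k, w k)) + (- (C * \<tau> * (D0 + t * R)) + (2 * c * \<epsilon> - C * Q) * D0 - (c * \<epsilon>\<^sup>2 + C * Q\<^sup>2) * t)"
    proof -
      have "(\<Sum>k<N. - (C * \<tau> * (m k + \<tau> * R)) + (2 * c * \<epsilon> - C * Q) * m k - (c * \<epsilon>\<^sup>2 + C * Q\<^sup>2) * \<tau>)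
        = - (C * \<tau> * (D0 + real N * (\<tau> * R))) + (2 * c * \<epsilon> - C * Q) * D0 - real N * ((c * \<epsilon>\<^sup>2 + C * Q\<^sup>2) * \<tau>)"
        unfolding D0_def by (simp add: sum.distrib sum_subtractf sum_negf sum_distrib_left distrib_left)
      then show ?thesis unfolding sum.distrib sum_distrib_left[symmetric] by (simp add: tN mult_ac)
    qed
    also have "(\<Sum>k<N. \<tau> * L (X k) (v k)) = discrete_action L N t x v"
      unfolding discrete_action_def X_def \<tau>_def ..
    finally have "A \<ge> discrete_action L N t x v + (- (C * \<tau> * (D0 + t * R)) + (2 * c * \<epsilon> - C * Q) * D0 - (c * \<epsilon>\<^sup>2 + C * Q\<^sup>2) * t)"
      unfolding fo by simp
    moreover have "- (C * (t / real N) * (D0 + t * R)) + (2 * c * \<epsilon> - C * Q) * D0 - (c * \<epsilon>\<^sup>2 + C * Q\<^sup>2) * t \<ge> - (calibration_const / real N)"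
      by (rule calibration_arith[OF N t small D00 D0le \<epsilon>_def Q_def])
    ultimately show ?thesis unfolding A_def \<tau>_def[symmetric] by linarith
  qed
qed

end

section \<open>The fundamental solution for short times\<close>

text \<open>Lets the mesh tend to 0 within an inequality, so each estimate passes to the limit by
  itself.\<close>

lemma le_if_le_add_inverse_nat:
  fixes a b M :: real
  assumes "\<And>N::nat. N > 0 \<Longrightarrow> a \<le> b + M / real N"
  shows "a \<le> b"
proof -
  have "(\<lambda>N. b + M * inverse (real (Suc N))) \<longlonglongrightarrow> b + M * 0"
    by (intro tendsto_intros LIMSEQ_inverse_real_of_nat)
  then have l: "(\<lambda>N. b + M * inverse (real (Suc N))) \<longlonglongrightarrow> b" by simp
  show ?thesis
    by (rule LIMSEQ_le_const[OF l]) (use assms[of "Suc _"] in \<open>auto simp: divide_inverse\<close>)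
qed

text \<open>The factor 6: the two ends of an outer curve in a second difference are at most
  \<open>3 * (lam * t)\<close> apart, over a time that may be as short as \<open>t / 2\<close>.
  Minimizers then have speed at most \<open>6 * lam + 1\<close>; a change of at most
  \<open>2 * lam * t\<close>, run in half the time, gives the bound on \<open>R\<close>. The last
  three conditions on \<open>T\<close> serve the oscillation of minimizers, the calibration and the
  absorption of displacements.\<close>

locale short_time = lagrangian_bounds L D R c C
  for L :: "real^'n \<Rightarrow> real^'n \<Rightarrow> real" and D R c C +
  fixes lam T :: real
  assumes lam: "lam > 0" and R_large: "R \<ge> 2 * (6 * lam + 1) + 4 * lam"
    and T: "T > 0" "T \<le> 1" "C * (1 + R) * T < 2 * c" "4 * C * (2 * C + R) * T \<le> c" "54 * remainder_const * T\<^sup>2 \<le> \<kappa>"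
begin

definition mesh_const :: real where "mesh_const = C * (R + R\<^sup>2) + calibration_const"

lemma small_time:
  assumes "0 < t" "t \<le> T"
  shows "t \<le> 1" "C * (1 + R) * t < 2 * c" "4 * C * (2 * C + R) * t \<le> c" "54 * remainder_const * t\<^sup>2 \<le> \<kappa>"
proof -
  show "t \<le> 1" using assms T by simp
  have "C * (1 + R) * t \<le> C * (1 + R) * T" using assms C_ge_1 R_nonneg by (intro mult_left_mono) auto
  then show "C * (1 + R) * t < 2 * c" using T by simp
  have "4 * C * (2 * C + R) * t \<le> 4 * C * (2 * C + R) * T" using assms C_ge_1 R_nonneg by (intro mult_left_mono) auto
  then show "4 * C * (2 * C + R) * t \<le> c" using T by simp
  have "54 * remainder_const * t\<^sup>2 \<le> 54 * remainder_const * T\<^sup>2" using assms remainder_const_pos by (intro mult_left_mono power_mono) auto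
  then show "54 * remainder_const * t\<^sup>2 \<le> \<kappa>" using T by simp
qed

text \<open>Coercivity bounds all actions from below, so the real infimum is a lower bound for them,
  and the polygon is a competitor.\<close>

lemma fund_sol_le_discrete_action:
  assumes N: "N > 0" and t: "0 < t" "t \<le> T" and v: "\<And>i. i < N \<Longrightarrow> norm (v i) \<le> R" and y: "node N t x v N = y"
  shows "fund_sol L t x y \<le> discrete_action L N t x v + mesh_const / real N"
proof -
  let ?S = "{integral {0..t} (\<lambda>s. L (\<gamma> s) (g s)) | \<gamma> g.
            W11 t \<gamma> g \<and> \<gamma> 0 = x \<and> \<gamma> t = y \<and>
            (\<lambda>s. L (\<gamma> s) (g s)) absolutely_integrable_on {0..t}}"
  have "bdd_below ?S"
  proof (rule bdd_belowI[of _ "- C * t"])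
    fix a assume "a \<in> ?S"
    then obtain \<gamma> g where a: "a = integral {0..t} (\<lambda>s. L (\<gamma> s) (g s))"
      and ai: "(\<lambda>s. L (\<gamma> s) (g s)) absolutely_integrable_on {0..t}" by blast
    have "integral {0..t} (\<lambda>_. - C) \<le> a" unfolding a
    proof (rule integral_le)
      show "(\<lambda>s. L (\<gamma> s) (g s)) integrable_on {0..t}" using ai set_lebesgue_integral_eq_integral(1) by blast
      show "- C \<le> L (\<gamma> s) (g s)" for s using L_coercive[of "g s" "\<gamma> s"] norm_ge_zero[of "g s"] by linarith
    qed (rule integrable_const_ivl)
    then show "- C * t \<le> a" using t by (simp add: field_simps)
  qed
  moreover obtain \<gamma> g where "W11 t \<gamma> g" "\<gamma> 0 = x" "\<gamma> t = node N t x v N"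
     "(\<lambda>s. L (\<gamma> s) (g s)) absolutely_integrable_on {0..t}" and
     le: "integral {0..t} (\<lambda>s. L (\<gamma> s) (g s)) \<le> discrete_action L N t x v + C * (R + R\<^sup>2) / real N"
    using polygon_action[OF N t(1) small_time(1)[OF t] v] by fastforce
  then have "integral {0..t} (\<lambda>s. L (\<gamma> s) (g s)) \<in> ?S" using y by auto
  ultimately have "fund_sol L t x y \<le> integral {0..t} (\<lambda>s. L (\<gamma> s) (g s))"
    unfolding fund_sol_def by (intro cInf_lower)
  moreover have "C * (R + R\<^sup>2) / real N \<le> mesh_const / real N"
    unfolding mesh_const_def using calibration_const_nonneg by (intro divide_right_mono) auto
  ultimately show ?thesis using le by linarith
qed

lemma fund_sol_ge_discrete_action:
  assumes N: "N > 0" and t: "0 < t" "t \<le> T" and min: "is_minimizer N t x y v"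
    and vs: "\<And>i. i < N \<Longrightarrow> norm (v i) \<le> R - 1"
  shows "discrete_action L N t x v - mesh_const / real N \<le> fund_sol L t x y"
  unfolding fund_sol_def
proof (rule cInf_greatest)
  have "\<And>i. norm (v i) \<le> R" "node N t x v N = y" using min unfolding is_minimizer_def by auto
  then show "{integral {0..t} (\<lambda>s. L (\<gamma> s) (g s)) | \<gamma> g.
            W11 t \<gamma> g \<and> \<gamma> 0 = x \<and> \<gamma> t = y \<and>
            (\<lambda>s. L (\<gamma> s) (g s)) absolutely_integrable_on {0..t}} \<noteq> {}"
    using polygon_action[OF N t(1) small_time(1)[OF t], of v x] by blast
  fix a assume "a \<in> {integral {0..t} (\<lambda>s. L (\<gamma> s) (g s)) | \<gamma> g.
            W11 t \<gamma> g \<and> \<gamma> 0 = x \<and> \<gamma> t = y \<and>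
            (\<lambda>s. L (\<gamma> s) (g s)) absolutely_integrable_on {0..t}}"
  then have "discrete_action L N t x v - calibration_const / real N \<le> a"
    using calibration[OF min N t(1) small_time(1,3)[OF t] vs] by blast
  moreover have "calibration_const / real N \<le> mesh_const / real N"
    unfolding mesh_const_def using C_ge_1 R_nonneg by (intro divide_right_mono) auto
  ultimately show "discrete_action L N t x v - mesh_const / real N \<le> a" by linarith
qed

lemma approximate_minimizer:
  assumes N: "N > 0" and t: "0 < t" "t \<le> T" and xy: "norm (y - x) \<le> 6 * lam * t"
  obtains v where "\<And>i. norm (v i) \<le> R" "\<And>i. i < N \<Longrightarrow> norm (v i) \<le> 6 * lam + 1" "node N t x v N = y"
    "discrete_action L N t x v \<le> fund_sol L t x y + mesh_const / real N"
proof -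
  have "6 * lam * t \<le> R * t" using lam R_large t by (intro mult_right_mono) auto
  then have "norm (y - x) \<le> R * t" using xy by simp
  then obtain v where v: "is_minimizer N t x y v" using minimizer_exists[OF N t(1)] by blast
  have s: "norm (v i) \<le> 6 * lam + 1" if "i < N" for i
    using minimizer_speed[OF v N t(1) small_time(2)[OF t] xy that] by simp
  have "norm (v i) \<le> R - 1" if "i < N" for i using s[OF that] R_large lam by auto
  then have "discrete_action L N t x v \<le> fund_sol L t x y + mesh_const / real N"
    using fund_sol_ge_discrete_action[OF N t v] by simp
  then show ?thesis using that v s unfolding is_minimizer_def by blast
qed

lemma fund_sol_bounded:
  assumes t: "0 < t" "t \<le> T" and xy: "norm (y - x) \<le> 6 * lam * t"
  shows "\<bar>fund_sol L t x y\<bar> \<le> C + mesh_const"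
proof -
  \<comment> \<open>A single time step is enough for a bound that need not be sharp.\<close>
  obtain v where v: "\<And>i. norm (v i) \<le> R" "node 1 t x v 1 = y"
    "discrete_action L 1 t x v \<le> fund_sol L t x y + mesh_const / real 1"
    using approximate_minimizer[OF zero_less_one t xy] by metis
  have "fund_sol L t x y \<le> discrete_action L 1 t x v + mesh_const / real 1"
    by (rule fund_sol_le_discrete_action[OF zero_less_one t v(1,2)])
  moreover have "\<bar>discrete_action L 1 t x v\<bar> \<le> 1 * C"
    unfolding discrete_action_def using L_bound[OF v(1)] t small_time(1)[OF t]
    by (simp add: abs_mult) (intro mult_mono[of t 1 _ C, simplified]; simp)
  ultimately show ?thesis using v(3) by simp
qed

text \<open>Minimizers at the outer points provide a competitor at the centre. The velocity gaps
  stay in the conclusion because uniform convexity is read off from them. The mesh error counts four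
  times: once for each outer point, twice for the centre.\<close>

lemma second_difference_lower_discrete:
  assumes N: "N > 0" and t: "0 < t" "t + \<bar>h\<bar> \<le> T" "\<bar>h\<bar> \<le> t / 2"
    and p: "norm ((y + z') - (x + z)) \<le> 6 * lam * (t + h)" and m: "norm ((y - z') - (x - z)) \<le> 6 * lam * (t - h)"
  obtains vp v where "node N (t + h) (x + z) vp N = y + z'" "node N t x v N = y"
    "fund_sol L (t + h) (x + z) (y + z') + fund_sol L (t - h) (x - z) (y - z') - 2 * fund_sol L t x y
      \<ge> \<kappa> * t / 8 * ((\<Sum>i<N. (norm (vp i - v i))\<^sup>2) / real N) - semiconvexity_const / t * (h\<^sup>2 + (norm z)\<^sup>2) - 4 * mesh_const / real N"
proof -
  have tt: "0 < t + h" "t + h \<le> T" "0 < t - h" "t - h \<le> T" "t \<le> T" using t by auto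
  obtain vp where vp: "\<And>i. norm (vp i) \<le> R" "node N (t + h) (x + z) vp N = y + z'"
    "discrete_action L N (t + h) (x + z) vp \<le> fund_sol L (t + h) (x + z) (y + z') + mesh_const / real N"
    using approximate_minimizer[OF N tt(1,2) p] by metis
  obtain vm where vm: "\<And>i. norm (vm i) \<le> R" "node N (t - h) (x - z) vm N = y - z'"
    "discrete_action L N (t - h) (x - z) vm \<le> fund_sol L (t - h) (x - z) (y - z') + mesh_const / real N"
    using approximate_minimizer[OF N tt(3,4) m] by metis
  define v where "v i = (1 / (2 * t)) *\<^sub>R ((t + h) *\<^sub>R vp i + (t - h) *\<^sub>R vm i)" for i
  have vR: "norm (v i) \<le> R" for i
  proof -
    have "norm ((t + h) *\<^sub>R vp i + (t - h) *\<^sub>R vm i) \<le> (t + h) * R + (t - h) * R"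
      using vp(1)[of i] vm(1)[of i] tt by (intro order_trans[OF norm_triangle_ineq add_mono]) (auto intro!: mult_left_mono)
    also have "\<dots> = 2 * t * R" by (simp add: algebra_simps)
    finally have "norm ((t + h) *\<^sub>R vp i + (t - h) *\<^sub>R vm i) \<le> 2 * t * R" .
    moreover have "norm (v i) = norm ((t + h) *\<^sub>R vp i + (t - h) *\<^sub>R vm i) / (2 * t)"
      unfolding v_def using t by simp
    ultimately show ?thesis using t by (simp add: pos_divide_le_eq mult.commute)
  qed
  have "node N t x v N = y"
  proof -
    have e: "(t / real N) *\<^sub>R v i = (1/2) *\<^sub>R (((t + h) / real N) *\<^sub>R vp i + ((t - h) / real N) *\<^sub>R vm i)" for i
    proof -
      have "(t / real N) *\<^sub>R v i = (1/2) *\<^sub>R ((1 / real N) *\<^sub>R ((t + h) *\<^sub>R vp i + (t - h) *\<^sub>R vm i))"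
        unfolding v_def using t by simp
      then show ?thesis by (simp add: scaleR_add_right)
    qed
    have "node N t x v N = x + (1/2) *\<^sub>R (((t + h) / real N) *\<^sub>R (\<Sum>i<N. vp i) + ((t - h) / real N) *\<^sub>R (\<Sum>i<N. vm i))"
      by (simp only: node_def scaleR_sum_right e sum.distrib[symmetric])
    also have "((t + h) / real N) *\<^sub>R (\<Sum>i<N. vp i) = y + z' - (x + z)"
      using vp(2) unfolding node_def by (simp add: algebra_simps)
    also have "((t - h) / real N) *\<^sub>R (\<Sum>i<N. vm i) = y - z' - (x - z)"
      using vm(2) unfolding node_def by (simp add: algebra_simps)
    also have "(y + z' - (x + z)) + (y - z' - (x - z)) = 2 *\<^sub>R (y - x)" by (simp add: scaleR_2)
    finally show ?thesis by simp
  qed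
  moreover have "fund_sol L t x y \<le> discrete_action L N t x v + mesh_const / real N"
    by (rule fund_sol_le_discrete_action[OF N t(1) tt(5) vR calculation])
  moreover have "discrete_action L N (t + h) (x + z) vp + discrete_action L N (t - h) (x - z) vm - 2 * discrete_action L N t x v
     \<ge> \<kappa> * t / 8 * ((\<Sum>i<N. (norm (vp i - v i))\<^sup>2) / real N) - semiconvexity_const / t * (h\<^sup>2 + (norm z)\<^sup>2)"
    by (rule discrete_second_difference_lower[OF N t(1) small_time(1,4)[OF t(1) tt(5)] t(3) vp(1) vm(1) v_def vR])
  moreover have "4 * mesh_const / real N = 4 * (mesh_const / real N)" by simp
  ultimately show ?thesis using that[of vp v] vp(2,3) vm(3) by linarith
qed

lemma second_difference_lower:
  assumes t: "0 < t" "t + \<bar>h\<bar> \<le> T" "\<bar>h\<bar> \<le> t / 2"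
    and p: "norm ((y + z') - (x + z)) \<le> 6 * lam * (t + h)" and m: "norm ((y - z') - (x - z)) \<le> 6 * lam * (t - h)"
  shows "fund_sol L (t + h) (x + z) (y + z') + fund_sol L (t - h) (x - z) (y - z') - 2 * fund_sol L t x y
      \<ge> - (semiconvexity_const / t * (h\<^sup>2 + (norm z)\<^sup>2))" (is "?A \<ge> ?B")
proof (rule le_if_le_add_inverse_nat)
  fix N :: nat assume N: "N > 0"
  obtain vp v :: "nat \<Rightarrow> real^'n" where "?A \<ge> \<kappa> * t / 8 * ((\<Sum>i<N. (norm (vp i - v i))\<^sup>2) / real N) - semiconvexity_const / t * (h\<^sup>2 + (norm z)\<^sup>2) - 4 * mesh_const / real N"
    using second_difference_lower_discrete[OF N t p m] by fastforce
  moreover have "0 \<le> \<kappa> * t / 8 * ((\<Sum>i<N. (norm (vp i - v i :: real^'n))\<^sup>2) / real N)"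
    using \<kappa>_pos t by (intro mult_nonneg_nonneg divide_nonneg_nonneg sum_nonneg) auto
  ultimately show "?B \<le> ?A + 4 * mesh_const / real N" by linarith
qed

text \<open>With \<open>h = 0\<close> and the initial point fixed, \<open>z\<close> is
  \<open>t\<close> times the mean velocity gap, so by Cauchy-Schwarz the mean square gap is at least
  |z|^2 / t^2, for every \<open>N\<close>.\<close>

lemma uniform_convexity:
  assumes t: "0 < t" "t \<le> T" and p: "norm (y + z - x) \<le> 6 * lam * t" and m: "norm (y - z - x) \<le> 6 * lam * t"
  shows "fund_sol L t x (y + z) + fund_sol L t x (y - z) - 2 * fund_sol L t x y \<ge> \<kappa> / 8 / t * (norm z)\<^sup>2"
    (is "?A \<ge> ?B")
proof (rule le_if_le_add_inverse_nat)
  fix N :: nat assume N: "N > 0"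
  obtain vp v where vp: "node N t x vp N = y + z" and v: "node N t x v N = y" and
    A: "?A \<ge> \<kappa> * t / 8 * ((\<Sum>i<N. (norm (vp i - v i))\<^sup>2) / real N) - 4 * mesh_const / real N"
    using second_difference_lower_discrete[OF N t(1), of 0 y z x 0] t p m by auto
  have "z = node N t x vp N - node N t x v N" using vp v by simp
  also have "\<dots> = (t / real N) *\<^sub>R (\<Sum>i<N. vp i - v i)" by (simp add: node_def sum_subtractf scaleR_diff_right)
  finally have "norm z = (t / real N) * norm (\<Sum>i<N. vp i - v i)" using t by simp
  also have "\<dots> \<le> (t / real N) * (\<Sum>i<N. norm (vp i - v i))" using t by (intro mult_left_mono norm_sum) auto
  finally have "(norm z)\<^sup>2 \<le> ((t / real N) * (\<Sum>i<N. norm (vp i - v i)))\<^sup>2" by (intro power_mono) auto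
  also have "\<dots> = t\<^sup>2 * ((\<Sum>i<N. norm (vp i - v i)) / real N)\<^sup>2" by (simp add: power_mult_distrib power_divide)
  also have "\<dots> \<le> t\<^sup>2 * ((\<Sum>i<N. (norm (vp i - v i))\<^sup>2) / real N)" by (intro mult_left_mono average_power2_le) auto
  finally have "\<kappa> / 8 / t * (norm z)\<^sup>2 \<le> \<kappa> / 8 / t * (t\<^sup>2 * ((\<Sum>i<N. (norm (vp i - v i))\<^sup>2) / real N))"
    using \<kappa>_pos t by (intro mult_left_mono) auto
  also have "\<dots> = \<kappa> * t / 8 * ((\<Sum>i<N. (norm (vp i - v i))\<^sup>2) / real N)" using t by (simp add: power2_eq_square)
  finally show "?B \<le> ?A + 4 * mesh_const / real N" using A by linarith
qed

lemma second_difference_upper: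
  assumes t: "0 < t" "t + \<bar>h\<bar> \<le> T" "\<bar>h\<bar> \<le> t / 2"
    and xy: "norm (y - x) \<le> 6 * lam * t" and z: "norm (z' - z) \<le> 2 * lam * t"
  shows "fund_sol L (t + h) (x + z) (y + z') + fund_sol L (t - h) (x - z) (y - z') - 2 * fund_sol L t x y
      \<le> semiconcavity_const / t * (h\<^sup>2 + (norm z)\<^sup>2 + (norm z')\<^sup>2)" (is "?A \<le> ?B")
proof (rule le_if_le_add_inverse_nat)
  fix N :: nat assume N: "N > 0"
  have tt: "0 < t + h" "t + h \<le> T" "0 < t - h" "t - h \<le> T" "t \<le> T" "t / 2 \<le> t + h" "t / 2 \<le> t - h" using t by auto
  obtain v where v: "\<And>i. norm (v i) \<le> R" "\<And>i. i < N \<Longrightarrow> norm (v i) \<le> 6 * lam + 1" "node N t x v N = y"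
    "discrete_action L N t x v \<le> fund_sol L t x y + mesh_const / real N"
    using approximate_minimizer[OF N t(1) tt(5) xy] by metis
  define vp where "vp i = (1 / (t + h)) *\<^sub>R (t *\<^sub>R v i + (z' - z))" for i
  define vm where "vm i = (1 / (t - h)) *\<^sub>R (t *\<^sub>R v i - (z' - z))" for i
  have pe: "(t + h) *\<^sub>R vp i = t *\<^sub>R v i + (z' - z)" and me: "(t - h) *\<^sub>R vm i = t *\<^sub>R v i - (z' - z)" for i
    using tt by (simp_all add: vp_def vm_def)
  \<comment> \<open>A shifted velocity is a shifted displacement divided by a duration of at least
    \<open>t / 2\<close>; this computation dictates the lower bound on \<open>R\<close>.\<close>
  have bd: "norm u \<le> R" if "s \<ge> t / 2" "norm (s *\<^sub>R u) \<le> t * (6 * lam + 1) + 2 * lam * t" for s and u :: "real^'n"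
  proof -
    have "(t / 2) * norm u \<le> s * norm u" using that by (intro mult_right_mono) auto
    also have "\<dots> \<le> t * (6 * lam + 1) + 2 * lam * t" using that t by simp
    also have "\<dots> = (t / 2) * (2 * (6 * lam + 1) + 4 * lam)" by (simp add: algebra_simps)
    also have "\<dots> \<le> (t / 2) * R" using R_large t by (intro mult_left_mono) auto
    finally show ?thesis using t by simp
  qed
  have tv: "norm (t *\<^sub>R v i) \<le> t * (6 * lam + 1)" if "i < N" for i using v(2)[OF that] t by simp
  have vpR: "norm (vp i) \<le> R" if "i < N" for i
    by (rule bd[OF tt(6)]) (unfold pe, use tv[OF that] z norm_triangle_ineq[of "t *\<^sub>R v i" "z' - z"] in linarith)
  have vmR: "norm (vm i) \<le> R" if "i < N" for i
    by (rule bd[OF tt(7)]) (unfold me, use tv[OF that] z norm_triangle_ineq4[of "t *\<^sub>R v i" "z' - z"] in linarith)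
  have nv: "(1 / real N) *\<^sub>R (\<Sum>i<N. t *\<^sub>R v i) = y - x" using v(3) unfolding node_def by (simp add: scaleR_sum_right[symmetric] algebra_simps)
  have node': "node N s a u i = a + (1 / real N) *\<^sub>R (\<Sum>j<i. s *\<^sub>R u j)" for s a and u :: "nat \<Rightarrow> real^'n" and i
    by (simp add: node_def scaleR_sum_right)
  have np: "node N (t + h) (x + z) vp N = y + z'"
    unfolding node' pe sum.distrib scaleR_add_right nv using N by (simp add: sum_constant_scaleR del: sum_constant)
  have nm: "node N (t - h) (x - z) vm N = y - z'"
    unfolding node' me sum_subtractf scaleR_diff_right nv using N by (simp add: sum_constant_scaleR del: sum_constant)
  have "fund_sol L (t + h) (x + z) (y + z') \<le> discrete_action L N (t + h) (x + z) vp + mesh_const / real N"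
    by (rule fund_sol_le_discrete_action[OF N tt(1,2) vpR np])
  moreover have "fund_sol L (t - h) (x - z) (y - z') \<le> discrete_action L N (t - h) (x - z) vm + mesh_const / real N"
    by (rule fund_sol_le_discrete_action[OF N tt(3,4) vmR nm])
  moreover have "discrete_action L N (t + h) (x + z) vp + discrete_action L N (t - h) (x - z) vm - 2 * discrete_action L N t x v \<le> ?B"
    by (rule discrete_second_difference_upper[OF N t(1) small_time(1)[OF t(1) tt(5)] t(3) vpR vmR v(1) pe me])
  moreover have "4 * mesh_const / real N = 4 * (mesh_const / real N)" by simp
  ultimately show "?A \<le> ?B + 4 * mesh_const / real N" using v(4) by linarith
qed

lemma second_difference_abs:
  assumes t: "0 < t" "t \<le> T / 2" "\<bar>h\<bar> \<le> t / 2"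
    and xy: "norm (y - x) \<le> lam * t" and z: "norm z \<le> lam * t" "norm z' \<le> lam * t"
  shows "\<bar>fund_sol L (t + h) (x + z) (y + z') + fund_sol L (t - h) (x - z) (y - z') - 2 * fund_sol L t x y\<bar>
      \<le> (semiconvexity_const + semiconcavity_const) / t * (h\<^sup>2 + (norm z)\<^sup>2 + (norm z')\<^sup>2)" (is "\<bar>?A\<bar> \<le> _ * ?S")
proof -
  have tT: "t + \<bar>h\<bar> \<le> T" using t by simp
  have near: "norm w \<le> 6 * lam * s" if "norm w \<le> 3 * (lam * t)" "t / 2 \<le> s" for w :: "real^'n" and s
    using that mult_left_mono[OF that(2), of "6 * lam"] lam by argo
  have "norm ((y + z') - (x + z)) \<le> 6 * lam * (t + h)"
  proof (rule near)
    have "(y + z') - (x + z) = (y - x) + z' - z" by simp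
    then show "norm ((y + z') - (x + z)) \<le> 3 * (lam * t)"
      using norm_triangle_ineq4[of "(y - x) + z'" z] norm_triangle_ineq[of "y - x" z'] xy z by (simp add: field_simps)
  qed (use t in auto)
  moreover have "norm ((y - z') - (x - z)) \<le> 6 * lam * (t - h)"
  proof (rule near)
    have "(y - z') - (x - z) = (y - x) - z' + z" by simp
    then show "norm ((y - z') - (x - z)) \<le> 3 * (lam * t)"
      using norm_triangle_ineq[of "(y - x) - z'" z] norm_triangle_ineq4[of "y - x" z'] xy z by (simp add: field_simps)
  qed (use t in auto)
  ultimately have lo: "?A \<ge> - (semiconvexity_const / t * (h\<^sup>2 + (norm z)\<^sup>2))" by (rule second_difference_lower[OF t(1) tT t(3)])
  have up: "?A \<le> semiconcavity_const / t * ?S"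
  proof (rule second_difference_upper[OF t(1) tT t(3)])
    show "norm (y - x) \<le> 6 * lam * t"
    proof (rule near)
      show "norm (y - x) \<le> 3 * (lam * t)" using xy mult_pos_pos[OF lam t(1)] by linarith
    qed (use t in simp)
    show "norm (z' - z) \<le> 2 * lam * t" using norm_triangle_ineq4[of z' z] z by simp
  qed
  have "semiconvexity_const / t * (h\<^sup>2 + (norm z)\<^sup>2) \<le> semiconvexity_const / t * ?S" using semiconvexity_const_pos t by (intro mult_left_mono) auto
  moreover have "(semiconvexity_const + semiconcavity_const) / t * ?S = semiconvexity_const / t * ?S + semiconcavity_const / t * ?S" by (simp add: add_divide_distrib distrib_right)
  moreover have "0 \<le> semiconvexity_const / t * ?S" "0 \<le> semiconcavity_const / t * ?S" using semiconvexity_const_pos semiconcavity_const_pos t by auto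
  ultimately show ?thesis using lo up by linarith
qed

end

text \<open>The factor \<open>K / t\<close> is unbounded near the vertex of the cone, so a constant
  exists only locally: on a small ball around a point with time \<open>t0\<close> all times are at
  least \<open>3 / 4 * t0\<close>.\<close>

lemma C11_loc_S_cone:
  fixes f :: "real \<times> (real^'n) \<Rightarrow> real"
  assumes lam: "lam > 0" and K: "K \<ge> 0"
    and sd: "\<And>t y h z. 0 < t \<Longrightarrow> t < T \<Longrightarrow> norm (y - x) \<le> lam * t \<Longrightarrow> \<bar>h\<bar> \<le> t / 2 \<Longrightarrow> norm z \<le> lam * t \<Longrightarrow>
       \<bar>f (t + h, y + z) + f (t - h, y - z) - 2 * f (t, y)\<bar> \<le> K / t * (h\<^sup>2 + (norm z)\<^sup>2)"
    and bd: "\<And>t y. 0 < t \<Longrightarrow> t < T \<Longrightarrow> norm (y - x) \<le> lam * t \<Longrightarrow> \<bar>f (t, y)\<bar> \<le> M"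
  shows "C11_loc f (S_cone lam x T)"
proof (rule C11_locI)
  fix p0 assume "p0 \<in> S_cone lam x T"
  then obtain t0 y0 where p0: "p0 = (t0, y0)" "0 < t0" "t0 < T" "norm (y0 - x) < lam * t0" by (auto simp: S_cone_def)
  \<comment> \<open>The first two bounds make all steps inside the ball admissible in
    \<open>sd\<close>; the last two keep the ball inside the cone, whose cross-section shrinks by
    \<open>lam\<close> per unit of time lost.\<close>
  define r where "r = min (min (t0 / 4) (lam * t0 / 4)) (min (T - t0) ((lam * t0 - norm (y0 - x)) / (1 + lam)))"
  have r: "r > 0" "r \<le> t0 / 4" "r \<le> lam * t0 / 4" "r \<le> T - t0" "r \<le> (lam * t0 - norm (y0 - x)) / (1 + lam)"
  proof -
    show "r > 0" unfolding r_def using p0 lam by auto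
    show "r \<le> t0 / 4" unfolding r_def by (rule min.coboundedI1, rule min.cobounded1)
    show "r \<le> lam * t0 / 4" unfolding r_def by (rule min.coboundedI1, rule min.cobounded2)
    show "r \<le> T - t0" unfolding r_def by (rule min.coboundedI2, rule min.cobounded1)
    show "r \<le> (lam * t0 - norm (y0 - x)) / (1 + lam)" unfolding r_def by (rule min.coboundedI2, rule min.cobounded2)
  qed
  have r5: "r * (1 + lam) \<le> lam * t0 - norm (y0 - x)" using r(5) lam by (simp add: pos_le_divide_eq)
  have inb: "\<bar>t - t0\<bar> < r \<and> norm (y - y0) < r" if "(t, y) \<in> ball p0 r" for t y
  proof -
    have d: "dist (t, y) p0 < r" using that by (simp add: dist_commute)
    have "dist t t0 \<le> dist (t, y) p0" "dist y y0 \<le> dist (t, y) p0"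
      using dist_fst_le[of "(t, y)" p0] dist_snd_le[of "(t, y)" p0] p0 by auto
    then show ?thesis using d by (simp add: dist_norm)
  qed
  have loc: "0 < t \<and> 3 / 4 * t0 \<le> t \<and> t < T \<and> norm (y - x) < lam * t" if "(t, y) \<in> ball p0 r" for t y
  proof -
    have a: "\<bar>t - t0\<bar> < r" "norm (y - y0) < r" using inb[OF that] by auto
    have "lam * (t0 - r) \<le> lam * t" using a lam by (intro mult_left_mono) auto
    moreover have "norm (y - x) \<le> norm (y - y0) + norm (y0 - x)" using norm_triangle_ineq[of "y - y0" "y0 - x"] by simp
    ultimately have "norm (y - x) < lam * t" using a r5 by (simp add: algebra_simps)
    then show ?thesis using a r p0 by auto
  qed
  have 1: "2 * K / t0 \<ge> 0" using K p0 by simp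
  have 2: "ball p0 r \<subseteq> S_cone lam x T" using loc by (auto simp: S_cone_def)
  have 3: "\<bar>f p\<bar> \<le> M" if "p \<in> ball p0 r" for p
    using loc[of "fst p" "snd p"] bd[of "fst p" "snd p"] that by auto
  have 4: "\<bar>f (p + q) + f (p - q) - 2 * f p\<bar> \<le> 2 * K / t0 * (norm q)\<^sup>2"
    if pq: "p + q \<in> ball p0 r" "p - q \<in> ball p0 r" for p q
  proof -
    obtain t y where p: "p = (t, y)" by (cases p)
    obtain h z where q: "q = (h, z)" by (cases q)
    have "(1/2) *\<^sub>R (p + q) + (1/2) *\<^sub>R (p - q) \<in> ball p0 r"
      using convexD[OF convex_ball pq, of "1/2" "1/2"] by simp
    moreover have "(1/2) *\<^sub>R (p + q) + (1/2) *\<^sub>R (p - q) = p"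
      by (simp add: algebra_simps flip: scaleR_add_left)
    ultimately have pb: "(t, y) \<in> ball p0 r" using p by simp
    have "dist (p + q) (p - q) \<le> dist (p + q) p0 + dist (p - q) p0" by (rule dist_triangle2)
    also have "\<dots> < 2 * r" using pq by (simp add: dist_commute)
    finally have "norm (q + q) < 2 * r" by (simp add: dist_norm)
    then have nq: "norm q < r" by (simp flip: scaleR_2)
    have hz: "\<bar>h\<bar> < r" "norm z < r" using norm_fst_le[of h z] norm_snd_le[of z h] nq q by auto
    have l: "0 < t" "3 / 4 * t0 \<le> t" "t < T" "norm (y - x) \<le> lam * t" using loc[OF pb] by auto
    have "lam * t0 / 4 \<le> lam * t" using l p0 mult_left_mono[of "t0 / 4" t lam] lam by simp
    then have "\<bar>f (t + h, y + z) + f (t - h, y - z) - 2 * f (t, y)\<bar> \<le> K / t * (h\<^sup>2 + (norm z)\<^sup>2)"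
      using hz r l p0 by (intro sd) auto
    also have "h\<^sup>2 + (norm z)\<^sup>2 = (norm q)\<^sup>2" by (simp add: q norm_Pair)
    also have "K / t * (norm q)\<^sup>2 \<le> 2 * K / t0 * (norm q)\<^sup>2"
    proof (intro mult_right_mono)
      have "K / t \<le> K / (t0 / 2)" using K l p0 by (intro divide_left_mono) auto
      then show "K / t \<le> 2 * K / t0" by (simp add: field_simps)
    qed auto
    finally show ?thesis by (simp add: p q)
  qed
  show "\<exists>r>0. \<exists>C\<ge>0. \<exists>M. ball p0 r \<subseteq> S_cone lam x T \<and>
      (\<forall>p q. p + q \<in> ball p0 r \<longrightarrow> p - q \<in> ball p0 r \<longrightarrow>
                 \<bar>f (p + q) + f (p - q) - 2 * f p\<bar> \<le> C * (norm q)\<^sup>2) \<and>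
      (\<forall>p\<in>ball p0 r. \<bar>f p\<bar> \<le> M)"
    using r(1) 1 2 3 4 by blast
qed

section \<open>Choice of the constants and conclusion\<close>

theorem mainTheorem2:
  fixes L :: "real^'n \<Rightarrow> real^'n \<Rightarrow> real" and lam :: real
  assumes "tonelli_lagrangian L" and "lam > 0"
  shows "\<exists>T>0.
    (\<exists>C>0. \<forall>x. \<forall>(t, y) \<in> S_cone lam x T. \<forall>h\<in>{0..<t/2}. \<forall>z\<in>ball 0 (lam * t).
       fund_sol L (t + h) x (y + z) + fund_sol L (t - h) x (y - z) - 2 * fund_sol L t x y
         \<ge> - (C / t) * (h\<^sup>2 + (norm z)\<^sup>2)) \<and>
    (\<exists>C'>0. \<forall>t\<in>{0<..T}. \<forall>x. \<forall>y\<in>ball x (lam * t). \<forall>z\<in>ball 0 (lam * t).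
       fund_sol L t x (y + z) + fund_sol L t x (y - z) - 2 * fund_sol L t x y
         \<ge> C' / t * (norm z)\<^sup>2) \<and>
    (\<forall>x. C11_loc (\<lambda>(t, y). fund_sol L t x y) (S_cone lam x T) \<and>
         C11_loc (\<lambda>(t, y). fund_sol L t y x) (S_cone lam x T))"
proof -
  note lam = assms(2)
  define R where "R = 2 * (6 * lam + 1) + 4 * lam"
  have R: "R > 0" using lam by (simp add: R_def)
  obtain D c C where lb: "lagrangian_bounds L D R c C"
    using tonelli_imp_lagrangian_bounds[OF assms(1) R] by blast
  interpret lb: lagrangian_bounds L D R c C by (rule lb)
  have C: "C > 0" using lb.C_ge_1 by simp
  \<comment> \<open>One term for each smallness condition of \<open>short_time\<close>; since
    \<open>T \<le> 1\<close>, the quadratic condition follows from the linear one.\<close>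
  define T where "T = min (min 1 (c / (C * (1 + R)))) (min (c / (4 * C * (2 * C + R))) (lb.\<kappa> / (54 * lb.remainder_const)))"
  have pos: "C * (1 + R) > 0" "4 * C * (2 * C + R) > 0" "54 * lb.remainder_const > 0" using C R lb.remainder_const_pos by auto
  have T: "T > 0" "T \<le> 1" "T \<le> c / (C * (1 + R))" "T \<le> c / (4 * C * (2 * C + R))" "T \<le> lb.\<kappa> / (54 * lb.remainder_const)"
    unfolding T_def using pos lb.c_pos lb.\<kappa>_pos by auto
  have "T\<^sup>2 \<le> T * 1" unfolding power2_eq_square using T by (intro mult_left_mono) auto
  then have T5: "54 * lb.remainder_const * T\<^sup>2 \<le> 54 * lb.remainder_const * T" using pos by (intro mult_left_mono) auto
  interpret short_time L D R c C lam T
  proof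
    show "C * (1 + R) * T < 2 * c" using T(3) pos lb.c_pos by (simp add: pos_le_divide_eq mult.commute)
    show "4 * C * (2 * C + R) * T \<le> c" using T(4) pos by (simp add: pos_le_divide_eq mult.commute)
    show "54 * lb.remainder_const * T\<^sup>2 \<le> lb.\<kappa>" 
    proof -
      have "54 * lb.remainder_const * T \<le> lb.\<kappa>" using T(5) pos by (simp add: pos_le_divide_eq mult.commute)
      then show ?thesis using T5 by linarith
    qed
  qed (use lam T in \<open>auto simp: R_def\<close>)
  define K' where "K' = lb.semiconvexity_const + lb.semiconcavity_const"
  have K': "K' > 0" unfolding K'_def using lb.semiconvexity_const_pos lb.semiconcavity_const_pos by simp
  have far: "norm w \<le> 6 * lam * t" if "norm w \<le> lam * t" "0 < t" for w :: "real^'n" and t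
    using that mult_pos_pos[OF lam that(2)] by linarith
  show ?thesis
  \<comment> \<open>Half of the admissible time, so that \<open>t + h\<close> does not exceed
    \<open>T\<close> for \<open>h \<le> t / 2\<close>.\<close>
  proof (rule exI[of _ "T / 2"], intro conjI)
    show "T / 2 > 0" using T by simp
    show "\<exists>C>0. \<forall>x. \<forall>(t, y) \<in> S_cone lam x (T / 2). \<forall>h\<in>{0..<t/2}. \<forall>z\<in>ball 0 (lam * t).
       fund_sol L (t + h) x (y + z) + fund_sol L (t - h) x (y - z) - 2 * fund_sol L t x y
         \<ge> - (C / t) * (h\<^sup>2 + (norm z)\<^sup>2)"
    proof (intro exI[of _ K'] conjI K' allI ballI)
      have sc: "fund_sol L (t + h) x (y + z) + fund_sol L (t - h) x (y - z) - 2 * fund_sol L t x y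
         \<ge> - (K' / t) * (h\<^sup>2 + (norm z)\<^sup>2)"
        if "(t, y) \<in> S_cone lam x (T / 2)" "h \<in> {0..<t/2}" "z \<in> ball 0 (lam * t)" for t h and x y z :: "real^'n"
      proof -
        have "\<bar>fund_sol L (t + h) (x + 0) (y + z) + fund_sol L (t - h) (x - 0) (y - z) - 2 * fund_sol L t x y\<bar>
          \<le> K' / t * (h\<^sup>2 + (norm (0::real^'n))\<^sup>2 + (norm z)\<^sup>2)"
          unfolding K'_def using that lam by (intro second_difference_abs) (auto simp: S_cone_def)
        then show ?thesis by simp
      qed
      fix x :: "real^'n" and p assume "p \<in> S_cone lam x (T / 2)"
      then show "case p of (t, y) \<Rightarrow> \<forall>h\<in>{0..<t/2}. \<forall>z\<in>ball 0 (lam * t).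
         fund_sol L (t + h) x (y + z) + fund_sol L (t - h) x (y - z) - 2 * fund_sol L t x y
         \<ge> - (K' / t) * (h\<^sup>2 + (norm z)\<^sup>2)"
        by (cases p) (simp only: prod.case, use sc in blast)
    qed
    show "\<exists>C'>0. \<forall>t\<in>{0<..T / 2}. \<forall>x. \<forall>y\<in>ball x (lam * t). \<forall>z\<in>ball 0 (lam * t).
       fund_sol L t x (y + z) + fund_sol L t x (y - z) - 2 * fund_sol L t x y
         \<ge> C' / t * (norm z)\<^sup>2"
    proof (intro exI[of _ "lb.\<kappa> / 8"] conjI ballI allI)
      show "lb.\<kappa> / 8 > 0" using lb.\<kappa>_pos by simp
      fix t :: real and x y z :: "real^'n"
      assume t: "t \<in> {0<..T / 2}" and y: "y \<in> ball x (lam * t)" and z: "z \<in> ball 0 (lam * t)"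
      have n: "norm (y - x) \<le> lam * t" "norm z \<le> lam * t" "0 \<le> lam * t"
        using y z t lam by (auto simp: dist_norm norm_minus_commute)
      have "norm (y + z - x) \<le> 6 * lam * t" using norm_triangle_ineq[of "y - x" z] n by (simp add: algebra_simps)
      moreover have "norm (y - z - x) \<le> 6 * lam * t" using norm_triangle_ineq4[of "y - x" z] n by (simp add: algebra_simps)
      ultimately show "fund_sol L t x (y + z) + fund_sol L t x (y - z) - 2 * fund_sol L t x y \<ge> lb.\<kappa> / 8 / t * (norm z)\<^sup>2"
        using t by (intro uniform_convexity) auto
    qed
    show "\<forall>x. C11_loc (\<lambda>(t, y). fund_sol L t x y) (S_cone lam x (T / 2)) \<and>
         C11_loc (\<lambda>(t, y). fund_sol L t y x) (S_cone lam x (T / 2))"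
    proof (intro allI conjI)
      fix x :: "real^'n"
      show "C11_loc (\<lambda>(t, y). fund_sol L t x y) (S_cone lam x (T / 2))"
      proof (rule C11_loc_S_cone[OF lam, where K = K' and M = "C + mesh_const"])
        show "\<bar>(case (t + h, y + z) of (t, y) \<Rightarrow> fund_sol L t x y) + (case (t - h, y - z) of (t, y) \<Rightarrow> fund_sol L t x y)
            - 2 * (case (t, y) of (t, y) \<Rightarrow> fund_sol L t x y)\<bar> \<le> K' / t * (h\<^sup>2 + (norm z)\<^sup>2)"
          if "0 < t" "t < T / 2" "norm (y - x) \<le> lam * t" "\<bar>h\<bar> \<le> t / 2" "norm z \<le> lam * t" for t y h and z :: "real^'n"
          using second_difference_abs[of t h y x 0 z] that lam unfolding K'_def by simp
        show "\<bar>case (t, y) of (t, y) \<Rightarrow> fund_sol L t x y\<bar> \<le> C + mesh_const"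
          if "0 < t" "t < T / 2" "norm (y - x) \<le> lam * t" for t y
          using fund_sol_bounded[of t y x] far[of "y - x" t] that by simp
      qed (use K' in simp)
      \<comment> \<open>The same two-sided estimate, now with the initial point shifted and the
        final point fixed.\<close>
      show "C11_loc (\<lambda>(t, y). fund_sol L t y x) (S_cone lam x (T / 2))"
      proof (rule C11_loc_S_cone[OF lam, where K = K' and M = "C + mesh_const"])
        show "\<bar>(case (t + h, y + z) of (t, y) \<Rightarrow> fund_sol L t y x) + (case (t - h, y - z) of (t, y) \<Rightarrow> fund_sol L t y x)
            - 2 * (case (t, y) of (t, y) \<Rightarrow> fund_sol L t y x)\<bar> \<le> K' / t * (h\<^sup>2 + (norm z)\<^sup>2)"
          if "0 < t" "t < T / 2" "norm (y - x) \<le> lam * t" "\<bar>h\<bar> \<le> t / 2" "norm z \<le> lam * t" for t y h and z :: "real^'n"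
          using second_difference_abs[of t h x y z 0] that lam unfolding K'_def by (simp add: norm_minus_commute)
        show "\<bar>case (t, y) of (t, y) \<Rightarrow> fund_sol L t y x\<bar> \<le> C + mesh_const"
          if "0 < t" "t < T / 2" "norm (y - x) \<le> lam * t" for t y
          using fund_sol_bounded[of t x y] far[of "x - y" t] that by (simp add: norm_minus_commute)
      qed (use K' in simp)
    qed
  qed
qed

end
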